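(* Let $G$ be a random $(d_1,d_2)$-biregular bipartite graph with cycle counts $(C_k)_{k\geq2}$, and let $(Z_k)_{k\geq2}$ be independent Poisson random variables with $\mathbb E Z_k=\mu_k:=\frac{(d_1-1)^k(d_2-1)^k}{2k}$. There is an absolute constant $c_6>0$ such that for any $n,m\geq1$, $r\geq2$ and $d_1\geq3$, $$d_{\mathrm{TV}}\big((C_2,\dots,C_r),(Z_2,\dots,Z_r)\big)\leq\frac{c_6\sqrt r\,(d_1-1)^{3r/2}(d_2-1)^{3r/2}}{nd_1}.$$
   Context: A $(d_1,d_2)$-biregular bipartite graph on $V_1=[n]$, $V_2=[m]$ is a simple bipartite graph in which all vertices of $V_1$ have degree $d_1$ and all vertices of $V_2$ have degree $d_2$ ($nd_1=md_2$); a random one is chosen uniformly among all such graphs. A cycle means a simple cycle (all vertices distinct); $C_k$ is the number of cycles of length $2k$ in $G$. $d_{\mathrm{TV}}$ denotes total variation distance. *)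

theory Defs
  imports "HOL-Probability.Probability"
begin

text \<open>A simple bipartite graph between V1 = {0..<n} and V2 = {0..<m} is represented by its
  edge set E, a set of pairs (u,v) with u in V1 and v in V2.\<close>

definition biregular :: "nat \<Rightarrow> nat \<Rightarrow> nat \<Rightarrow> nat \<Rightarrow> (nat \<times> nat) set \<Rightarrow> bool" where
  "biregular n m d1 d2 E \<longleftrightarrow>
     E \<subseteq> {0..<n} \<times> {0..<m} \<and>
     (\<forall>u\<in>{0..<n}. card {v. (u, v) \<in> E} = d1) \<and>
     (\<forall>v\<in>{0..<m}. card {u. (u, v) \<in> E} = d2)"

definition biregular_graphs :: "nat \<Rightarrow> nat \<Rightarrow> nat \<Rightarrow> nat \<Rightarrow> (nat \<times> nat) set set" where
  "biregular_graphs n m d1 d2 = {E. biregular n m d1 d2 E}"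

text \<open>The edge set of the cycle u_0 v_0 u_1 v_1 ... u_{k-1} v_{k-1} u_0 (length 2k).\<close>
definition cycle_edges :: "nat \<Rightarrow> (nat \<Rightarrow> nat) \<Rightarrow> (nat \<Rightarrow> nat) \<Rightarrow> (nat \<times> nat) set" where
  "cycle_edges k u v = (\<lambda>i. (u i, v i)) ` {0..<k} \<union> (\<lambda>i. (u ((i + 1) mod k), v i)) ` {0..<k}"

text \<open>Cycles of length 2k in E (k \<ge> 2), identified with their edge sets: simple cycles
  (all vertices distinct) whose edges all lie in E.\<close>
definition cycles :: "nat \<Rightarrow> (nat \<times> nat) set \<Rightarrow> (nat \<times> nat) set set" where
  "cycles k E = {C. \<exists>u v. inj_on u {0..<k} \<and> inj_on v {0..<k} \<and>
                        C = cycle_edges k u v \<and> C \<subseteq> E}"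

definition cycle_count :: "nat \<Rightarrow> (nat \<times> nat) set \<Rightarrow> nat" where
  "cycle_count k E = card (cycles k E)"

definition poisson :: "real \<Rightarrow> nat pmf" where
  "poisson \<mu> = (if \<mu> > 0 then poisson_pmf \<mu> else return_pmf 0)"

definition d_TV :: "'a pmf \<Rightarrow> 'a pmf \<Rightarrow> real" where
  "d_TV p q = (SUP A. \<bar>measure_pmf.prob p A - measure_pmf.prob q A\<bar>)"

definition mu :: "nat \<Rightarrow> nat \<Rightarrow> nat \<Rightarrow> real" where
  "mu d1 d2 k = (real d1 - 1) ^ k * (real d2 - 1) ^ k / (2 * real k)"

definition cycle_law :: "nat \<Rightarrow> nat \<Rightarrow> nat \<Rightarrow> nat \<Rightarrow> nat \<Rightarrow> (nat \<Rightarrow> nat) pmf" where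
  "cycle_law n m d1 d2 r =
     map_pmf (\<lambda>E k. if k \<in> {2..r} then cycle_count k E else 0)
             (pmf_of_set (biregular_graphs n m d1 d2))"

definition poisson_law :: "nat \<Rightarrow> nat \<Rightarrow> nat \<Rightarrow> (nat \<Rightarrow> nat) pmf" where
  "poisson_law d1 d2 r = Pi_pmf {2..r} 0 (\<lambda>k. poisson (mu d1 d2 k))"

end

theory Submission
  imports Defs
begin

text \<open>Stein's method with a switching that destroys or creates a single cycle. Let \<open>D = (d1 - 1)(d2 - 1)\<close>.
  Choose a cycle of length \<open>2k\<close>, one of its edges \<open>(a, b)\<close> and a further edge \<open>(c, d)\<close>, and replace these
  two edges by \<open>(a, d)\<close> and \<open>(c, b)\<close>. There are \<open>2k C\<^sub>k n d1\<close> choices. In the new graph the rest of the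
  cycle has become a path with \<open>2k + 1\<close> edges whose two end edges can be switched back, and a graph has
  exactly \<open>n d1 D^k\<close> nonbacktracking walks with \<open>2k + 1\<close> edges. The ratio of the two numbers is \<open>C\<^sub>k / \<mu>\<^sub>k\<close>,
  so if every switching changed the short cycle counts by that one cycle only, the counts would satisfy the
  Stein equation of the Poisson law exactly.

  A switching fails only near a subgraph with more edges than a tree or a cycle allows. A switching bound on
  the probability that a random graph contains a given set of edges shows that the expected number of copies
  of a graph with \<open>V\<close> vertices and \<open>V + t\<close> edges is of order \<open>D^(V/2 + t) / (n d1)^t\<close>. This makes the
  error for \<open>C\<^sub>k\<close> of order \<open>D^(2k) / (n d1)\<close>, and the factor \<open>\<mu>\<^sub>k^(-1/2)\<close> from the solution of the Stein
  equation turns it into \<open>k^(1/2) D^(3k/2) / (n d1)\<close>. If \<open>n d1\<close> is small compared with \<open>r^2 D\<close>,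
  the claimed bound exceeds 1.\<close>

section \<open>Stein's equation for products of Poisson laws\<close>

text \<open>The Stein equation for length \<open>2k\<close> has only the shorter counts as
  parameters, so a switching must keep the cycles shorter than \<open>2k\<close> and may change
  longer ones freely; obstructions then come from cycles of length at most \<open>2k\<close> only.
  Most obstructions are reduced to an ear: a path that leaves the cycle, or the path left by the
  switching, at position \<open>p\<close> and returns at position \<open>q\<close> after
  \<open>s\<close> new vertices. Such a configuration spoils about \<open>D^(k + 1 + s/2)\<close>
  switchings. A plain union bound would charge a factor \<open>k\<close> for \<open>p\<close> and
  another for \<open>q\<close>. But a competing short path that agrees with the given one for
  \<open>p\<close> steps has that many fewer steps left for the ear, so the sum over
  \<open>p\<close> and \<open>s\<close> is geometric. Only \<open>q\<close> costs a factor
  \<open>k\<close>, which cancels against the \<open>2k\<close> choices of the switched edge. The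
  numbers of switchings are bounded from above in every graph, but from below only on average. Since
  the defects therefore have one sign, this is enough.\<close>

lemma poisson_lower_tail_ratio:
  fixes l :: real
  assumes l: "l \<ge> 1" and j: "real j \<le> l"
  defines "p \<equiv> \<lambda>i. l ^ i / fact i * exp (- l)"
  shows "(\<Sum>i\<le>j. p i) \<le> 2 * sqrt l * p j"
proof -
  have pos: "p i > 0" for i using l by (simp add: p_def)
  have rec: "p (Suc i) = l / real (Suc i) * p i" for i
    by (simp add: p_def field_simps)
  have s1: "sqrt l \<ge> 1" and ss: "sqrt l * sqrt l = l" using l by auto
  \<comment> \<open>The ratio \<open>p (i - 1) / p i = i / l\<close> is at most
    \<open>1 - 1 / sqrt l\<close> for \<open>i \<le> l - sqrt l\<close>, so the sum up to there is
    geometric with bound \<open>sqrt l\<close>. In the remaining window of width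
    \<open>sqrt l\<close> each step adds at most 1; the \<open>max\<close> term counts these
    steps.\<close>
  have "(\<Sum>i\<le>j. p i) \<le> (sqrt l + max 0 (real j - (l - sqrt l))) * p j"
    using j
  proof (induction j)
    case 0
    have "1 * p 0 \<le> (sqrt l + max 0 (real 0 - (l - sqrt l))) * p 0"
      using s1 pos[of 0] max.cobounded1[of 0 "real 0 - (l - sqrt l)"]
      by (intro mult_right_mono; linarith)
    then show ?case by simp
  next
    case (Suc j)
    define a where "a = sqrt l + max 0 (real j - (l - sqrt l))"
    define b where "b = sqrt l + max 0 (real (Suc j) - (l - sqrt l))"
    have "(\<Sum>i\<le>Suc j. p i) \<le> a * p j + p (Suc j)"
      using Suc by (simp add: a_def)
    also have "p j = real (Suc j) / l * p (Suc j)"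
      using l by (simp add: rec)
    also have "a * (real (Suc j) / l * p (Suc j)) + p (Suc j) = (a * (real (Suc j) / l) + 1) * p (Suc j)"
      by (simp add: algebra_simps)
    also have "a * (real (Suc j) / l) + 1 \<le> b"
    proof (cases "real (Suc j) \<le> l - sqrt l")
      case True
      then have "a = sqrt l" "b = sqrt l" by (auto simp: a_def b_def)
      moreover have "sqrt l * (real (Suc j) / l) \<le> sqrt l * ((l - sqrt l) / l)"
        using True s1 l by (intro mult_left_mono divide_right_mono) auto
      moreover have "sqrt l * ((l - sqrt l) / l) = sqrt l - 1"
        using l ss by (simp add: field_simps)
      ultimately show ?thesis by simp
    next
      case False
      have a0: "a \<ge> 0" using s1 by (auto simp: a_def)
      have "a * (real (Suc j) / l) \<le> a * 1"
        using Suc.prems l a0 by (intro mult_left_mono) auto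
      moreover have "a + 1 \<le> b \<or> a = sqrt l" using False by (auto simp: a_def b_def)
      \<comment> \<open>The window is entered here, and \<open>b\<close> exceeds
        \<open>sqrt l\<close> only by the part of the step inside it.\<close>
      moreover have "a * (real (Suc j) / l) + 1 \<le> b" if "a = sqrt l"
      proof -
        have "sqrt l * (real (Suc j) / l) = sqrt l - (l - real (Suc j)) / sqrt l"
          using l ss s1 by (simp add: field_simps)
        moreover have "1 - (l - real (Suc j)) / sqrt l = (real (Suc j) - (l - sqrt l)) / sqrt l"
          using s1 by (simp add: field_simps)
        moreover have "\<dots> \<le> (real (Suc j) - (l - sqrt l)) / 1"
          using False s1 by (intro divide_left_mono) auto
        ultimately show ?thesis using that False by (auto simp: b_def)
      qed
      ultimately show ?thesis by linarith
    qed
    finally show ?case using pos[of "Suc j"] by (simp add: b_def mult_right_mono)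
  qed
  also have "\<dots> \<le> (2 * sqrt l) * p j"
    using j s1 pos[of j] by (intro mult_right_mono) auto
  finally show ?thesis .
qed

text \<open>The same comparison above the mean, where \<open>p (i + 1) / p i = l / (i + 1)\<close>,
  run downwards. The cutoff \<open>N\<close> gives the induction a starting point;
  \<open>poisson_stein_solution\<close> lets it tend to infinity.\<close>

lemma poisson_upper_tail_ratio:
  fixes l :: real
  assumes l: "l \<ge> 1" and j: "real j \<ge> l" and "j \<le> N"
  defines "p \<equiv> \<lambda>i. l ^ i / fact i * exp (- l)"
  shows "(\<Sum>i\<in>{j<..N}. p i) \<le> 2 * sqrt l * p j"
proof -
  have pos: "p i > 0" for i using l by (simp add: p_def)
  have rec: "p (Suc i) = l / real (Suc i) * p i" for i
    by (simp add: p_def field_simps)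
  have s1: "sqrt l \<ge> 1" and ss: "sqrt l * sqrt l = l" using l by auto
  have "(\<Sum>i\<in>{j<..N}. p i) \<le> (sqrt l + max 0 (l + sqrt l - real j)) * p j"
    using \<open>j \<le> N\<close> j
  proof (induction j rule: inc_induct)
    case base
    show ?case using pos[of N] s1 by simp
  next
    case (step j)
    define a where "a = sqrt l + max 0 (l + sqrt l - real (Suc j))"
    define b where "b = sqrt l + max 0 (l + sqrt l - real j)"
    have a0: "a \<ge> 0" using s1 by (auto simp: a_def)
    have "{j<..N} = insert (Suc j) {Suc j<..N}" using step by auto
    then have "(\<Sum>i\<in>{j<..N}. p i) = p (Suc j) + (\<Sum>i\<in>{Suc j<..N}. p i)" by simp
    also have "\<dots> \<le> p (Suc j) + a * p (Suc j)"
      using step by (simp add: a_def)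
    also have "\<dots> = (l / real (Suc j) * (1 + a)) * p j"
      by (simp add: rec algebra_simps add_divide_distrib)
    also have "l / real (Suc j) * (1 + a) \<le> b"
    proof (cases "real (Suc j) \<ge> l + sqrt l")
      case True
      then have "a = sqrt l" by (auto simp: a_def)
      moreover have "l / real (Suc j) * (1 + sqrt l) \<le> l / (l + sqrt l) * (1 + sqrt l)"
        using True s1 l by (intro mult_right_mono divide_left_mono mult_pos_pos add_pos_pos) auto
      moreover have "l / (l + sqrt l) * (1 + sqrt l) = sqrt l"
      proof -
        have "l * (1 + sqrt l) = sqrt l * (l + sqrt l)" using ss by (simp add: algebra_simps)
        moreover have "l + sqrt l \<noteq> 0" using s1 l by linarith
        ultimately show ?thesis by (simp add: nonzero_divide_eq_eq)
      qed
      moreover have "b \<ge> sqrt l" by (simp add: b_def)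
      ultimately show ?thesis by simp
    next
      case False
      have "l / real (Suc j) * (1 + a) \<le> 1 * (1 + a)"
        using step.prems l a0 by (intro mult_right_mono) auto
      moreover have "1 + a = b" using False by (auto simp: a_def b_def)
      ultimately show ?thesis by simp
    qed
    finally show ?case using pos[of j] by (simp add: b_def mult_right_mono)
  qed
  also have "\<dots> \<le> (2 * sqrt l) * p j"
    using j s1 pos[of j] by (intro mult_right_mono) auto
  finally show ?thesis .
qed

text \<open>Multiplied by \<open>p j\<close>, the equation telescopes, so the solution is the
  partial sum \<open>S\<close> of \<open>(h - E) * p\<close> divided by \<open>l * p\<close>. Since
  \<open>h - E\<close> has mean zero, \<open>S j\<close> is also minus the sum over the tail above
  \<open>j\<close>. The tail that does not cross the mean bounds it by
  \<open>2 * sqrt l * p j\<close>, and division by \<open>l * p j\<close> yields the gain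
  \<open>1 / sqrt l\<close>.\<close>

lemma poisson_stein_solution:
  fixes l :: real and h :: "nat \<Rightarrow> real"
  assumes l: "l \<ge> 1" and h: "\<And>j. 0 \<le> h j" "\<And>j. h j \<le> 1"
  obtains f where "\<And>j. l * f (Suc j) - real j * f j = h j - measure_pmf.expectation (poisson_pmf l) h"
    and "\<And>j. \<bar>f j\<bar> \<le> 2 / sqrt l"
proof -
  define P where "P = poisson_pmf l"
  define E where "E = measure_pmf.expectation P h"
  define p where "p = (\<lambda>i. l ^ i / fact i * exp (- l))"
  define S where "S = (\<lambda>j. \<Sum>i\<le>j. (h i - E) * p i)"
  \<comment> \<open>The value at 0 is free, since the equation multiplies it by 0.\<close>
  define f where "f = (\<lambda>j. case j of 0 \<Rightarrow> 0 | Suc i \<Rightarrow> S i / (l * p i))"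
  have pmfP: "pmf P i = p i" for i using l by (simp add: P_def p_def)
  have pos: "p i > 0" for i using l by (simp add: p_def)
  have rec: "p (Suc i) = l / real (Suc i) * p i" for i
    by (simp add: p_def field_simps)
  have intb: "integrable (measure_pmf P) g" if "\<And>x. \<bar>g x\<bar> \<le> 1" for g :: "nat \<Rightarrow> real"
    using that by (intro measure_pmf.integrable_const_bound[where B=1]) auto
  have inth: "integrable (measure_pmf P) h"
    using h by (intro intb) auto
  have E: "0 \<le> E" "E \<le> 1"
    unfolding E_def using h inth
    by (auto intro!: measure_pmf.integral_le_const Bochner_Integration.integral_nonneg)
  have hE: "\<bar>h i - E\<bar> \<le> 1" for i using h[of i] E by auto
  have meas: "measure_pmf.prob P A = (\<Sum>i\<in>A. p i)" if "finite A" for A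
    using that by (simp add: measure_measure_pmf_finite pmfP)
  have eq: "l * f (Suc j) - real j * f j = h j - E" for j
  proof (cases j)
    case 0
    then show ?thesis using l pos[of 0] by (simp add: f_def S_def)
  next
    case (Suc i)
    have "real (Suc i) * f (Suc i) = S i / p (Suc i)"
      using l pos[of i] by (simp add: f_def rec field_simps)
    moreover have "l * f (Suc (Suc i)) = S (Suc i) / p (Suc i)"
      using l pos[of "Suc i"] by (simp add: f_def)
    moreover have "S (Suc i) / p (Suc i) - S i / p (Suc i) = h (Suc i) - E"
      using pos[of "Suc i"] by (simp add: S_def field_simps)
    ultimately show ?thesis using Suc by simp
  qed
  have Sb: "\<bar>S j\<bar> \<le> 2 * sqrt l * p j" for j
  proof (cases "real j \<le> l")
    case True
    have "\<bar>S j\<bar> \<le> (\<Sum>i\<le>j. \<bar>(h i - E) * p i\<bar>)" unfolding S_def by (rule sum_abs)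
    also have "\<dots> \<le> (\<Sum>i\<le>j. 1 * p i)"
      unfolding abs_mult using hE pos less_imp_le[OF pos] by (intro sum_mono mult_mono) auto
    also have "\<dots> \<le> 2 * sqrt l * p j"
      using poisson_lower_tail_ratio[OF l True] by (simp add: p_def)
    finally show ?thesis .
  next
    case False
    define g where "g = (\<lambda>i. h i - E)"
    have intg: "integrable (measure_pmf P) (\<lambda>i. g i * indicator A i)" for A
      by (intro intb) (auto simp: g_def indicator_def hE)
    have "0 = measure_pmf.expectation P g"
      unfolding g_def using inth by (simp add: E_def)
    also have "\<dots> = measure_pmf.expectation P (\<lambda>i. g i * indicator {..j} i + g i * indicator {j<..} i)"
      by (intro Bochner_Integration.integral_cong) (auto simp: indicator_def)
    also have "\<dots> = measure_pmf.expectation P (\<lambda>i. g i * indicator {..j} i)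
        + measure_pmf.expectation P (\<lambda>i. g i * indicator {j<..} i)"
      using intg by (intro Bochner_Integration.integral_add) auto
    also have "measure_pmf.expectation P (\<lambda>i. g i * indicator {..j} i) = S j"
      by (subst integral_measure_pmf_real[where A="{..j}"]) (auto simp: S_def g_def pmfP indicator_def split: if_splits)
    finally have "\<bar>S j\<bar> = \<bar>measure_pmf.expectation P (\<lambda>i. g i * indicator {j<..} i)\<bar>" by linarith
    also have "\<dots> \<le> measure_pmf.expectation P (\<lambda>i. \<bar>g i * indicator {j<..} i\<bar>)"
      by (rule integral_abs_bound)
    also have "\<dots> \<le> measure_pmf.expectation P (indicator {j<..})"
      using hE by (intro integral_mono intb) (auto simp: g_def indicator_def)
    also have "\<dots> = measure_pmf.prob P {j<..}" by simp
    also have "\<dots> \<le> 2 * sqrt l * p j"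
    proof (rule LIMSEQ_le_const2)
      have "{j<..} = (\<Union>N. {j<..N})" by auto
      then show "(\<lambda>N. measure_pmf.prob P {j<..N}) \<longlonglongrightarrow> measure_pmf.prob P {j<..}"
        using measure_pmf.finite_Lim_measure_incseq[of "\<lambda>N. {j<..N}" P]
        by (simp add: incseq_def subset_iff)
      show "\<exists>N. \<forall>n\<ge>N. measure_pmf.prob P {j<..n} \<le> 2 * sqrt l * p j"
        using poisson_upper_tail_ratio[OF l, of j] False by (intro exI[of _ j]) (auto simp: meas p_def)
    qed
    finally show ?thesis .
  qed
  have "\<bar>f j\<bar> \<le> 2 / sqrt l" for j
  proof (cases j)
    case 0 then show ?thesis using l by (simp add: f_def)
  next
    case (Suc i)
    have "\<bar>f j\<bar> = \<bar>S i\<bar> / (l * p i)" using Suc l pos[of i] by (simp add: f_def abs_mult)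
    also have "\<dots> \<le> 2 * sqrt l * p i / (l * p i)"
      using Sb l pos[of i] by (intro divide_right_mono) auto
    also have "\<dots> = 2 * (sqrt l / l)" using pos[of i] by simp
    also have "sqrt l / l = 1 / sqrt l" using l by (simp add: field_simps)
    finally show ?thesis by simp
  qed
  with eq show ?thesis using that unfolding E_def P_def by blast
qed

lemma measure_bind_pmf:
  "measure_pmf.prob (bind_pmf M N) X = measure_pmf.expectation M (\<lambda>x. measure_pmf.prob (N x) X)"
proof -
  have "ennreal (measure_pmf.prob (bind_pmf M N) X) = (\<integral>\<^sup>+x. ennreal (measure_pmf.prob (N x) X) \<partial>M)"
    unfolding measure_pmf.emeasure_eq_measure[symmetric] by simp
  also have "\<dots> = ennreal (measure_pmf.expectation M (\<lambda>x. measure_pmf.prob (N x) X))"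
    by (intro nn_integral_eq_integral measure_pmf.integrable_const_bound[where B=1]) auto
  finally show ?thesis by (simp add: Bochner_Integration.integral_nonneg)
qed

text \<open>Replace the coordinates of the Poisson vector one at a time. When coordinate \<open>k\<close> is
  replaced, the Stein equation is solved in that coordinate, with the earlier coordinates as
  parameters and the later ones integrated out.\<close>

lemma d_TV_poisson_product:
  fixes W :: "'g \<Rightarrow> nat \<Rightarrow> nat" and l B :: "nat \<Rightarrow> real"
  assumes fin: "finite S" "S \<noteq> {}"
    and supp: "\<And>G i. G \<in> S \<Longrightarrow> i \<notin> {2..r} \<Longrightarrow> W G i = 0"
    and l: "\<And>k. k \<in> {2..r} \<Longrightarrow> l k \<ge> 1"
    and step: "\<And>k f b. k \<in> {2..r} \<Longrightarrow> (\<And>w j. \<bar>f w j\<bar> \<le> b) \<Longrightarrow>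
       (\<And>w w'. (\<And>i. i \<in> {2..<k} \<Longrightarrow> w i = w' i) \<Longrightarrow> f w = f w') \<Longrightarrow>
       \<bar>\<Sum>G\<in>S. l k * f (W G) (Suc (W G k)) - real (W G k) * f (W G) (W G k)\<bar>
         \<le> real (card S) * (b * B k)"
  shows "d_TV (map_pmf W (pmf_of_set S)) (Pi_pmf {2..r} 0 (\<lambda>k. poisson_pmf (l k)))
           \<le> (\<Sum>k=2..r. 2 / sqrt (l k) * B k)"
proof -
  define Q where "Q = (\<lambda>k. poisson_pmf (l k))"
  define \<beta> where "\<beta> = (\<lambda>k. 2 / sqrt (l k) * B k)"
  have main: "\<bar>measure_pmf.prob (map_pmf W (pmf_of_set S)) A - measure_pmf.prob (Pi_pmf {2..r} 0 Q) A\<bar>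
       \<le> (\<Sum>k=2..r. \<beta> k)" for A
  proof -
    \<comment> \<open>\<open>H k\<close> interpolates between the two laws: coordinates up to
      \<open>k\<close> are read from \<open>w\<close>, the later ones are independent Poisson
      variables. Averaged over \<open>S\<close> it is the probability of \<open>A\<close> under the
      law of \<open>W\<close> for \<open>k = r\<close> and under the Poisson law for
      \<open>k = 1\<close>.\<close>
    define H where "H = (\<lambda>k w. measure_pmf.prob (Pi_pmf {k<..r} 0 Q)
        {z. (\<lambda>i. if i \<in> {2..k} then w i else z i) \<in> A})"
    have H01: "0 \<le> H k w" "H k w \<le> 1" for k w by (auto simp: H_def)
    have Hcong: "H k w = H k w'" if "\<And>i. i \<in> {2..k} \<Longrightarrow> w i = w' i" for k w w'
    proof -
      have "(\<lambda>i. if i \<in> {2..k} then w i else z i) = (\<lambda>i. if i \<in> {2..k} then w' i else z i)" for z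
        using that by auto
      then show ?thesis by (simp only: H_def)
    qed
    have Hstep: "H (k - 1) w = measure_pmf.expectation (Q k) (\<lambda>y. H k (w(k := y)))"
      if k: "k \<in> {2..r}" for k w
    proof -
      have ins: "{k - 1<..r} = insert k {k<..r}" using k by auto
      have fn: "(\<lambda>i. if i \<in> {2..k-1} then w i else (z(k := y)) i) =
          (\<lambda>i. if i \<in> {2..k} then (w(k := y)) i else z i)" for y z
        using k by (auto simp: fun_eq_iff)
      have "Pi_pmf {k - 1<..r} 0 Q = bind_pmf (Q k) (\<lambda>y. map_pmf (\<lambda>z. z(k := y)) (Pi_pmf {k<..r} 0 Q))"
        unfolding ins by (subst Pi_pmf_insert') (auto simp: map_pmf_def)
      then have "H (k - 1) w = measure_pmf.expectation (Q k)
          (\<lambda>y. measure_pmf.prob (map_pmf (\<lambda>z. z(k := y)) (Pi_pmf {k<..r} 0 Q))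
             {z. (\<lambda>i. if i \<in> {2..k-1} then w i else z i) \<in> A})"
        by (simp add: H_def measure_bind_pmf)
      also have "\<dots> = measure_pmf.expectation (Q k) (\<lambda>y. H k (w(k := y)))"
        unfolding H_def by (simp only: measure_map_pmf vimage_Collect_eq fn)
      finally show ?thesis .
    qed
    define av where "av = (\<lambda>k. (\<Sum>G\<in>S. H k (W G)) / real (card S))"
    have cS: "real (card S) > 0" using fin by (simp add: card_gt_0_iff)
    have diff: "\<bar>av k - av (k - 1)\<bar> \<le> \<beta> k" if k: "k \<in> {2..r}" for k
    proof -
      have "\<exists>f. (\<forall>j. l k * f (Suc j) - real j * f j
            = H k (w(k := j)) - measure_pmf.expectation (poisson_pmf (l k)) (\<lambda>j. H k (w(k := j))))
           \<and> (\<forall>j. \<bar>f j\<bar> \<le> 2 / sqrt (l k))" for w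
        using poisson_stein_solution[OF l[OF k], of "\<lambda>j. H k (w(k := j))"] H01 by metis
      then obtain f0 where f0: "\<And>w j. l k * f0 w (Suc j) - real j * f0 w j
            = H k (w(k := j)) - measure_pmf.expectation (poisson_pmf (l k)) (\<lambda>j. H k (w(k := j)))"
           "\<And>w j. \<bar>f0 w j\<bar> \<le> 2 / sqrt (l k)" by metis
      \<comment> \<open>\<open>f0\<close> is chosen separately for each \<open>w\<close>.
        Overwriting the coordinates from \<open>k\<close> on by 0 makes the choice depend on the
        earlier ones only, as \<open>step\<close> demands.\<close>
      define f where "f = (\<lambda>w. f0 (\<lambda>i. if i \<in> {2..<k} then w i else 0))"
      have f: "l k * f w (Suc (w k)) - real (w k) * f w (w k) = H k w - H (k - 1) w" for w
      proof -
        let ?w = "\<lambda>i. if i \<in> {2..<k} then w i else 0"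
        have eq: "H k (?w(k := j)) = H k (w(k := j))" for j
          by (rule Hcong) auto
        have "l k * f w (Suc (w k)) - real (w k) * f w (w k)
            = H k (w(k := w k)) - measure_pmf.expectation (Q k) (\<lambda>j. H k (w(k := j)))"
          unfolding f_def f0(1) eq Q_def ..
        also have "\<dots> = H k w - H (k - 1) w" using Hstep[OF k, of w] by simp
        finally show ?thesis .
      qed
      have "\<bar>\<Sum>G\<in>S. l k * f (W G) (Suc (W G k)) - real (W G k) * f (W G) (W G k)\<bar>
         \<le> real (card S) * (2 / sqrt (l k) * B k)"
      proof (rule step[OF k])
        show "\<bar>f w j\<bar> \<le> 2 / sqrt (l k)" for w j by (simp add: f_def f0)
        show "f w = f w'" if "\<And>i. i \<in> {2..<k} \<Longrightarrow> w i = w' i" for w w'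
        proof -
          have "(\<lambda>i. if i \<in> {2..<k} then w i else 0) = (\<lambda>i. if i \<in> {2..<k} then w' i else 0)"
            using that by auto
          then show ?thesis by (simp only: f_def)
        qed
      qed
      then have "\<bar>\<Sum>G\<in>S. H k (W G) - H (k - 1) (W G)\<bar> \<le> real (card S) * \<beta> k"
        by (simp only: f \<beta>_def)
      moreover have "av k - av (k - 1) = (\<Sum>G\<in>S. H k (W G) - H (k - 1) (W G)) / real (card S)"
        by (simp add: av_def sum_subtractf diff_divide_distrib)
      ultimately show ?thesis using cS by (simp add: abs_divide pos_divide_le_eq mult.commute)
    qed
    have tele: "\<bar>av k - av 1\<bar> \<le> (\<Sum>i=2..k. \<beta> i)" if "1 \<le> k" "k \<le> r" for k
      using that
    proof (induction k rule: dec_induct)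
      case base then show ?case by simp
    next
      case (step k)
      have "\<bar>av (Suc k) - av k\<bar> \<le> \<beta> (Suc k)" using diff[of "Suc k"] step by simp
      then show ?case using step by (auto simp: sum.cl_ivl_Suc)
    qed
    show ?thesis
    proof (cases "r \<ge> 1")
      case True
      have "H r (W G) = indicator A (W G)" if "G \<in> S" for G
      proof -
        have "(\<lambda>i. if i \<in> {2..r} then W G i else 0) = W G" using supp[OF that] by auto
        then show ?thesis by (simp add: H_def indicator_def del: atLeastAtMost_iff)
      qed
      then have "av r = measure_pmf.prob (map_pmf W (pmf_of_set S)) A"
        using fin by (simp add: av_def measure_pmf_of_set sum.If_cases indicator_def vimage_def Int_def)
      moreover have "{Suc 0<..r} = {2..r}" by auto
      then have "H 1 w = measure_pmf.prob (Pi_pmf {2..r} 0 Q) A" for w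
        by (simp add: H_def del: atLeastAtMost_iff)
      then have "av 1 = measure_pmf.prob (Pi_pmf {2..r} 0 Q) A"
        using cS by (simp add: av_def)
      ultimately show ?thesis using tele[of r] True by simp
    next
      case False
      have "W G = (\<lambda>_. 0)" if "G \<in> S" for G using supp[OF that] False by auto
      then have "map_pmf W (pmf_of_set S) = map_pmf (\<lambda>_. \<lambda>_. 0) (pmf_of_set S)"
        using fin by (intro map_pmf_cong) auto
      then show ?thesis using False by (simp add: map_pmf_const)
    qed
  qed
  show ?thesis
    unfolding d_TV_def using main unfolding Q_def \<beta>_def by (intro cSUP_least) auto
qed

section \<open>Paths and cycles as vertex lists\<close>

text \<open>Left vertices are \<open>Inl u\<close> and right vertices are \<open>Inr v\<close>. The edge \<open>ed x y\<close> is meaningful only if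
  \<open>x\<close> and \<open>y\<close> lie on different sides, which \<open>alt\<close> guarantees for consecutive entries of a list.\<close>

type_synonym graph = "(nat \<times> nat) set"
type_synonym walk = "(nat + nat) list"

definition ed :: "nat + nat \<Rightarrow> nat + nat \<Rightarrow> nat \<times> nat" where
  "ed x y = (if isl x then (projl x, projr y) else (projl y, projr x))"

fun pe :: "walk \<Rightarrow> graph" where
  "pe (x # y # zs) = insert (ed x y) (pe (y # zs))"
| "pe _ = {}"

definition alt :: "walk \<Rightarrow> bool" where
  "alt xs = successively (\<lambda>x y. isl x \<noteq> isl y) xs"

lemma alt_simps [simp]:
  "alt []" "alt [x]" "alt (x # y # zs) \<longleftrightarrow> isl x \<noteq> isl y \<and> alt (y # zs)"
  by (auto simp: alt_def)

lemma alt_append: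
  "alt (xs @ ys) \<longleftrightarrow> alt xs \<and> alt ys \<and> (xs = [] \<or> ys = [] \<or> isl (last xs) \<noteq> isl (hd ys))"
  by (simp add: alt_def successively_append_iff)

definition is_path :: "graph \<Rightarrow> walk \<Rightarrow> bool" where
  "is_path E xs \<longleftrightarrow> distinct xs \<and> alt xs \<and> pe xs \<subseteq> E"

definition cyc :: "walk \<Rightarrow> graph" where
  "cyc xs = insert (ed (last xs) (hd xs)) (pe xs)"

lemma ed_commute: "isl x \<noteq> isl y \<Longrightarrow> ed x y = ed y x"
  by (auto simp: ed_def)

lemma ed_eq_iff:
  "isl x \<noteq> isl y \<Longrightarrow> isl x' \<noteq> isl y' \<Longrightarrow>
    ed x y = ed x' y' \<longleftrightarrow> (x = x' \<and> y = y') \<or> (x = y' \<and> y = x')"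
  by (cases x; cases y; cases x'; cases y') (auto simp: ed_def)

lemma ed_Inl [simp]: "ed (Inl u) (Inr v) = (u, v)" "ed (Inr v) (Inl u) = (u, v)"
  by (auto simp: ed_def)

lemma pe_Cons: "ys \<noteq> [] \<Longrightarrow> pe (x # ys) = insert (ed x (hd ys)) (pe ys)"
  by (cases ys) auto

lemma pe_append:
  "xs \<noteq> [] \<Longrightarrow> ys \<noteq> [] \<Longrightarrow> pe (xs @ ys) = insert (ed (last xs) (hd ys)) (pe xs \<union> pe ys)"
  by (induction xs rule: induct_list012) (auto simp: pe_Cons)

lemma pe_append_subset1: "pe xs \<subseteq> pe (xs @ ys)"
  and pe_append_subset2: "pe ys \<subseteq> pe (xs @ ys)"
  by (cases "xs = []"; cases "ys = []"; auto simp: pe_append)+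

lemma alt_Cons: "ys \<noteq> [] \<Longrightarrow> alt (x # ys) \<longleftrightarrow> isl x \<noteq> isl (hd ys) \<and> alt ys"
  by (cases ys) auto

lemma pe_rev: "alt xs \<Longrightarrow> pe (rev xs) = pe xs"
proof (induction xs)
  case (Cons x xs)
  show ?case
  proof (cases "xs = []")
    case False
    then have "ed (hd xs) x = ed x (hd xs)" "alt xs"
      using Cons.prems by (auto simp: alt_Cons intro!: ed_commute)
    then show ?thesis using Cons.IH False by (simp add: pe_append pe_Cons last_rev)
  qed simp
qed simp

lemma alt_rev: "alt (rev xs) = alt xs"
  unfolding alt_def successively_rev by (rule successively_cong) auto

lemma finite_pe [simp]: "finite (pe xs)"
  by (induction xs rule: pe.induct) auto

lemma pe_vertices:
  "alt xs \<Longrightarrow> isl a \<noteq> isl b \<Longrightarrow> ed a b \<in> pe xs \<Longrightarrow> a \<in> set xs \<and> b \<in> set xs"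
  by (induction xs rule: pe.induct) (auto simp: ed_eq_iff)

lemma card_pe: "distinct xs \<Longrightarrow> alt xs \<Longrightarrow> card (pe xs) = length xs - 1"
proof (induction xs rule: pe.induct)
  case (1 x y zs)
  have "ed x y \<notin> pe (y # zs)" using 1 pe_vertices[of "y # zs" x y] by auto
  then show ?case using 1 by simp
qed auto

lemma pe_split:
  "alt xs \<Longrightarrow> isl a \<noteq> isl b \<Longrightarrow> ed a b \<in> pe xs \<Longrightarrow>
    \<exists>as bs. xs = as @ bs \<and> as \<noteq> [] \<and> bs \<noteq> [] \<and>
       ((last as = a \<and> hd bs = b) \<or> (last as = b \<and> hd bs = a))"
proof (induction xs rule: pe.induct)
  case (1 x y zs)
  show ?case
  proof (cases "ed a b = ed x y")
    case True
    then show ?thesis using 1 by (intro exI[of _ "[x]"] exI[of _ "y # zs"]) (auto simp: ed_eq_iff)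
  next
    case False
    then obtain as bs where "y # zs = as @ bs" "as \<noteq> []" "bs \<noteq> []"
      "(last as = a \<and> hd bs = b) \<or> (last as = b \<and> hd bs = a)"
      using 1 by auto
    then show ?thesis by (intro exI[of _ "x # as"] exI[of _ bs]) auto
  qed
qed auto

lemma pe_neighbour:
  assumes "distinct xs" "alt xs" "i < length xs" "isl (xs ! i) \<noteq> isl y" "ed (xs ! i) y \<in> pe xs"
  shows "(Suc i < length xs \<and> y = xs ! Suc i) \<or> (i > 0 \<and> y = xs ! (i - 1))"
proof -
  obtain as bs where s: "xs = as @ bs" "as \<noteq> []" "bs \<noteq> []"
    "(last as = xs ! i \<and> hd bs = y) \<or> (last as = y \<and> hd bs = xs ! i)"
    using pe_split[OF assms(2,4,5)] by blast
  have l: "last as = xs ! (length as - 1)" and h: "hd bs = xs ! length as"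
    using s by (auto simp: nth_append last_conv_nth hd_conv_nth)
  have len: "length as < length xs" "length as > 0" using s by auto
  from s(4) show ?thesis
  proof
    assume a: "last as = xs ! i \<and> hd bs = y"
    have "length as - 1 < length xs" using len by linarith
    moreover have "xs ! (length as - 1) = xs ! i" using a l by simp
    ultimately have "i = length as - 1"
      using nth_eq_iff_index_eq[OF assms(1), of "length as - 1" i] assms(3) by blast
    then show ?thesis using a h len by simp
  next
    assume a: "last as = y \<and> hd bs = xs ! i"
    then have "i = length as"
      using nth_eq_iff_index_eq[OF assms(1), of "length as" i] assms(3) h len by metis
    then show ?thesis using a l len by simp
  qed
qed

lemma is_path_rev: "is_path E (rev xs) = is_path E xs"
  by (auto simp: is_path_def pe_rev alt_rev dest: pe_rev)

lemma is_path_appendD: "is_path E (xs @ ys) \<Longrightarrow> is_path E xs" "is_path E (xs @ ys) \<Longrightarrow> is_path E ys"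
  using pe_append_subset1[of xs ys] pe_append_subset2[of ys xs]
  by (auto simp: is_path_def alt_append)

text \<open>An ear on the path \<open>xs\<close>: it has one more new edge than new vertices, so it
  raises edges minus vertices by one. \<open>ys\<close> may be empty, which gives a chord, and
  \<open>p\<close> may lie after \<open>q\<close>.\<close>

definition excursion ::
  "graph \<Rightarrow> walk \<Rightarrow> nat \<Rightarrow> nat \<Rightarrow> walk \<Rightarrow> bool" where
  "excursion E xs p q ys \<longleftrightarrow> p < length xs \<and> q < length xs \<and> p \<noteq> q \<and> distinct ys \<and>
     set ys \<inter> set xs = {} \<and> alt (xs ! p # ys @ [xs ! q]) \<and>
     pe (xs ! p # ys @ [xs ! q]) \<subseteq> E \<and> pe (xs ! p # ys @ [xs ! q]) \<inter> pe xs = {}"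

lemma excursion_mono: "excursion E xs p q ys \<Longrightarrow> E \<subseteq> E' \<Longrightarrow> excursion E' xs p q ys"
  by (auto simp: excursion_def)

text \<open>Follow \<open>Q\<close> along \<open>xs\<close> while the two agree; they part at index
  \<open>p\<close>, and the stretch of \<open>Q\<close> up to its next vertex on \<open>xs\<close>
  is the excursion. The \<open>p - a\<close> common steps are charged to the length of
  \<open>Q\<close>. The last premise stops \<open>Q\<close> from running backwards along
  \<open>xs\<close>, where it would use no new edge.\<close>

lemma excursion_of_departing_path:
  assumes "distinct xs" "alt xs" "is_path E Q" "Q \<noteq> []" "a < length xs" "hd Q = xs ! a"
    "last Q \<in> set xs" "\<not> prefix Q (drop a xs)"
    "a = 0 \<or> ed (xs ! (a - 1)) (xs ! a) \<notin> pe Q"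
  shows "\<exists>p q ys. excursion (pe Q) xs p q ys \<and> a \<le> p \<and> length ys + 2 + (p - a) \<le> length Q"
  using assms(3-9)
proof (induction Q arbitrary: a)
  case Nil
  then show ?case by simp
next
  case (Cons x Q)
  have x: "x = xs ! a" using Cons by simp
  have dr: "drop a xs = xs ! a # drop (Suc a) xs" using Cons by (simp add: Cons_nth_drop_Suc)
  have Q: "Q \<noteq> []" using Cons x dr by auto
  have pa: "isl x \<noteq> isl (hd Q)" "is_path E Q" "distinct (x # Q)"
    using Cons.prems(1) Q by (auto simp: is_path_def alt_Cons pe_Cons)
  have altQ: "alt Q" using pa by (simp add: is_path_def)
  show ?case
  proof (cases "Suc a < length xs \<and> hd Q = xs ! Suc a")
    case True
    \<comment> \<open>\<open>Q\<close> takes the next step of \<open>xs\<close>; being simple, it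
      does not use that edge again, so the last premise survives.\<close>
    have "\<exists>p q ys. excursion (pe Q) xs p q ys \<and> Suc a \<le> p \<and> length ys + 2 + (p - Suc a) \<le> length Q"
    proof (rule Cons.IH)
      show "\<not> prefix Q (drop (Suc a) xs)" using Cons.prems x dr by auto
      have "x \<notin> set Q" using pa by simp
      then show "Suc a = 0 \<or> ed (xs ! (Suc a - 1)) (xs ! Suc a) \<notin> pe Q"
        using pe_vertices[OF altQ, of x "hd Q"] pa True x by auto
    qed (use True Cons.prems Q pa in auto)
    then obtain p q ys where "excursion (pe Q) xs p q ys" "Suc a \<le> p" "length ys + 2 + (p - Suc a) \<le> length Q"
      by blast
    moreover have "pe Q \<subseteq> pe (x # Q)" using Q by (auto simp: pe_Cons)
    ultimately show ?thesis
      by (intro exI[of _ p] exI[of _ q] exI[of _ ys]) (auto intro: excursion_mono)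
  next
    case False
    have "\<exists>z\<in>set Q. z \<in> set xs" using Cons.prems Q by (metis last_ConsR last_in_set)
    then obtain ys z zs where Qs: "Q = ys @ z # zs" "z \<in> set xs" "\<forall>y\<in>set ys. y \<notin> set xs"
      using split_list_first_prop[of Q "\<lambda>z. z \<in> set xs"] by blast
    obtain q where q: "q < length xs" "z = xs ! q" using Qs by (auto simp: in_set_conv_nth)
    have qa: "q \<noteq> a" using q pa x Qs by auto
    have xQ: "x # Q = (x # ys @ [z]) @ zs" using Qs by simp
    have altx: "alt (x # Q)" using Cons.prems(1) by (simp add: is_path_def)
    have 1: "alt (x # ys @ [z])" using altx unfolding xQ alt_append by blast
    have 2: "pe (x # ys @ [z]) \<subseteq> pe (x # Q)" unfolding xQ by (rule pe_append_subset1)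
    \<comment> \<open>Without inner vertices the edge could lie on \<open>xs\<close> only as the
      step forward, excluded by the case, or as the step back, excluded by the premise. With inner
      vertices every edge has an end off \<open>xs\<close>.\<close>
    have 3: "pe (x # ys @ [z]) \<inter> pe xs = {}"
    proof (cases "ys = []")
      case True
      then have hq: "hd Q = z" using Qs by simp
      have "ed x z \<notin> pe xs"
      proof
        assume e: "ed x z \<in> pe xs"
        from pe_neighbour[OF assms(1,2) Cons.prems(3), of z] e pa hq x False
        have "a > 0" "z = xs ! (a - 1)" by auto
        moreover have "ed x z \<in> pe (x # Q)" using Q hq by (auto simp: pe_Cons)
        ultimately show False using Cons.prems(7) x pa hq ed_commute[of x z] by auto
      qed
      then show ?thesis using True by simp
    next
      case False
      show ?thesis
      proof (rule ccontr)
        assume "\<not> ?thesis"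
        then obtain e where e: "e \<in> pe (x # ys @ [z])" "e \<in> pe xs" by auto
        have "\<exists>c d. isl c \<noteq> isl d \<and> e = ed c d \<and> (c \<in> set ys \<or> d \<in> set ys)"
          using e(1) 1 False
        proof (induction ys arbitrary: x)
          case (Cons y ys)
          consider "e = ed x y" | "e = ed y z" "ys = []" | "e \<in> pe (y # ys @ [z])" "ys \<noteq> []"
            using Cons.prems by (cases "ys = []") auto
          then show ?case
          proof cases
            case 1
            then show ?thesis using Cons.prems by (intro exI[of _ x] exI[of _ y]) auto
          next
            case 2
            then show ?thesis using Cons.prems by (intro exI[of _ y] exI[of _ z]) auto
          next
            case 3
            then show ?thesis using Cons.IH[of y] Cons.prems by auto
          qed
        qed simp
        then obtain c d where "isl c \<noteq> isl d" "e = ed c d" "c \<in> set ys \<or> d \<in> set ys" by blast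
        with pe_vertices[OF assms(2), of c d] e(2) Qs(3) show False by auto
      qed
    qed
    have "excursion (pe (x # Q)) xs a q ys"
      using Cons.prems(3) q qa Qs 1 2 3 x pa(3) by (auto simp: excursion_def)
    then show ?thesis using Qs by (intro exI[of _ a] exI[of _ q] exI[of _ ys]) auto
  qed
qed

text \<open>Otherwise \<open>Q\<close> would leave \<open>xs\<close>, and the resulting excursion
  would contain an edge outside \<open>pe xs\<close>.\<close>

lemma path_within_path_prefix:
  assumes "distinct xs" "alt xs" "is_path E Q" "Q \<noteq> []" "xs \<noteq> []" "hd Q = hd xs" "pe Q \<subseteq> pe xs"
  shows "prefix Q xs"
proof (rule ccontr)
  assume np: "\<not> prefix Q xs"
  have "last Q \<in> set xs"
  proof (cases "length Q = 1")
    case True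
    then show ?thesis using assms by (cases Q) (auto simp: length_Suc_conv)
  next
    case False
    define R where "R = butlast Q"
    have R: "Q = R @ [last Q]" "R \<noteq> []"
      using assms(4) False by (auto simp: R_def) (metis append_butlast_last_id append_self_conv2 length_Cons list.size(3) One_nat_def)
    then have "ed (last R) (last Q) \<in> pe Q" using pe_append[of R "[last Q]"] by (metis insertI1 list.distinct(1) list.sel(1))
    moreover have "isl (last R) \<noteq> isl (last Q)"
      using assms(3) R by (metis is_path_def list.distinct(1) list.sel(1) alt_append)
    ultimately show ?thesis using pe_vertices[OF assms(2)] assms(7) by blast
  qed
  then obtain p q ys where "excursion (pe Q) xs p q ys"
    using excursion_of_departing_path[OF assms(1-4), of 0] assms(5,6) np by (auto simp: hd_conv_nth)
  then have "pe (xs ! p # ys @ [xs ! q]) = {}" using assms(7) by (auto simp: excursion_def)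
  then show False by (simp add: pe_Cons)
qed

section \<open>Cycles as lists with a distinguished closing edge\<close>

lemma alt_nth: "alt xs \<Longrightarrow> i < length xs \<Longrightarrow> isl (xs ! i) \<longleftrightarrow> (isl (hd xs) \<longleftrightarrow> even i)"
proof (induction xs arbitrary: i rule: pe.induct)
  case (1 x y zs)
  then show ?case by (cases i) auto
qed auto

lemma alt_even_ends:
  assumes "alt xs" "length xs = 2 * k" "k \<ge> 1"
  shows "isl (last xs) \<noteq> isl (hd xs)"
proof -
  have "xs \<noteq> []" using assms by auto
  then show ?thesis using alt_nth[OF assms(1), of "length xs - 1"] assms by (auto simp: last_conv_nth)
qed

lemma cyc_append: "xs \<noteq> [] \<Longrightarrow> ys \<noteq> [] \<Longrightarrow> cyc (xs @ ys) = cyc (ys @ xs)"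
  by (auto simp: cyc_def pe_append)

lemma cyc_rev: "alt xs \<Longrightarrow> isl (last xs) \<noteq> isl (hd xs) \<Longrightarrow> cyc (rev xs) = cyc xs"
  using ed_commute[of "last xs" "hd xs"]
  by (cases "xs = []") (auto simp: cyc_def pe_rev hd_rev last_rev)

text \<open>A cycle of length \<open>2 * k\<close> has \<open>2 * k\<close> such lists, one for each choice of its closing edge.\<close>

definition cycle_list :: "nat \<Rightarrow> walk \<Rightarrow> bool" where
  "cycle_list k xs \<longleftrightarrow> length xs = 2 * k \<and> distinct xs \<and> alt xs \<and> isl (hd xs)"

definition cycle_lists :: "nat \<Rightarrow> graph \<Rightarrow> walk set" where
  "cycle_lists k E = {xs. cycle_list k xs \<and> cyc xs \<subseteq> E}"

text \<open>The first vertex of a simple path has only the second one as path neighbour, and for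
  \<open>k \<ge> 2\<close> the second vertex is not the last. For \<open>k = 1\<close> the closing
  edge is the only edge of the path.\<close>

lemma closing_edge_notin_pe:
  assumes "cycle_list k xs" "k \<ge> 2"
  shows "ed (last xs) (hd xs) \<notin> pe xs"
proof
  assume e: "ed (last xs) (hd xs) \<in> pe xs"
  have xs: "length xs = 2 * k" "distinct xs" "alt xs" using assms by (auto simp: cycle_list_def)
  have ends: "isl (last xs) \<noteq> isl (hd xs)" using alt_even_ends xs assms by auto
  have ne: "xs \<noteq> []" using xs assms by auto
  have "ed (xs ! 0) (last xs) \<in> pe xs"
    using e ed_commute[OF ends] ne by (simp add: hd_conv_nth)
  then have "last xs = xs ! 1"
    using pe_neighbour[OF xs(2,3), of 0 "last xs"] ends ne by (auto simp: hd_conv_nth)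
  then have "xs ! (length xs - 1) = xs ! 1" using ne by (simp add: last_conv_nth)
  then show False using xs assms by (simp add: nth_eq_iff_index_eq)
qed

lemma card_cyc:
  assumes "cycle_list k xs" "k \<ge> 2"
  shows "card (cyc xs) = 2 * k"
  using closing_edge_notin_pe[OF assms] assms
  by (auto simp: cyc_def card_pe cycle_list_def)

text \<open>Cut the cycle at \<open>e\<close> and exchange the two pieces; reverse the result if it
  starts on the right side.\<close>

lemma cycle_list_relabel:
  assumes xs: "cycle_list k xs" "k \<ge> 2" and e: "e \<in> cyc xs"
  obtains ys where "cycle_list k ys" "cyc ys = cyc xs" "ed (last ys) (hd ys) = e"
proof -
  have x: "length xs = 2 * k" "distinct xs" "alt xs" "isl (hd xs)" using xs by (auto simp: cycle_list_def)
  have ends: "isl (last xs) \<noteq> isl (hd xs)" using alt_even_ends x xs by auto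
  show ?thesis
  proof (cases "e = ed (last xs) (hd xs)")
    case True
    then show ?thesis using xs that by blast
  next
    case False
    then have "e \<in> pe xs" using e by (auto simp: cyc_def)
    then obtain a b where ab: "isl a \<noteq> isl b" "e = ed a b"
      using x(3) by (induction xs rule: pe.induct) auto
    obtain as bs where s: "xs = as @ bs" "as \<noteq> []" "bs \<noteq> []"
       "(last as = a \<and> hd bs = b) \<or> (last as = b \<and> hd bs = a)"
      using pe_split[OF x(3) ab(1)] \<open>e \<in> pe xs\<close> ab by blast
    define ys where "ys = bs @ as"
    have y: "length ys = 2 * k" "distinct ys" "cyc ys = cyc xs"
      using x s cyc_append[of as bs] by (auto simp: ys_def)
    have ay: "alt ys" using x(3) ends s by (auto simp: ys_def alt_append)
    have ey: "isl (last ys) \<noteq> isl (hd ys)" using alt_even_ends ay y xs by auto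
    have ee: "ed (last ys) (hd ys) = e" using s ab ed_commute[OF ab(1)] by (auto simp: ys_def)
    show ?thesis
    proof (cases "isl (hd ys)")
      case True
      then show ?thesis using that[of ys] y ay ee by (auto simp: cycle_list_def)
    next
      case False
      have "ys \<noteq> []" using s by (simp add: ys_def)
      then show ?thesis
        using that[of "rev ys"] y ay ee ey False ed_commute[OF ey]
        by (auto simp: cycle_list_def alt_rev cyc_rev hd_rev last_rev)
    qed
  qed
qed

text \<open>The closing edge determines the first vertex, which is its left end, and the remaining
  edges form a path along which there is no choice.\<close>

lemma cycle_list_eqI:
  assumes xs: "cycle_list k xs" and ys: "cycle_list k ys" and "k \<ge> 2"
    and "cyc xs = cyc ys" "ed (last xs) (hd xs) = ed (last ys) (hd ys)"
  shows "xs = ys"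
proof -
  have ne: "xs \<noteq> []" "ys \<noteq> []" using assms by (auto simp: cycle_list_def)
  have "isl (last xs) \<noteq> isl (hd xs)" "isl (last ys) \<noteq> isl (hd ys)" "isl (hd xs)" "isl (hd ys)"
    using alt_even_ends assms by (auto simp: cycle_list_def)
  then have h: "hd xs = hd ys" using assms(5) by (auto simp: ed_eq_iff)
  have "pe xs = pe ys"
    using assms(4,5) closing_edge_notin_pe[OF xs] closing_edge_notin_pe[OF ys] \<open>k \<ge> 2\<close>
    by (metis cyc_def insert_ident)
  then have "prefix xs ys"
    using path_within_path_prefix[of ys UNIV xs] assms ne h by (auto simp: cycle_list_def is_path_def)
  then show ?thesis using xs ys by (auto simp: cycle_list_def prefix_def)
qed

lemma pe_conv_nth: "pe xs = (\<lambda>i. ed (xs ! i) (xs ! Suc i)) ` {i. Suc i < length xs}"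
proof (induction xs rule: pe.induct)
  case (1 x y zs)
  have "{i. Suc i < length (x # y # zs)} = insert 0 (Suc ` {i. Suc i < length (y # zs)})"
    by (auto simp: image_iff) (metis Suc_less_eq not0_implies_Suc less_nat_zero_code neq0_conv)
  then show ?case using 1 by (simp add: image_image)
qed auto

lemma cyc_conv_cycle_edges:
  assumes "length xs = 2 * k" "k \<ge> 1" "\<And>i. i < k \<Longrightarrow> xs ! (2 * i) = Inl (u i)"
    "\<And>i. i < k \<Longrightarrow> xs ! (2 * i + 1) = Inr (v i)"
  shows "cyc xs = cycle_edges k u v"
proof -
  let ?f = "\<lambda>i. ed (xs ! i) (xs ! ((i + 1) mod (2 * k)))"
  have ne: "xs \<noteq> []" using assms by auto
  have "{..<2 * k} = insert (2 * k - 1) {i. Suc i < 2 * k}" using assms(2) by auto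
  then have "?f ` {..<2 * k} = insert (?f (2 * k - 1)) (?f ` {i. Suc i < 2 * k})" by simp
  also have "?f (2 * k - 1) = ed (last xs) (hd xs)"
    using assms(1,2) ne by (simp add: last_conv_nth hd_conv_nth)
  also have "?f ` {i. Suc i < 2 * k} = pe xs" unfolding pe_conv_nth assms(1) by (rule image_cong) auto
  finally have 1: "cyc xs = ?f ` {..<2 * k}" by (simp add: cyc_def)
  have "{..<2 * k} = (\<lambda>i. 2 * i) ` {0..<k} \<union> (\<lambda>i. 2 * i + 1) ` {0..<k}"
  proof (rule set_eqI)
    fix i show "i \<in> {..<2 * k} \<longleftrightarrow> i \<in> (\<lambda>i. 2 * i) ` {0..<k} \<union> (\<lambda>i. 2 * i + 1) ` {0..<k}"
      by (cases "even i") (auto elim!: evenE oddE)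
  qed
  then have "cyc xs = (\<lambda>i. ?f (2 * i)) ` {0..<k} \<union> (\<lambda>i. ?f (2 * i + 1)) ` {0..<k}"
    unfolding 1 by (simp add: image_Un image_image)
  also have "(\<lambda>i. ?f (2 * i)) ` {0..<k} = (\<lambda>i. (u i, v i)) ` {0..<k}"
  proof (rule image_cong)
    fix i assume "i \<in> {0..<k}"
    then have "(2 * i + 1) mod (2 * k) = 2 * i + 1" "i < k" by auto
    then show "?f (2 * i) = (u i, v i)" using assms(3)[of i] assms(4)[of i] by (simp only: ed_Inl)
  qed simp
  also have "(\<lambda>i. ?f (2 * i + 1)) ` {0..<k} = (\<lambda>i. (u ((i + 1) mod k), v i)) ` {0..<k}"
  proof (rule image_cong)
    fix i assume i: "i \<in> {0..<k}"
    have "(2 * i + 1 + 1) mod (2 * k) = 2 * ((i + 1) mod k)"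
      using mult_mod_right[of 2 "i + 1" k] by simp
    moreover have "(i + 1) mod k < k" using assms(2) by simp
    ultimately show "?f (2 * i + 1) = (u ((i + 1) mod k), v i)"
      using assms(3)[of "(i + 1) mod k"] assms(4)[of i] i by (simp only: ed_Inl atLeastLessThan_iff)
  qed simp
  finally show ?thesis by (simp add: cycle_edges_def)
qed

lemma cycles_conv_cyc:
  assumes "k \<ge> 1"
  shows "cycles k E = cyc ` cycle_lists k E"
proof (intro equalityI subsetI)
  fix C assume "C \<in> cycles k E"
  then obtain u v where uv: "inj_on u {0..<k}" "inj_on v {0..<k}" "C = cycle_edges k u v" "C \<subseteq> E"
    by (auto simp: cycles_def)
  define g where "g = (\<lambda>i. if even i then Inl (u (i div 2)) else Inr (v (i div 2)) :: nat + nat)"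
  define xs where "xs = map g [0..<2 * k]"
  have len: "length xs = 2 * k" by (simp add: xs_def)
  have "inj_on g {0..<2 * k}"
  proof (rule inj_onI)
    fix i j assume ij: "i \<in> {0..<2 * k}" "j \<in> {0..<2 * k}" "g i = g j"
    have par: "even i = even j" using ij(3) by (simp add: g_def split: if_splits)
    have lt: "i div 2 \<in> {0..<k}" "j div 2 \<in> {0..<k}" using ij by auto
    have "i div 2 = j div 2"
    proof (cases "even i")
      case True
      then show ?thesis using ij(3) par inj_onD[OF uv(1) _ lt] by (simp add: g_def)
    next
      case False
      then show ?thesis using ij(3) par inj_onD[OF uv(2) _ lt] by (simp add: g_def)
    qed
    moreover have "i mod 2 = j mod 2" using par by presburger
    ultimately show "i = j" by (metis div_mult_mod_eq)
  qed
  then have "distinct xs" by (simp add: xs_def distinct_map)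
  moreover have "alt xs" unfolding alt_def successively_conv_nth by (auto simp: xs_def g_def)
  moreover have "isl (hd xs)" using assms by (simp add: xs_def hd_map upt_conv_Cons g_def)
  moreover have "cyc xs = C" unfolding uv(3)
    by (rule cyc_conv_cycle_edges) (use assms in \<open>auto simp: xs_def g_def\<close>)
  ultimately show "C \<in> cyc ` cycle_lists k E"
    using uv(4) len by (auto simp: cycle_lists_def cycle_list_def)
next
  fix C assume "C \<in> cyc ` cycle_lists k E"
  then obtain xs where xs: "length xs = 2 * k" "distinct xs" "alt xs" "isl (hd xs)" "cyc xs \<subseteq> E" "C = cyc xs"
    by (auto simp: cycle_lists_def cycle_list_def)
  define u where "u = (\<lambda>i. projl (xs ! (2 * i)))"
  define v where "v = (\<lambda>i. projr (xs ! (2 * i + 1)))"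
  have u: "xs ! (2 * i) = Inl (u i)" if "i < k" for i
    using alt_nth[OF xs(3), of "2 * i"] xs that by (simp add: u_def)
  have v: "xs ! (2 * i + 1) = Inr (v i)" if "i < k" for i
    using alt_nth[OF xs(3), of "2 * i + 1"] xs that by (cases "xs ! (2 * i + 1)") (auto simp: v_def)
  have "inj_on u {0..<k}"
  proof (rule inj_onI)
    fix i j assume "i \<in> {0..<k}" "j \<in> {0..<k}" "u i = u j"
    then have "xs ! (2 * i) = xs ! (2 * j)" using u by simp
    then show "i = j" using xs \<open>i \<in> _\<close> \<open>j \<in> _\<close> by (simp add: nth_eq_iff_index_eq)
  qed
  moreover have "inj_on v {0..<k}"
  proof (rule inj_onI)
    fix i j assume "i \<in> {0..<k}" "j \<in> {0..<k}" "v i = v j"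
    then have "xs ! (2 * i + 1) = xs ! (2 * j + 1)" using v by (simp del: One_nat_def)
    then show "i = j" using xs \<open>i \<in> _\<close> \<open>j \<in> _\<close> by (simp add: nth_eq_iff_index_eq)
  qed
  moreover have "cyc xs = cycle_edges k u v"
    by (rule cyc_conv_cycle_edges) (use assms xs u v in auto)
  ultimately show "C \<in> cycles k E" using xs by (auto simp: cycles_def)
qed

lemma finite_cycles [simp]: "finite E \<Longrightarrow> finite (cycles k E)"
  by (rule finite_subset[of _ "Pow E"]) (auto simp: cycles_def)

lemma card_cycle_lists:
  assumes E: "finite E" and k: "k \<ge> 2"
  shows "finite (cycle_lists k E)" "card (cycle_lists k E) = 2 * k * cycle_count k E"
proof -
  define F where "F = (\<lambda>C. {xs \<in> cycle_lists k E. cyc xs = C})"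
  have bij: "bij_betw (\<lambda>xs. ed (last xs) (hd xs)) (F C) C" if C: "C \<in> cycles k E" for C
  proof -
    obtain xs where xs: "xs \<in> cycle_lists k E" "C = cyc xs"
      using C cycles_conv_cyc[of k E] k by auto
    show ?thesis
    proof (rule bij_betwI')
      fix ys zs assume "ys \<in> F C" "zs \<in> F C"
      then show "(ed (last ys) (hd ys) = ed (last zs) (hd zs)) = (ys = zs)"
        using cycle_list_eqI[of k ys zs] k by (auto simp: F_def cycle_lists_def)
    next
      fix ys assume "ys \<in> F C"
      then show "ed (last ys) (hd ys) \<in> C" by (auto simp: F_def cyc_def)
    next
      fix e assume "e \<in> C"
      then obtain ys where "cycle_list k ys" "cyc ys = cyc xs" "ed (last ys) (hd ys) = e"
        using cycle_list_relabel[of k xs e] xs k by (auto simp: cycle_lists_def)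
      then show "\<exists>ys\<in>F C. e = ed (last ys) (hd ys)"
        using xs by (intro bexI[of _ ys]) (auto simp: F_def cycle_lists_def)
    qed
  qed
  have cC: "finite C" "card C = 2 * k" if "C \<in> cycles k E" for C
    using that cycles_conv_cyc[of k E] k card_cyc[of k]
    by (auto simp: cycle_lists_def cyc_def)
  have fF: "finite (F C)" "card (F C) = 2 * k" if "C \<in> cycles k E" for C
    using bij[OF that] cC[OF that] bij_betw_finite bij_betw_same_card by metis+
  have U: "cycle_lists k E = (\<Union>C\<in>cycles k E. F C)"
    using cycles_conv_cyc[of k E] k by (auto simp: F_def)
  show "finite (cycle_lists k E)" unfolding U using E fF by auto
  have "card (\<Union>C\<in>cycles k E. F C) = (\<Sum>C\<in>cycles k E. card (F C))"
    using E fF by (intro card_UN_disjoint) (auto simp: F_def)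
  also have "\<dots> = 2 * k * cycle_count k E" using fF by (simp add: cycle_count_def)
  finally show "card (cycle_lists k E) = 2 * k * cycle_count k E" unfolding U .
qed

section \<open>Edge containment probabilities\<close>

definition swap :: "graph \<Rightarrow> nat \<Rightarrow> nat \<Rightarrow> nat \<Rightarrow> nat \<Rightarrow> graph" where
  "swap G a b c d = G - {(a, b), (c, d)} \<union> {(a, d), (c, b)}"

lemma swap_swap:
  assumes "(a, b) \<in> G" "(c, d) \<in> G" "(a, d) \<notin> G" "(c, b) \<notin> G"
  shows "swap (swap G a b c d) a d c b = G"
  using assms by (auto simp: swap_def)

lemma biregular_swap:
  assumes bi: "biregular n m d1 d2 G"
    and "(a, b) \<in> G" "(c, d) \<in> G" "(a, d) \<notin> G" "(c, b) \<notin> G"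
  shows "biregular n m d1 d2 (swap G a b c d)"
proof -
  have G: "G \<subseteq> {0..<n} \<times> {0..<m}" using bi by (simp add: biregular_def)
  have fin: "finite {v. (u, v) \<in> G}" "finite {u. (u, v) \<in> G}" for u v
    by (rule finite_subset[of _ "{0..<m}"] finite_subset[of _ "{0..<n}"], use G in auto)+
  have ex: "card (insert y (R - {x})) = card R" if "finite R" "x \<in> R" "y \<notin> R" for x y and R :: "nat set"
    using that by (metis Diff_iff card_Suc_Diff1 card_insert_disjoint finite_Diff)
  have ne: "a \<noteq> c" "b \<noteq> d" using assms by auto
  have "{v. (u, v) \<in> swap G a b c d} =
      (if u = a then insert d ({v. (u, v) \<in> G} - {b}) else
       if u = c then insert b ({v. (u, v) \<in> G} - {d}) else {v. (u, v) \<in> G})" for u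
    using ne by (auto simp: swap_def)
  then have 1: "card {v. (u, v) \<in> swap G a b c d} = card {v. (u, v) \<in> G}" for u
    using assms fin ex[of "{v. (u, v) \<in> G}" b d] ex[of "{v. (u, v) \<in> G}" d b] by auto
  have "{u. (u, v) \<in> swap G a b c d} =
      (if v = b then insert c ({u. (u, v) \<in> G} - {a}) else
       if v = d then insert a ({u. (u, v) \<in> G} - {c}) else {u. (u, v) \<in> G})" for v
    using ne by (auto simp: swap_def)
  then have 2: "card {u. (u, v) \<in> swap G a b c d} = card {u. (u, v) \<in> G}" for v
    using assms fin ex[of "{u. (u, v) \<in> G}" a c] ex[of "{u. (u, v) \<in> G}" c a] by auto
  have "swap G a b c d \<subseteq> {0..<n} \<times> {0..<m}" using G assms by (auto simp: swap_def)
  with 1 2 bi show ?thesis by (simp add: biregular_def)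
qed

lemma finite_biregular_graphs: "finite (biregular_graphs n m d1 d2)"
  by (rule finite_subset[of _ "Pow ({0..<n} \<times> {0..<m})"]) (auto simp: biregular_graphs_def biregular_def)

lemma biregular_finite: "biregular n m d1 d2 G \<Longrightarrow> finite G"
  by (auto simp: biregular_def intro: finite_subset)

lemma biregular_card:
  assumes "biregular n m d1 d2 G"
  shows "card G = n * d1"
proof -
  have "G = (SIGMA u:{0..<n}. {v. (u, v) \<in> G})" using assms by (auto simp: biregular_def)
  then have "card G = card (SIGMA u:{0..<n}. {v. (u, v) \<in> G})" by simp
  also have "\<dots> = (\<Sum>u\<in>{0..<n}. card {v. (u, v) \<in> G})"
    using assms by (intro card_SigmaI) (auto simp: biregular_def intro!: finite_subset[of _ "{0..<m}"])
  also have "\<dots> = n * d1" using assms by (simp add: biregular_def)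
  finally show ?thesis .
qed

lemma biregular_finite_nbrs:
  assumes "biregular n m d1 d2 G"
  shows "finite {v. (u, v) \<in> G}" "finite {u. (u, v) \<in> G}"
  by (rule finite_subset[of _ "{0..<m}"] finite_subset[of _ "{0..<n}"], use assms in \<open>auto simp: biregular_def\<close>)+

lemma biregular_card_nbrs_le:
  assumes "biregular n m d1 d2 G"
  shows "card {v. (u, v) \<in> G} \<le> d1" "card {u. (u, v) \<in> G} \<le> d2"
proof -
  have "{v. (u, v) \<in> G} = {}" if "u \<notin> {0..<n}" using assms that by (auto simp: biregular_def)
  then show "card {v. (u, v) \<in> G} \<le> d1"
    using assms by (cases "u \<in> {0..<n}") (auto simp: biregular_def)
  have "{u. (u, v) \<in> G} = {}" if "v \<notin> {0..<m}" using assms that by (auto simp: biregular_def)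
  then show "card {u. (u, v) \<in> G} \<le> d2"
    using assms by (cases "v \<in> {0..<m}") (auto simp: biregular_def)
qed

definition containing :: "nat \<Rightarrow> nat \<Rightarrow> nat \<Rightarrow> nat \<Rightarrow> graph \<Rightarrow> graph set" where
  "containing n m d1 d2 H = {G \<in> biregular_graphs n m d1 d2. H \<subseteq> G}"

text \<open>Double counting of the switchings of \<open>(u, v)\<close> with an arbitrary other edge of the graph: at most
  \<open>2 * d1 * d2\<close> of these would create a double edge.\<close>

lemma card_containing_insert:
  assumes uv: "(u, v) \<notin> H" and H: "finite H"
  shows "card (containing n m d1 d2 (insert (u, v) H)) * (n * d1 - card H - 2 * d1 * d2)
    \<le> card (containing n m d1 d2 H) * ((d1 - card {v. (u, v) \<in> H}) * (d2 - card {u. (u, v) \<in> H}))"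
proof -
  define T where "T = (\<lambda>G. {(u', v') \<in> G - H. (u, v') \<notin> G \<and> (u', v) \<notin> G})"
  \<comment> \<open>Both edges of the reverse switching must lie outside \<open>H\<close>; this is
    what lowers the degrees in the bound by those of \<open>H\<close>.\<close>
  define R where "R = (\<lambda>G. {(u', v'). (u', v) \<in> G - H \<and> (u, v') \<in> G - H})"
  define X where "X = containing n m d1 d2 (insert (u, v) H)"
  define Y where "Y = containing n m d1 d2 H"
  have finXY: "finite X" "finite Y"
    unfolding X_def Y_def containing_def using finite_biregular_graphs by auto
  have biX: "biregular n m d1 d2 G" "insert (u, v) H \<subseteq> G" if "G \<in> X" for G
    using that by (auto simp: X_def containing_def biregular_graphs_def)
  have biY: "biregular n m d1 d2 G" "H \<subseteq> G" if "G \<in> Y" for G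
    using that by (auto simp: Y_def containing_def biregular_graphs_def)
  have T: "finite (T G)" "card (T G) \<ge> n * d1 - card H - 2 * d1 * d2" if "G \<in> X" for G
  proof -
    note bi = biX(1)[OF that]
    note fG = biregular_finite[OF bi]
    show fT: "finite (T G)" using fG by (auto simp: T_def intro: finite_subset)
    \<comment> \<open>\<open>P\<close> holds, with coordinates exchanged, the edges excluded because
      \<open>(u, v')\<close> is present, and \<open>Q\<close> those excluded because
      \<open>(u', v)\<close> is present.\<close>
    define P where "P = (SIGMA v':{v'. (u, v') \<in> G}. {u'. (u', v') \<in> G})"
    define Q where "Q = (SIGMA u':{u'. (u', v) \<in> G}. {v'. (u', v') \<in> G})"
    have fPQ: "finite P" "finite Q" unfolding P_def Q_def
      using biregular_finite_nbrs[OF bi] by (auto intro!: finite_SigmaI)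
    have "card P = (\<Sum>v'\<in>{v'. (u, v') \<in> G}. card {u'. (u', v') \<in> G})"
      unfolding P_def using biregular_finite_nbrs[OF bi] by (intro card_SigmaI) auto
    also have "\<dots> \<le> card {v'. (u, v') \<in> G} * d2"
      using sum_bounded_above[of "{v'. (u, v') \<in> G}" "\<lambda>v'. card {u'. (u', v') \<in> G}" d2]
        biregular_card_nbrs_le[OF bi] by simp
    also have "\<dots> \<le> d1 * d2" using biregular_card_nbrs_le[OF bi] by (intro mult_right_mono) auto
    finally have cP: "card P \<le> d1 * d2" .
    have "card Q = (\<Sum>u'\<in>{u'. (u', v) \<in> G}. card {v'. (u', v') \<in> G})"
      unfolding Q_def using biregular_finite_nbrs[OF bi] by (intro card_SigmaI) auto
    also have "\<dots> \<le> card {u'. (u', v) \<in> G} * d1"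
      using sum_bounded_above[of "{u'. (u', v) \<in> G}" "\<lambda>u'. card {v'. (u', v') \<in> G}" d1]
        biregular_card_nbrs_le[OF bi] by simp
    also have "\<dots> \<le> d2 * d1" using biregular_card_nbrs_le[OF bi] by (intro mult_right_mono) auto
    finally have cQ: "card Q \<le> d1 * d2" by (simp add: mult.commute)
    have "G \<subseteq> T G \<union> H \<union> prod.swap ` P \<union> Q" by (force simp: T_def P_def Q_def)
    then have "card G \<le> card (T G \<union> H \<union> prod.swap ` P \<union> Q)"
      using fT H fPQ by (intro card_mono) auto
    also have "\<dots> \<le> card (T G) + card H + card (prod.swap ` P) + card Q"
      by (meson add_le_mono card_Un_le le_refl order_trans)
    also have "\<dots> \<le> card (T G) + card H + d1 * d2 + d1 * d2"
      using cP cQ card_image_le[OF fPQ(1), of prod.swap] by linarith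
    finally show "card (T G) \<ge> n * d1 - card H - 2 * d1 * d2" using biregular_card[OF bi] by simp
  qed
  have R: "finite (R G)" "card (R G) \<le> (d1 - card {v. (u, v) \<in> H}) * (d2 - card {u. (u, v) \<in> H})"
    if "G \<in> Y" for G
  proof -
    note bi = biY(1)[OF that]
    have eq: "R G = ({u'. (u', v) \<in> G} - {u'. (u', v) \<in> H}) \<times> ({v'. (u, v') \<in> G} - {v'. (u, v') \<in> H})"
      by (auto simp: R_def)
    show "finite (R G)" unfolding eq using biregular_finite_nbrs[OF bi] by auto
    have sub: "{u'. (u', v) \<in> H} \<subseteq> {u'. (u', v) \<in> G}" "{v'. (u, v') \<in> H} \<subseteq> {v'. (u, v') \<in> G}"
      using biY(2)[OF that] by auto
    have fin: "finite {u'. (u', v) \<in> H}" "finite {v'. (u, v') \<in> H}"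
      using finite_subset[OF sub(1)] finite_subset[OF sub(2)] biregular_finite_nbrs[OF bi] by auto
    have "card (R G) = (card {u'. (u', v) \<in> G} - card {u'. (u', v) \<in> H}) * (card {v'. (u, v') \<in> G} - card {v'. (u, v') \<in> H})"
      unfolding eq card_cartesian_product using sub fin by (simp add: card_Diff_subset)
    also have "\<dots> \<le> (d2 - card {u. (u, v) \<in> H}) * (d1 - card {v. (u, v) \<in> H})"
      using biregular_card_nbrs_le[OF bi] by (intro mult_mono diff_le_mono) auto
    finally show "card (R G) \<le> (d1 - card {v. (u, v) \<in> H}) * (d2 - card {u. (u, v) \<in> H})"
      by (simp add: mult.commute)
  qed
  define f where "f = (\<lambda>(G, u', v'). (swap G u v u' v', u', v'))"
  have "card X * (n * d1 - card H - 2 * d1 * d2) \<le> (\<Sum>G\<in>X. card (T G))"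
    using sum_bounded_below[of X "n * d1 - card H - 2 * d1 * d2" "\<lambda>G. card (T G)"] T by simp
  also have "\<dots> = card (Sigma X T)" using finXY T by simp
  also have "\<dots> \<le> card (Sigma Y R)"
  proof (rule card_inj_on_le[where f=f])
    show "finite (Sigma Y R)" using finXY R by auto
    show "inj_on f (Sigma X T)"
    proof (rule inj_on_inverseI[where g="\<lambda>(G, u', v'). (swap G u v' u' v, u', v')"])
      fix x assume "x \<in> Sigma X T"
      then obtain G u' v' where "x = (G, u', v')" "G \<in> X" "(u', v') \<in> T G" by (cases x) auto
      then show "(\<lambda>(G, u', v'). (swap G u v' u' v, u', v')) (f x) = x"
        using biX(2)[of G] swap_swap[of u v G u' v'] by (auto simp: f_def T_def)
    qed
    show "f ` Sigma X T \<subseteq> Sigma Y R"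
    proof safe
      fix G' u1 v1 G u' v' assume *: "G \<in> X" "(u', v') \<in> T G" "(G', u1, v1) = f (G, u', v')"
      then have t: "(u', v') \<in> G" "(u', v') \<notin> H" "(u, v') \<notin> G" "(u', v) \<notin> G" "(u, v) \<in> G" "H \<subseteq> G"
        using biX(2)[of G] by (auto simp: T_def)
      have "biregular n m d1 d2 (swap G u v u' v')"
        using biregular_swap[OF biX(1)[OF *(1)]] t by blast
      moreover have "H \<subseteq> swap G u v u' v'" using t uv by (auto simp: swap_def)
      ultimately show "G' \<in> Y" using * by (auto simp: f_def Y_def containing_def biregular_graphs_def)
      show "(u1, v1) \<in> R G'" using * t by (auto simp: f_def R_def swap_def)
    qed
  qed
  also have "\<dots> = (\<Sum>G\<in>Y. card (R G))" using finXY R by simp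
  also have "\<dots> \<le> card Y * ((d1 - card {v. (u, v) \<in> H}) * (d2 - card {u. (u, v) \<in> H}))"
    using sum_bounded_above[of Y "\<lambda>G. card (R G)"] R by simp
  finally show ?thesis unfolding X_def Y_def .
qed

text \<open>Insert the edges one by one. The first edge at a left vertex contributes a factor at
  most \<open>d1\<close>, every later one at most \<open>d1 - 1\<close>, and likewise on the right;
  this yields the exponents. With \<open>h\<close> instead of \<open>card H\<close> the base stays
  fixed throughout the induction.\<close>

lemma card_containing_le:
  assumes "finite H" "card H \<le> h"
  shows "card (containing n m d1 d2 H) * (n * d1 - h - 2 * d1 * d2) ^ card H
    \<le> card (biregular_graphs n m d1 d2) *
      (d1 ^ card (fst ` H) * (d1 - 1) ^ (card H - card (fst ` H)) *
       (d2 ^ card (snd ` H) * (d2 - 1) ^ (card H - card (snd ` H))))"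
  using assms
proof (induction H)
  case empty
  then show ?case by (simp add: containing_def)
next
  case (insert e H)
  obtain u v where e: "e = (u, v)" by (cases e)
  define M where "M = n * d1 - h - 2 * d1 * d2"
  define c where "c = card H"
  have c: "card (insert e H) = Suc c" using insert by (simp add: c_def)
  have ch: "c \<le> h" using insert c by simp
  have factor: "(d - card K) * (d ^ card S * (d - 1) ^ (c - card S))
      \<le> d ^ card S' * (d - 1) ^ (Suc c - card S')"
    if "finite S" "S' = insert x S" "x \<in> S \<longleftrightarrow> K \<noteq> {}" "finite K" "card S \<le> c"
    for d x :: nat and K :: "nat set" and S S' :: "nat set"
  proof (cases "x \<in> S")
    case True
    then have "S' = S" using that by auto
    moreover have "card K \<ge> 1" using True that by (simp add: Suc_le_eq card_gt_0_iff)
    then have "d - card K \<le> d - 1" by simp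
    then have "(d - card K) * (d ^ card S * (d - 1) ^ (c - card S)) \<le> (d - 1) * (d ^ card S * (d - 1) ^ (c - card S))"
      by (rule mult_right_mono) simp
    moreover have "Suc c - card S = Suc (c - card S)" using that by simp
    ultimately show ?thesis by (simp add: mult_ac)
  next
    case False
    then have "card S' = Suc (card S)" "K = {}" using that by auto
    then show ?thesis by simp
  qed
  have fin: "finite (fst ` H)" "finite (snd ` H)" using insert by auto
  have le: "card (fst ` H) \<le> c" "card (snd ` H) \<le> c" using insert by (auto simp: c_def card_image_le)
  have f1: "(d1 - card {v. (u, v) \<in> H}) * (d1 ^ card (fst ` H) * (d1 - 1) ^ (c - card (fst ` H)))
      \<le> d1 ^ card (fst ` insert e H) * (d1 - 1) ^ (Suc c - card (fst ` insert e H))"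
    by (rule factor[of _ _ u]) (use fin le insert in \<open>force simp: e intro: finite_subset[of _ "snd ` H"]\<close>)+
  have f2: "(d2 - card {u. (u, v) \<in> H}) * (d2 ^ card (snd ` H) * (d2 - 1) ^ (c - card (snd ` H)))
      \<le> d2 ^ card (snd ` insert e H) * (d2 - 1) ^ (Suc c - card (snd ` insert e H))"
    by (rule factor[of _ _ v]) (use fin le insert in \<open>force simp: e intro: finite_subset[of _ "fst ` H"]\<close>)+
  let ?A = "d1 ^ card (fst ` H) * (d1 - 1) ^ (c - card (fst ` H))"
  let ?B = "d2 ^ card (snd ` H) * (d2 - 1) ^ (c - card (snd ` H))"
  let ?a = "d1 - card {v. (u, v) \<in> H}" and ?b = "d2 - card {u. (u, v) \<in> H}"
  let ?N = "card (biregular_graphs n m d1 d2)"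
  have "card (containing n m d1 d2 (insert e H)) * M \<le> card (containing n m d1 d2 (insert e H)) * (n * d1 - card H - 2 * d1 * d2)"
    using ch by (intro mult_left_mono) (auto simp: M_def c_def)
  also have "\<dots> \<le> card (containing n m d1 d2 H) * (?a * ?b)"
    using card_containing_insert[of u v H n m d1 d2] insert by (simp add: e)
  finally have "card (containing n m d1 d2 (insert e H)) * M * M ^ c \<le> card (containing n m d1 d2 H) * (?a * ?b) * M ^ c"
    by (rule mult_right_mono) simp
  also have "\<dots> = (card (containing n m d1 d2 H) * M ^ c) * (?a * ?b)" by simp
  also have "\<dots> \<le> (?N * (?A * ?B)) * (?a * ?b)"
    using insert ch by (intro mult_right_mono) (auto simp: M_def c_def)
  also have "\<dots> = ?N * ((?a * ?A) * (?b * ?B))" by (simp only: mult_ac)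
  also have "\<dots> \<le> ?N * ((d1 ^ card (fst ` insert e H) * (d1 - 1) ^ (Suc c - card (fst ` insert e H))) *
     (d2 ^ card (snd ` insert e H) * (d2 - 1) ^ (Suc c - card (snd ` insert e H))))"
    by (intro mult_left_mono mult_mono f1 f2) auto
  finally show ?case unfolding c M_def by (simp add: mult_ac)
qed

section \<open>Expected numbers of small subgraphs\<close>

lemma card_filter_as_sum:
  "finite A \<Longrightarrow> card {x \<in> A. P x} = (\<Sum>x\<in>A. if P x then 1 else 0)"
  by (simp add: sum.If_cases Int_def)

lemma sum_card_swap:
  assumes "finite A" "finite B"
  shows "(\<Sum>x\<in>A. card {y \<in> B. R x y}) = (\<Sum>y\<in>B. card {x \<in> A. R x y})"
  by (simp only: card_filter_as_sum[OF assms(1)] card_filter_as_sum[OF assms(2)]) (rule sum.swap)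

section \<open>Vertex lists with a prescribed side pattern\<close>

definition verts :: "nat \<Rightarrow> nat \<Rightarrow> (nat + nat) set" where
  "verts n m = Inl ` {0..<n} \<union> Inr ` {0..<m}"

fun altl :: "bool \<Rightarrow> nat \<Rightarrow> bool list" where
  "altl b 0 = []"
| "altl b (Suc L) = b # altl (\<not> b) L"

lemma length_altl [simp]: "length (altl b L) = L"
  by (induction L arbitrary: b) auto

lemma altl_nth: "i < L \<Longrightarrow> altl b L ! i \<longleftrightarrow> (b \<longleftrightarrow> even i)"
  by (induction L arbitrary: b i) (auto simp: nth_Cons split: nat.splits)

lemma count_altl: "count_list (altl b L) b = (L + 1) div 2 \<and> count_list (altl b L) (\<not> b) = L div 2"
proof (induction L arbitrary: b)
  case (Suc L)
  from Suc[of "\<not> b"] show ?case by auto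
qed simp

lemma count_altl_le: "count_list (altl b L) c \<le> (L + 1) div 2"
  using count_altl[of b L] by (cases "c = b") auto

lemma map_isl_alt: "alt xs \<Longrightarrow> xs = [] \<or> isl (hd xs) = b \<Longrightarrow> map isl xs = altl b (length xs)"
proof (rule nth_equalityI)
  fix i assume "alt xs" "xs = [] \<or> isl (hd xs) = b" "i < length (map isl xs)"
  then show "map isl xs ! i = altl b (length xs) ! i"
    using alt_nth[of xs i] altl_nth[of i "length xs" b] by auto
qed simp

lemma card_lists_with_sides:
  "finite {zs. map isl zs = bs \<and> set zs \<subseteq> verts n m} \<and>
   card {zs. map isl zs = bs \<and> set zs \<subseteq> verts n m} = n ^ count_list bs True * m ^ count_list bs False"
proof (induction bs)
  case Nil
  have "{zs. map isl zs = [] \<and> set zs \<subseteq> verts n m} = {[]}" by auto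
  then show ?case by simp
next
  case (Cons b bs)
  define S where "S = {x \<in> verts n m. isl x = b}"
  have S: "S = (if b then Inl ` {0..<n} else Inr ` {0..<m})" by (auto simp: S_def verts_def)
  have cS: "finite S" "card S = (if b then n else m)" unfolding S by (auto simp: card_image)
  have eq: "{zs. map isl zs = b # bs \<and> set zs \<subseteq> verts n m}
      = (\<lambda>(x, zs). x # zs) ` (S \<times> {zs. map isl zs = bs \<and> set zs \<subseteq> verts n m})"
    by (auto simp: S_def map_eq_Cons_conv image_iff)
  have "inj_on (\<lambda>(x, zs). x # zs) (S \<times> {zs. map isl zs = bs \<and> set zs \<subseteq> verts n m})"
    by (auto simp: inj_on_def)
  then show ?case unfolding eq using Cons cS by (auto simp: card_image card_cartesian_product)
qed

lemma card_sides:
  assumes "distinct zs"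
  shows "card {u. Inl u \<in> set zs} = count_list (map isl zs) True"
    "card {v. Inr v \<in> set zs} = count_list (map isl zs) False"
proof -
  have "{u. Inl u \<in> set zs} = projl ` set (filter isl zs)" by (force simp: image_iff isl_def)
  moreover have "inj_on projl (set (filter isl zs))" by (auto simp: inj_on_def isl_def)
  ultimately have "card {u. Inl u \<in> set zs} = length (filter isl zs)"
    using assms by (metis card_image distinct_card distinct_filter)
  then show "card {u. Inl u \<in> set zs} = count_list (map isl zs) True"
    by (simp add: count_list_eq_length_filter filter_map o_def)
  have "{v. Inr v \<in> set zs} = projr ` set (filter (\<lambda>x. \<not> isl x) zs)"
  proof (intro equalityI subsetI)
    fix v assume "v \<in> {v. Inr v \<in> set zs}"
    then show "v \<in> projr ` set (filter (\<lambda>x. \<not> isl x) zs)" by (intro image_eqI[of _ _ "Inr v"]) auto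
  qed auto
  moreover have "inj_on projr (set (filter (\<lambda>x. \<not> isl x) zs))"
    by (auto simp: inj_on_def) (metis sum.collapse(2))
  ultimately have "card {v. Inr v \<in> set zs} = length (filter (\<lambda>x. \<not> isl x) zs)"
    using assms by (metis card_image distinct_card distinct_filter)
  then show "card {v. Inr v \<in> set zs} = count_list (map isl zs) False"
    by (simp add: count_list_eq_length_filter filter_map o_def)
qed

text \<open>The last assumption makes the \<open>4 * k\<close>-th power of \<open>1 - (4 * k + 2 * d1 * d2) / (n * d1)\<close> at least
  one half, so that the containment bound loses only a factor 2 for graphs with up to \<open>4 * k\<close> edges.\<close>

locale biregular_setting =
  fixes n m d1 d2 k :: nat
  assumes edges_eq: "n * d1 = m * d2" and d1: "d1 \<ge> 3" and d2: "d2 \<ge> 2" and k: "k \<ge> 2"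
    and sparse: "8 * k * (4 * k + 2 * d1 * d2) \<le> n * d1"
begin

abbreviation "\<G> \<equiv> biregular_graphs n m d1 d2"

abbreviation total :: "(graph \<Rightarrow> 'a set) \<Rightarrow> nat" where
  "total X \<equiv> (\<Sum>G\<in>\<G>. card (X G))"

definition DD :: nat where "DD = (d1 - 1) * (d2 - 1)"

lemma DD2: "DD \<ge> 2"
proof -
  have "2 * 1 \<le> (d1 - 1) * (d2 - 1)" using d1 d2 by (intro mult_mono) auto
  then show ?thesis by (simp add: DD_def)
qed

lemma finite_G [simp]: "finite \<G>" by (rule finite_biregular_graphs)

lemma G_biregular: "G \<in> \<G> \<Longrightarrow> biregular n m d1 d2 G" by (simp add: biregular_graphs_def)

lemma finite_graph: "G \<in> \<G> \<Longrightarrow> finite G" using biregular_finite G_biregular by blast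

lemma G_subset: "G \<in> \<G> \<Longrightarrow> G \<subseteq> {0..<n} \<times> {0..<m}"
  using G_biregular by (auto simp: biregular_def)

lemma nd1_pos: "n * d1 > 0"
proof -
  have "0 < 8 * k * (4 * k + 2 * d1 * d2)" using k by simp
  then show ?thesis using sparse by linarith
qed

lemma power_M:
  assumes "h \<le> 4 * k"
  shows "(n * d1) ^ h \<le> 2 * (n * d1 - 4 * k - 2 * d1 * d2) ^ h"
    and "n * d1 - 4 * k - 2 * d1 * d2 > 0"
proof -
  define x where "x = 4 * k + 2 * d1 * d2"
  have "1 * x < 8 * k * x" using k by (intro mult_strict_right_mono) (auto simp: x_def)
  moreover have "8 * k * x \<le> n * d1" using sparse by (simp only: x_def)
  ultimately have xN: "x < n * d1" by linarith
  then show "n * d1 - 4 * k - 2 * d1 * d2 > 0" by (simp add: x_def)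
  define N where "N = real (n * d1)"
  have N: "N > 0" using nd1_pos by (simp add: N_def)
  have xr: "real x < N" unfolding N_def using xN by (rule of_nat_less_iff[THEN iffD2])
  have "real h * real x \<le> real (4 * k) * real x" using assms by (intro mult_right_mono) auto
  also have "\<dots> = real (4 * k * x)" by simp
  also have "\<dots> \<le> N / 2"
  proof -
    have "2 * (4 * k * x) \<le> n * d1" using sparse by (simp add: x_def)
    then have "real (2 * (4 * k * x)) \<le> N" unfolding N_def by (rule of_nat_mono)
    then show ?thesis by simp
  qed
  finally have hx: "real h * (real x / N) \<le> 1 / 2" using N by (simp add: field_simps)
  have "1 + real h * (- (real x / N)) \<le> (1 + (- (real x / N))) ^ h"
    using xr N by (intro Bernoulli_inequality) (simp add: field_simps)
  then have "1 / 2 \<le> (1 - real x / N) ^ h" using hx by simp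
  also have "1 - real x / N = (N - real x) / N" using N by (simp add: field_simps)
  finally have "N ^ h \<le> 2 * (N - real x) ^ h" using N by (simp add: power_divide field_simps)
  also have "N - real x = real (n * d1 - 4 * k - 2 * d1 * d2)"
    unfolding N_def using xN by (simp add: x_def of_nat_diff)
  finally have "real ((n * d1) ^ h) \<le> real (2 * (n * d1 - 4 * k - 2 * d1 * d2) ^ h)"
    unfolding N_def by simp
  then show "(n * d1) ^ h \<le> 2 * (n * d1 - 4 * k - 2 * d1 * d2) ^ h"
    by (simp only: of_nat_le_iff)
qed

text \<open>First moment bound for copies of a graph with \<open>V = length bs\<close> labelled vertices, none of
  them isolated, and \<open>V + t\<close> edges; \<open>bs\<close> records the side of each vertex.\<close>

lemma expected_copies:
  fixes H :: "walk \<Rightarrow> graph"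
  assumes X: "\<And>G. X G \<subseteq> {zs. map isl zs = bs \<and> P zs \<and> H zs \<subseteq> G}"
    and P: "\<And>zs. map isl zs = bs \<Longrightarrow> P zs \<Longrightarrow> distinct zs \<and> finite (H zs) \<and>
      Inl ` fst ` H zs \<union> Inr ` snd ` H zs = set zs \<and> card (H zs) = length bs + t"
    and len: "length bs + t \<le> 4 * k"
    and A: "count_list bs True \<le> A" "count_list bs False \<le> A"
  shows "total X * (n * d1) ^ t \<le> 2 * card \<G> * DD ^ (A + t)"
    and "G \<in> \<G> \<Longrightarrow> finite (X G)"
proof -
  define Z where "Z = {zs. map isl zs = bs \<and> P zs \<and> set zs \<subseteq> verts n m}"
  define I where "I = count_list bs True"
  define J where "J = count_list bs False"
  define h where "h = length bs + t"
  define M where "M = n * d1 - 4 * k - 2 * d1 * d2"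
  have IJ: "I + J = length bs" unfolding I_def J_def by (induction bs) auto
  have sub: "Z \<subseteq> {zs. map isl zs = bs \<and> set zs \<subseteq> verts n m}" by (auto simp: Z_def)
  have fZ: "finite Z" using card_lists_with_sides[of bs n m] finite_subset[OF sub] by blast
  have cZ: "card Z \<le> n ^ I * m ^ J"
    using card_lists_with_sides[of bs n m] card_mono[OF _ sub] by (simp add: I_def J_def)
  have eq: "{zs. map isl zs = bs \<and> P zs \<and> H zs \<subseteq> G} = {zs \<in> Z. H zs \<subseteq> G}" if "G \<in> \<G>" for G
  proof -
    have "set zs \<subseteq> verts n m" if "map isl zs = bs" "P zs" "H zs \<subseteq> G" for zs
    proof -
      have "set zs = Inl ` fst ` H zs \<union> Inr ` snd ` H zs" using P that by blast
      also have "\<dots> \<subseteq> verts n m" using that(3) G_subset[OF \<open>G \<in> \<G>\<close>] by (force simp: verts_def)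
      finally show ?thesis .
    qed
    then show ?thesis by (auto simp: Z_def)
  qed
  have XZ: "X G \<subseteq> {zs \<in> Z. H zs \<subseteq> G}" if "G \<in> \<G>" for G using X[of G] eq[OF that] by simp
  show "finite (X G)" if "G \<in> \<G>" for G using finite_subset[OF XZ[OF that]] fZ by simp
  have each: "card (containing n m d1 d2 (H zs)) * M ^ h \<le> card \<G> * (d1 ^ I * d2 ^ J * DD ^ (A + t))"
    if "zs \<in> Z" for zs
  proof -
    have zs: "distinct zs" "finite (H zs)" "Inl ` fst ` H zs \<union> Inr ` snd ` H zs = set zs"
      "card (H zs) = h" "map isl zs = bs"
      using P that by (auto simp: Z_def h_def)
    have "fst ` H zs = {u. Inl u \<in> set zs}" "snd ` H zs = {v. Inr v \<in> set zs}"
      unfolding zs(3)[symmetric] by auto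
    then have c: "card (fst ` H zs) = I" "card (snd ` H zs) = J"
      using card_sides[OF zs(1)] zs(5) by (simp_all add: I_def J_def)
    \<comment> \<open>No vertex is isolated, so each left vertex takes one factor \<open>d1\<close>
      and the other \<open>h - I\<close> edges take \<open>d1 - 1\<close> each; symmetrically on the
      right.\<close>
    have hI: "h - I = J + t" "h - J = I + t" using IJ by (auto simp: h_def)
    have "card (containing n m d1 d2 (H zs)) * M ^ h \<le>
       card \<G> * (d1 ^ I * (d1 - 1) ^ (J + t) * (d2 ^ J * (d2 - 1) ^ (I + t)))"
      using card_containing_le[OF zs(2), of "4 * k" n m d1 d2] len zs(4) unfolding c hI[symmetric] M_def h_def
      by simp
    \<comment> \<open>With both exponents raised to \<open>A + t\<close> the factors combine to a
      power of \<open>DD\<close>; this is why \<open>A\<close> has to bound both sides of the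
      pattern.\<close>
    also have "\<dots> \<le> card \<G> * (d1 ^ I * (d1 - 1) ^ (A + t) * (d2 ^ J * (d2 - 1) ^ (A + t)))"
      using A d1 d2 by (intro mult_mono power_increasing) (auto simp: I_def J_def)
    also have "\<dots> = card \<G> * (d1 ^ I * d2 ^ J * DD ^ (A + t))"
      by (simp add: DD_def power_mult_distrib mult_ac)
    finally show ?thesis .
  qed
  have "total X \<le> (\<Sum>G\<in>\<G>. card {zs \<in> Z. H zs \<subseteq> G})"
    using fZ by (intro sum_mono card_mono XZ) auto
  also have "\<dots> = (\<Sum>zs\<in>Z. card (containing n m d1 d2 (H zs)))"
    unfolding containing_def by (rule sum_card_swap) (auto simp: fZ)
  finally have S: "total X \<le> (\<Sum>zs\<in>Z. card (containing n m d1 d2 (H zs)))" .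
  have "total X * M ^ h \<le> (\<Sum>zs\<in>Z. card (containing n m d1 d2 (H zs)) * M ^ h)"
    unfolding sum_distrib_right[symmetric] using S by (rule mult_right_mono) simp
  also have "\<dots> \<le> card Z * (card \<G> * (d1 ^ I * d2 ^ J * DD ^ (A + t)))"
    using sum_mono[OF each] by simp
  also have "\<dots> \<le> (n ^ I * m ^ J) * (card \<G> * (d1 ^ I * d2 ^ J * DD ^ (A + t)))"
    using cZ by (rule mult_right_mono) simp
  also have "\<dots> = card \<G> * ((n * d1) ^ I * (m * d2) ^ J) * DD ^ (A + t)"
    by (simp add: power_mult_distrib mult_ac)
  \<comment> \<open>The choices of the vertices and of one edge at each of them merge into a single
    power of \<open>n * d1\<close>. Compared with \<open>M ^ (length bs + t)\<close> it falls short
    by \<open>t\<close> factors, which are the gain.\<close>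
  also have "(n * d1) ^ I * (m * d2) ^ J = (n * d1) ^ length bs"
    unfolding edges_eq[symmetric] IJ[symmetric] by (simp add: power_add)
  finally have "total X * M ^ h * (n * d1) ^ t \<le> card \<G> * (n * d1) ^ length bs * DD ^ (A + t) * (n * d1) ^ t"
    by (rule mult_right_mono) simp
  also have "\<dots> = card \<G> * DD ^ (A + t) * (n * d1) ^ h"
    by (simp add: h_def power_add mult_ac)
  also have "\<dots> \<le> card \<G> * DD ^ (A + t) * (2 * M ^ h)"
    using power_M(1)[of h] len by (intro mult_left_mono) (auto simp: M_def h_def)
  finally have "(total X * (n * d1) ^ t) * M ^ h \<le> (2 * card \<G> * DD ^ (A + t)) * M ^ h"
    by (simp add: mult_ac)
  moreover have "M ^ h > 0" using power_M(2)[of 0] by (simp add: M_def)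
  ultimately show "total X * (n * d1) ^ t \<le> 2 * card \<G> * DD ^ (A + t)" by (rule mult_right_le_imp_le)
qed

end

section \<open>Vertex sets of edge sets; geometric sums\<close>

definition vs :: "graph \<Rightarrow> (nat + nat) set" where
  "vs H = Inl ` fst ` H \<union> Inr ` snd ` H"

lemma vs_insert: "isl x \<noteq> isl y \<Longrightarrow> vs (insert (ed x y) H) = {x, y} \<union> vs H"
  by (cases x; cases y) (auto simp: vs_def)

lemma vs_Un: "vs (A \<union> B) = vs A \<union> vs B"
  by (auto simp: vs_def)

lemma vs_pe: "alt xs \<Longrightarrow> length xs \<ge> 2 \<Longrightarrow> vs (pe xs) = set xs"
proof (induction xs rule: pe.induct)
  case (1 x y zs)
  show ?case
  proof (cases zs)
    case Nil
    then show ?thesis using 1 by (simp add: vs_insert) (simp add: vs_def)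
  next
    case (Cons z zs')
    then show ?thesis using 1 by (auto simp: vs_insert)
  qed
qed auto

lemma vs_cyc: "cycle_list j xs \<Longrightarrow> j \<ge> 1 \<Longrightarrow> vs (cyc xs) = set xs"
  using alt_even_ends[of xs j]
  by (cases "xs = []") (auto simp: cyc_def vs_insert vs_pe cycle_list_def)

text \<open>Each power of \<open>D\<close> occurs at most twice and the powers at least double, so
  the sum is at most 4 times its largest term. The induction goes in steps of 2 to follow these
  pairs.\<close>

lemma sum_pow_half:
  fixes D :: nat assumes "D \<ge> 2"
  shows "(\<Sum>r<R. D ^ (r div 2)) \<le> 4 * D ^ ((R - 1) div 2)"
proof (induction R rule: induct_nat_012)
  case (ge2 R)
  show ?case
  proof (cases "R = 0")
    case True then show ?thesis by simp
  next
    case False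
    have e: "(Suc (Suc R) - 1) div 2 = Suc ((R - 1) div 2)" using False by simp
    have "D ^ (R div 2) \<le> D ^ Suc ((R - 1) div 2)" "D ^ (Suc R div 2) \<le> D ^ Suc ((R - 1) div 2)"
      using assms by (intro power_increasing; linarith)+
    moreover have "4 * D ^ ((R - 1) div 2) \<le> 2 * D ^ Suc ((R - 1) div 2)" using assms by simp
    moreover have "(\<Sum>r<Suc (Suc R). D ^ (r div 2)) = (\<Sum>r<R. D ^ (r div 2)) + D ^ (R div 2) + D ^ (Suc R div 2)"
      by simp
    ultimately show ?thesis using ge2(1) unfolding e by linarith
  qed
qed auto

lemma sum_pow_half_Suc:
  fixes D :: nat assumes "D \<ge> 2"
  shows "(\<Sum>s<S. D ^ ((s + 1) div 2)) \<le> 4 * D ^ (S div 2)"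
proof -
  have "(\<Sum>s<S. D ^ ((s + 1) div 2)) = (\<Sum>r\<in>Suc ` {..<S}. D ^ (r div 2))"
    by (subst sum.reindex) auto
  also have "\<dots> \<le> (\<Sum>r<Suc S. D ^ (r div 2))" by (rule sum_mono2) auto
  also have "\<dots> \<le> 4 * D ^ (S div 2)" using sum_pow_half[OF assms, of "Suc S"] by simp
  finally show ?thesis .
qed

text \<open>Each inner sum is dominated by its last term, and these terms are geometric in
  \<open>p\<close> again: 4 * 4 = 16, with no factor \<open>k\<close>.\<close>

lemma sum_pow_half_triangle:
  fixes D :: nat assumes "D \<ge> 2" "k \<ge> 1"
  shows "(\<Sum>p<2 * k. \<Sum>s<2 * k - 1 - p. D ^ ((s + 1) div 2)) \<le> 16 * D ^ (k - 1)"
proof -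
  have "(\<Sum>p<2 * k. \<Sum>s<2 * k - 1 - p. D ^ ((s + 1) div 2)) \<le> (\<Sum>p<2 * k. 4 * D ^ ((2 * k - 1 - p) div 2))"
    by (intro sum_mono sum_pow_half_Suc assms)
  also have "\<dots> = 4 * (\<Sum>r<2 * k. D ^ (r div 2))"
    unfolding sum_distrib_left[symmetric] using sum.nat_diff_reindex[of "\<lambda>r. D ^ (r div 2)" "2 * k"] by simp
  also have "\<dots> \<le> 4 * (4 * D ^ ((2 * k - 1) div 2))" by (intro mult_left_mono sum_pow_half assms) simp
  also have "(2 * k - 1) div 2 = k - 1" using assms by linarith
  finally show ?thesis by simp
qed

section \<open>First moments of paths and cycles with an ear, and of disjoint cycles\<close>

context biregular_setting
begin

text \<open>\<open>take L zs\<close> is a path and \<open>drop L zs\<close> is the interior of an excursion.\<close>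

definition path_excursions :: "bool \<Rightarrow> nat \<Rightarrow> nat \<Rightarrow> nat \<Rightarrow> nat \<Rightarrow> graph \<Rightarrow> walk set" where
  "path_excursions b L p q s G = {zs. length zs = L + s \<and> isl (hd zs) = b \<and> is_path G (take L zs) \<and>
      excursion G (take L zs) p q (drop L zs)}"

text \<open>\<open>excursion\<close> keeps the ear off the path edges only. The closing edge is
  excluded separately, since it would itself count as an ear without inner vertices.\<close>

definition cycle_excursions :: "nat \<Rightarrow> nat \<Rightarrow> nat \<Rightarrow> graph \<Rightarrow> walk set" where
  "cycle_excursions p q s G = {zs. length zs = 2 * k + s \<and> take (2 * k) zs \<in> cycle_lists k G \<and>
      excursion G (take (2 * k) zs) p q (drop (2 * k) zs) \<and>
      ed (last (take (2 * k) zs)) (hd (take (2 * k) zs)) \<notin>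
        pe (take (2 * k) zs ! p # drop (2 * k) zs @ [take (2 * k) zs ! q])}"

lemma map_isl_excursion:
  assumes "alt xs" "isl (hd xs) = b" "length xs = L" "p < L" "alt (xs ! p # ys @ [z])"
  shows "map isl (xs @ ys) = altl b L @ altl (b \<noteq> even p) (length ys)"
proof -
  have "xs \<noteq> []" using assms by auto
  then have 1: "map isl xs = altl b L" using map_isl_alt[of xs b] assms by simp
  have "isl (xs ! p) = (b = even p)" using alt_nth[of xs p] assms by auto
  then have "ys = [] \<or> isl (hd ys) = (b \<noteq> even p)" using assms(5) by (auto simp: alt_Cons)
  moreover have "alt ys" using assms(5) by (cases "ys = []") (auto simp: alt_Cons alt_append)
  ultimately show ?thesis using 1 map_isl_alt[of ys] by simp
qed

lemma excursion_vs_card: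
  assumes "excursion G xs p q ys" "distinct xs"
  shows "vs (pe (xs ! p # ys @ [xs ! q])) = {xs ! p, xs ! q} \<union> set ys"
    "card (pe (xs ! p # ys @ [xs ! q])) = length ys + 1" "distinct (xs @ ys)"
proof -
  have "distinct (xs ! p # ys @ [xs ! q])"
    using assms nth_mem[of p xs] nth_mem[of q xs] by (auto simp: excursion_def nth_eq_iff_index_eq)
  then show "card (pe (xs ! p # ys @ [xs ! q])) = length ys + 1"
    using assms by (subst card_pe) (auto simp: excursion_def)
  show "vs (pe (xs ! p # ys @ [xs ! q])) = {xs ! p, xs ! q} \<union> set ys"
    using assms by (subst vs_pe) (auto simp: excursion_def)
  show "distinct (xs @ ys)" using assms by (auto simp: excursion_def)
qed

text \<open>A path with an ear has as many edges as vertices, hence \<open>t = 0\<close>. The two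
  halves are rounded up separately, because path and ear may have their surplus vertices on the same
  side.\<close>

lemma expected_path_excursions:
  assumes L: "L \<ge> 2" "L + s \<le> 4 * k"
  shows "total (path_excursions b L p q s) \<le> 2 * card \<G> * DD ^ ((L + 1) div 2 + (s + 1) div 2)"
    and "G \<in> \<G> \<Longrightarrow> finite (path_excursions b L p q s G)"
proof -
  define bs where "bs = altl b L @ altl (b \<noteq> even p) s"
  define Q where "Q = (\<lambda>zs :: walk. take L zs ! p # drop L zs @ [take L zs ! q])"
  define H where "H = (\<lambda>zs. pe (take L zs) \<union> pe (Q zs))"
  define P where "P = (\<lambda>zs. distinct (take L zs) \<and> alt (take L zs) \<and> excursion UNIV (take L zs) p q (drop L zs))"
  define A where "A = (L + 1) div 2 + (s + 1) div 2"
  have sub: "path_excursions b L p q s G \<subseteq> {zs. map isl zs = bs \<and> P zs \<and> H zs \<subseteq> G}" for G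
  proof
    fix zs assume zs: "zs \<in> path_excursions b L p q s G"
    then have e: "length zs = L + s" "isl (hd zs) = b" "is_path G (take L zs)" "excursion G (take L zs) p q (drop L zs)"
      by (auto simp: path_excursions_def)
    have "map isl (take L zs @ drop L zs) = altl b L @ altl (b \<noteq> even p) (length (drop L zs))"
      by (rule map_isl_excursion[where z="take L zs ! q"])
        (use e L in \<open>auto simp: is_path_def excursion_def\<close>)
    then have "map isl zs = bs" using e by (simp add: bs_def)
    moreover have "P zs" using e by (auto simp: P_def is_path_def excursion_def)
    moreover have "H zs \<subseteq> G" using e by (auto simp: H_def Q_def is_path_def excursion_def)
    ultimately show "zs \<in> {zs. map isl zs = bs \<and> P zs \<and> H zs \<subseteq> G}" by simp
  qed
  have P: "distinct zs \<and> finite (H zs) \<and> Inl ` fst ` H zs \<union> Inr ` snd ` H zs = set zs \<and>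
      card (H zs) = length bs + 0" if "map isl zs = bs" "P zs" for zs
  proof -
    have len: "length zs = L + s" using arg_cong[OF that(1), of length] by (simp add: bs_def)
    define xs ys where "xs = take L zs" and "ys = drop L zs"
    have zs: "zs = xs @ ys" "length xs = L" "length ys = s" using len by (auto simp: xs_def ys_def)
    have ex: "distinct xs" "alt xs" "excursion UNIV xs p q ys" using that(2) by (auto simp: P_def xs_def ys_def)
    note ec = excursion_vs_card[OF ex(3,1)]
    have H: "H zs = pe xs \<union> pe (xs ! p # ys @ [xs ! q])" by (simp add: H_def Q_def xs_def ys_def)
    have "vs (H zs) = set zs" unfolding H vs_Un ec(1) using ex zs L by (auto simp: vs_pe excursion_def)
    moreover have "card (H zs) = (L - 1) + (s + 1)"
      unfolding H using ex ec(2) zs card_pe[OF ex(1,2)]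
      by (subst card_Un_disjoint) (auto simp: excursion_def)
    moreover have "finite (H zs)" by (simp add: H)
    ultimately show ?thesis using ec(3) zs(1) L by (simp add: vs_def bs_def)
  qed
  have len: "length bs + 0 \<le> 4 * k" using L by (simp add: bs_def)
  have A: "count_list bs True \<le> A" "count_list bs False \<le> A"
    unfolding bs_def A_def count_list_append by (intro add_mono count_altl_le)+
  note ec = expected_copies[OF sub P len A]
  show "finite (path_excursions b L p q s G)" if "G \<in> \<G>" using ec(2)[OF _ _ that] by blast
  show "total (path_excursions b L p q s) \<le> 2 * card \<G> * DD ^ ((L + 1) div 2 + (s + 1) div 2)"
    using ec(1) by (simp add: A_def)
qed

text \<open>A cycle with an ear has one more edge than vertices, hence \<open>t = 1\<close>. The
  gain of \<open>1 / (n * d1)\<close> pays for the free choice of the second edge of the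
  switching.\<close>

lemma expected_cycle_excursions:
  assumes L: "2 * k + s + 1 \<le> 4 * k"
  shows "total (cycle_excursions p q s) * (n * d1) \<le> 2 * card \<G> * DD ^ (k + (s + 1) div 2 + 1)"
    and "G \<in> \<G> \<Longrightarrow> finite (cycle_excursions p q s G)"
proof -
  define L where "L = 2 * k"
  define bs where "bs = altl True L @ altl (True \<noteq> even p) s"
  define Q where "Q = (\<lambda>zs :: walk. take L zs ! p # drop L zs @ [take L zs ! q])"
  define H where "H = (\<lambda>zs. cyc (take L zs) \<union> pe (Q zs))"
  define P where "P = (\<lambda>zs. cycle_list k (take L zs) \<and> excursion UNIV (take L zs) p q (drop L zs) \<and>
     ed (last (take L zs)) (hd (take L zs)) \<notin> pe (Q zs))"
  define A where "A = k + (s + 1) div 2"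
  have sub: "cycle_excursions p q s G \<subseteq> {zs. map isl zs = bs \<and> P zs \<and> H zs \<subseteq> G}" for G
  proof
    fix zs assume zs: "zs \<in> cycle_excursions p q s G"
    then have e: "length zs = L + s" "cycle_list k (take L zs)" "cyc (take L zs) \<subseteq> G"
      "excursion G (take L zs) p q (drop L zs)" "ed (last (take L zs)) (hd (take L zs)) \<notin> pe (Q zs)"
      by (auto simp: cycle_excursions_def cycle_lists_def L_def Q_def)
    have "map isl (take L zs @ drop L zs) = altl True L @ altl (True \<noteq> even p) (length (drop L zs))"
      by (rule map_isl_excursion[where z="take L zs ! q"])
        (use e L in \<open>auto simp: excursion_def cycle_list_def\<close>)
    then have "map isl zs = bs" using e by (simp add: bs_def)
    moreover have "P zs" using e by (auto simp: P_def excursion_def)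
    moreover have "H zs \<subseteq> G" using e by (auto simp: H_def Q_def excursion_def)
    ultimately show "zs \<in> {zs. map isl zs = bs \<and> P zs \<and> H zs \<subseteq> G}" by simp
  qed
  have P: "distinct zs \<and> finite (H zs) \<and> Inl ` fst ` H zs \<union> Inr ` snd ` H zs = set zs \<and>
      card (H zs) = length bs + 1" if "map isl zs = bs" "P zs" for zs
  proof -
    have len: "length zs = L + s" using arg_cong[OF that(1), of length] by (simp add: bs_def)
    define xs ys where "xs = take L zs" and "ys = drop L zs"
    have zs: "zs = xs @ ys" "length xs = L" "length ys = s" using len by (auto simp: xs_def ys_def)
    have ex: "cycle_list k xs" "excursion UNIV xs p q ys"
      "ed (last xs) (hd xs) \<notin> pe (xs ! p # ys @ [xs ! q])"
      using that(2) by (auto simp: P_def xs_def ys_def Q_def)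
    have "distinct xs" using ex(1) by (simp add: cycle_list_def)
    note ec = excursion_vs_card[OF ex(2) this]
    have H: "H zs = cyc xs \<union> pe (xs ! p # ys @ [xs ! q])" by (simp add: H_def Q_def xs_def ys_def)
    have "vs (H zs) = set zs" unfolding H vs_Un ec(1) using ex zs k vs_cyc[OF ex(1)] by (auto simp: excursion_def)
    moreover have "card (H zs) = 2 * k + (s + 1)"
      unfolding H using ex ec(2) zs card_cyc[OF ex(1) k]
      by (subst card_Un_disjoint) (auto simp: excursion_def cyc_def)
    moreover have "finite (H zs)" by (simp add: H cyc_def)
    ultimately show ?thesis using ec(3) zs(1) L by (simp add: vs_def bs_def L_def)
  qed
  have len: "length bs + 1 \<le> 4 * k" using L by (simp add: bs_def L_def)
  have "count_list (altl True L) c \<le> k" for c using count_altl_le[of True L c] by (simp add: L_def)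
  then have A: "count_list bs True \<le> A" "count_list bs False \<le> A"
    unfolding bs_def A_def count_list_append by (intro add_mono count_altl_le; simp)+
  note ec = expected_copies[OF sub P len A]
  show "finite (cycle_excursions p q s G)" if "G \<in> \<G>" using ec(2)[OF _ _ that] by blast
  show "total (cycle_excursions p q s) * (n * d1) \<le> 2 * card \<G> * DD ^ (k + (s + 1) div 2 + 1)"
    using ec(1) by (simp add: A_def)
qed

text \<open>For the case that the second edge of the switching lies on another short cycle, disjoint
  from the first. It is then the closing edge of the second list.\<close>

definition cycle_pairs :: "nat \<Rightarrow> graph \<Rightarrow> walk set" where
  "cycle_pairs j G = {zs. length zs = 2 * k + 2 * j \<and> distinct zs \<and>
     take (2 * k) zs \<in> cycle_lists k G \<and> drop (2 * k) zs \<in> cycle_lists j G}"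

lemma expected_cycle_pairs:
  assumes j: "2 \<le> j" "j \<le> k"
  shows "total (cycle_pairs j) \<le> 2 * card \<G> * DD ^ (k + j)"
    and "G \<in> \<G> \<Longrightarrow> finite (cycle_pairs j G)"
proof -
  define bs where "bs = altl True (2 * k) @ altl True (2 * j)"
  define H where "H = (\<lambda>zs. cyc (take (2 * k) zs) \<union> cyc (drop (2 * k) zs))"
  define P where "P = (\<lambda>zs. distinct zs \<and> cycle_list k (take (2 * k) zs) \<and> cycle_list j (drop (2 * k) zs))"
  have sub: "cycle_pairs j G \<subseteq> {zs. map isl zs = bs \<and> P zs \<and> H zs \<subseteq> G}" for G
  proof
    fix zs assume "zs \<in> cycle_pairs j G"
    then have e: "distinct zs" "cycle_list k (take (2 * k) zs)" "cyc (take (2 * k) zs) \<subseteq> G"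
      "cycle_list j (drop (2 * k) zs)" "cyc (drop (2 * k) zs) \<subseteq> G"
      by (auto simp: cycle_pairs_def cycle_lists_def)
    have "map isl (take (2 * k) zs @ drop (2 * k) zs) = bs"
      unfolding map_append bs_def using map_isl_alt[of "take (2 * k) zs" True] map_isl_alt[of "drop (2 * k) zs" True] e
      by (simp add: cycle_list_def)
    then have "map isl zs = bs" by simp
    then show "zs \<in> {zs. map isl zs = bs \<and> P zs \<and> H zs \<subseteq> G}" using e by (auto simp: P_def H_def)
  qed
  have P: "distinct zs \<and> finite (H zs) \<and> Inl ` fst ` H zs \<union> Inr ` snd ` H zs = set zs \<and>
      card (H zs) = length bs + 0" if "map isl zs = bs" "P zs" for zs
  proof -
    define xs ys where "xs = take (2 * k) zs" and "ys = drop (2 * k) zs"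
    have zs: "zs = xs @ ys" by (auto simp: xs_def ys_def)
    have ex: "cycle_list k xs" "cycle_list j ys" "set xs \<inter> set ys = {}" "distinct zs"
      using that(2) set_take_disj_set_drop_if_distinct[of zs "2 * k" "2 * k"] by (auto simp: P_def xs_def ys_def)
    have H: "H zs = cyc xs \<union> cyc ys" by (simp add: H_def xs_def ys_def)
    have v: "vs (cyc xs) = set xs" "vs (cyc ys) = set ys" using vs_cyc[OF ex(1)] vs_cyc[OF ex(2)] k j by auto
    have "cyc xs \<inter> cyc ys = {}" using ex(3) unfolding v[symmetric] by (fastforce simp: vs_def)
    then have "card (H zs) = 2 * k + 2 * j"
      unfolding H using card_cyc[OF ex(1) k] card_cyc[OF ex(2) j(1)]
      by (subst card_Un_disjoint) (auto simp: cyc_def)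
    moreover have "vs (H zs) = set zs" unfolding H vs_Un v using zs by simp
    moreover have "finite (H zs)" by (simp add: H cyc_def)
    ultimately show ?thesis using ex(4) by (simp add: vs_def bs_def)
  qed
  have len: "length bs + 0 \<le> 4 * k" using j by (simp add: bs_def)
  have "count_list (altl True (2 * i)) c \<le> i" for c i using count_altl_le[of True "2 * i" c] by simp
  then have A: "count_list bs True \<le> k + j" "count_list bs False \<le> k + j"
    unfolding bs_def count_list_append by (intro add_mono; simp)+
  note ec = expected_copies[OF sub P len A]
  show "finite (cycle_pairs j G)" if "G \<in> \<G>" using ec(2)[OF _ _ that] by blast
  show "total (cycle_pairs j) \<le> 2 * card \<G> * DD ^ (k + j)" using ec(1) by simp
qed

lemma expected_cycle_lists: "total (cycle_lists k) \<le> 2 * card \<G> * DD ^ k"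
proof -
  define bs where "bs = altl True (2 * k)"
  have sub: "cycle_lists k G \<subseteq> {zs. map isl zs = bs \<and> cycle_list k zs \<and> cyc zs \<subseteq> G}" for G
    using map_isl_alt[of _ True] by (auto simp: cycle_lists_def cycle_list_def bs_def)
  have P: "distinct zs \<and> finite (cyc zs) \<and> Inl ` fst ` cyc zs \<union> Inr ` snd ` cyc zs = set zs \<and>
      card (cyc zs) = length bs + 0" if "map isl zs = bs" "cycle_list k zs" for zs
    using that card_cyc[of k zs] vs_cyc[of k zs] k by (auto simp: bs_def vs_def cycle_list_def cyc_def)
  have len: "length bs + 0 \<le> 4 * k" by (simp add: bs_def)
  have "count_list bs c \<le> k" for c using count_altl_le[of True "2 * k" c] by (simp add: bs_def)
  then have A: "count_list bs True \<le> k" "count_list bs False \<le> k" by auto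
  show ?thesis using expected_copies(1)[OF sub P len A] by simp
qed

end

section \<open>Nonbacktracking walks\<close>

fun nb :: "walk \<Rightarrow> bool" where
  "nb (x # y # z # zs) \<longleftrightarrow> x \<noteq> z \<and> nb (y # z # zs)"
| "nb _ \<longleftrightarrow> True"

lemma distinct_nb: "distinct xs \<Longrightarrow> nb xs"
  by (induction xs rule: nb.induct) auto

definition nbwalk :: "graph \<Rightarrow> walk \<Rightarrow> bool" where
  "nbwalk G ws \<longleftrightarrow> alt ws \<and> nb ws \<and> pe ws \<subseteq> G"

lemma is_path_nbwalk: "is_path G ws \<Longrightarrow> nbwalk G ws"
  by (auto simp: is_path_def nbwalk_def distinct_nb)

lemma nb_Cons: "length ws \<ge> 2 \<Longrightarrow> nb (y # ws) \<longleftrightarrow> y \<noteq> ws ! 1 \<and> nb ws"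
  by (cases ws; cases "tl ws") auto

definition nbrs :: "graph \<Rightarrow> nat + nat \<Rightarrow> (nat + nat) set" where
  "nbrs G x = {y. isl y \<noteq> isl x \<and> ed y x \<in> G}"

lemma nbwalk_Cons:
  "length ws \<ge> 2 \<Longrightarrow> nbwalk G (y # ws) \<longleftrightarrow> nbwalk G ws \<and> y \<in> nbrs G (hd ws) \<and> y \<noteq> ws ! 1"
  by (cases "ws = []") (auto simp: nbwalk_def nb_Cons alt_Cons pe_Cons nbrs_def)

lemma nbwalk_ConsD: "nbwalk G (y # ws) \<Longrightarrow> nbwalk G ws"
  by (cases "length ws \<ge> 2"; cases ws; cases "tl ws") (auto simp: nbwalk_Cons nbwalk_def)

lemma nbwalk_appendD: "nbwalk G (as @ bs) \<Longrightarrow> nbwalk G bs"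
  by (induction as) (auto dest: nbwalk_ConsD)

context biregular_setting
begin

definition deg :: "bool \<Rightarrow> nat" where "deg b = (if b then d1 else d2)"

lemma deg_le: "deg b \<le> 2 * (deg b - 1)" using d1 d2 by (auto simp: deg_def)

lemma card_nbrs:
  assumes "G \<in> \<G>" "x \<in> verts n m"
  shows "finite (nbrs G x)" "card (nbrs G x) = deg (isl x)"
proof -
  note bi = G_biregular[OF assms(1)]
  have "finite (nbrs G x) \<and> card (nbrs G x) = deg (isl x)"
  proof (cases x)
    case (Inl u)
    have "nbrs G x = Inr ` {v. (u, v) \<in> G}"
    proof (intro equalityI subsetI)
      fix y assume "y \<in> nbrs G x"
      then show "y \<in> Inr ` {v. (u, v) \<in> G}" by (cases y) (auto simp: nbrs_def Inl)
    qed (auto simp: nbrs_def Inl)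
    then show ?thesis using biregular_finite_nbrs[OF bi] bi assms(2) Inl
      by (auto simp: card_image deg_def biregular_def verts_def)
  next
    case (Inr v)
    have "nbrs G x = Inl ` {u. (u, v) \<in> G}"
    proof (intro equalityI subsetI)
      fix y assume "y \<in> nbrs G x"
      then show "y \<in> Inl ` {u. (u, v) \<in> G}" by (cases y) (auto simp: nbrs_def Inr)
    qed (auto simp: nbrs_def Inr)
    then show ?thesis using biregular_finite_nbrs[OF bi] bi assms(2) Inr
      by (auto simp: card_image deg_def biregular_def verts_def)
  qed
  then show "finite (nbrs G x)" "card (nbrs G x) = deg (isl x)" by auto
qed

lemma vs_G: "G \<in> \<G> \<Longrightarrow> H \<subseteq> G \<Longrightarrow> vs H \<subseteq> verts n m"
  using G_subset[of G] by (force simp: vs_def verts_def)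

lemma nbwalk_verts:
  assumes "G \<in> \<G>" "nbwalk G ws" "length ws \<ge> 2"
  shows "set ws \<subseteq> verts n m"
  using vs_G[OF assms(1), of "pe ws"] vs_pe[of ws] assms by (auto simp: nbwalk_def)

text \<open>The number of ways to prolong a nonbacktracking walk by \<open>L\<close> steps beyond
  its head, if the head lies on side \<open>b\<close>.\<close>

fun wprod :: "bool \<Rightarrow> nat \<Rightarrow> nat" where
  "wprod b 0 = 1"
| "wprod b (Suc L) = (deg b - 1) * wprod (\<not> b) L"

lemma wprod_Suc: "wprod b (Suc L) = wprod b L * (deg (b = even L) - 1)"
proof (induction L arbitrary: b)
  case (Suc L)
  have "wprod b (Suc (Suc L)) = (deg b - 1) * wprod (\<not> b) (Suc L)" by simp
  also have "\<dots> = (deg b - 1) * wprod (\<not> b) L * (deg ((\<not> b) = even L) - 1)"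
    unfolding Suc by simp
  also have "((\<not> b) = even L) = (b = even (Suc L))" by auto
  finally show ?case by simp
qed simp

lemma deg_mult: "(deg b - 1) * (deg (\<not> b) - 1) = DD"
  by (cases b) (auto simp: deg_def DD_def)

lemma wprod_even: "wprod b (2 * s) = DD ^ s"
proof (induction s)
  case (Suc s)
  have "wprod b (2 * Suc s) = (deg b - 1) * (deg (\<not> b) - 1) * wprod b (2 * s)" by simp
  then show ?case using Suc unfolding deg_mult by simp
qed simp

lemma deg_le_DD: "deg b - 1 \<le> DD"
  using d1 d2 by (auto simp: deg_def DD_def)

lemma wprod_le: "wprod b L \<le> DD ^ ((L + 1) div 2)"
proof (cases "even L")
  case True
  then obtain s where "L = 2 * s" by blast
  then show ?thesis using wprod_even[of b s] by simp
next
  case False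
  then obtain s where L: "L = Suc (2 * s)" by (metis oddE Suc_eq_plus1)
  have "wprod b L = (deg b - 1) * DD ^ s" unfolding L by (simp add: wprod_even)
  also have "\<dots> \<le> DD * DD ^ s" by (intro mult_right_mono deg_le_DD) simp
  finally show ?thesis by (simp add: L)
qed

text \<open>A vertex put in front may be any neighbour of the head except the second vertex, so two
  vertices must be fixed to start with. By biregularity the number of choices depends on the side
  only, which makes the count exact.\<close>

lemma card_nbwalk_extensions:
  assumes G: "G \<in> \<G>" and bs: "nbwalk G bs" "length bs \<ge> 2"
  shows "finite {ws. nbwalk G ws \<and> length ws = a + length bs \<and> drop a ws = bs} \<and>
    card {ws. nbwalk G ws \<and> length ws = a + length bs \<and> drop a ws = bs} = wprod (isl (hd bs)) a"
proof (induction a)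
  case 0
  have "{ws. nbwalk G ws \<and> length ws = 0 + length bs \<and> drop 0 ws = bs} = {bs}" using bs by auto
  then show ?case by simp
next
  case (Suc a)
  define X where "X = {ws. nbwalk G ws \<and> length ws = a + length bs \<and> drop a ws = bs}"
  define N where "N = (\<lambda>ws. nbrs G (hd ws) - {ws ! 1})"
  have eq: "{ws. nbwalk G ws \<and> length ws = Suc a + length bs \<and> drop (Suc a) ws = bs}
     = (\<lambda>(ws, y). y # ws) ` Sigma X N" (is "?L = ?R")
  proof (intro equalityI subsetI)
    fix zs assume z: "zs \<in> ?L"
    then obtain y ws where zs: "zs = y # ws" by (cases zs) auto
    have ws: "nbwalk G (y # ws)" "length ws = a + length bs" "drop a ws = bs" using z zs by auto
    have "length ws \<ge> 2" using ws(2) bs(2) by linarith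
    then have "ws \<in> X" "y \<in> N ws" using ws by (simp_all add: X_def N_def nbwalk_Cons)
    then show "zs \<in> ?R" unfolding zs by (intro image_eqI[of _ _ "(ws, y)"]) auto
  next
    fix zs assume "zs \<in> ?R"
    then obtain ws y where zs: "zs = y # ws" "ws \<in> X" "y \<in> N ws" by auto
    then have ws: "nbwalk G ws" "length ws = a + length bs" "drop a ws = bs" by (simp_all add: X_def)
    have "length ws \<ge> 2" using ws(2) bs(2) by linarith
    then show "zs \<in> ?L" using ws zs by (simp add: N_def nbwalk_Cons)
  qed
  have cN: "finite (N ws)" "card (N ws) = deg (isl (hd bs) = even a) - 1" if "ws \<in> X" for ws
  proof -
    have ws: "nbwalk G ws" "length ws = a + length bs" "drop a ws = bs" using that by (auto simp: X_def)
    have "length ws \<ge> 2" using ws(2) bs(2) by linarith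
    moreover then have "ws \<noteq> []" by auto
    ultimately have hv: "hd ws \<in> verts n m" using nbwalk_verts[OF G ws(1)] by auto
    have al: "a < length ws" using ws(2) bs(2) by linarith
    then have "hd bs = ws ! a" using ws(3) hd_drop_conv_nth[of a ws] by simp
    then have par: "isl (hd ws) = (isl (hd bs) = even a)"
      using alt_nth[of ws a] ws(1) al by (auto simp: nbwalk_def)
    obtain x y r where wx: "ws = x # y # r" using \<open>length ws \<ge> 2\<close> by (metis Suc_le_length_iff numeral_2_eq_2)
    then have "ws ! 1 \<in> nbrs G (hd ws)" using ws(1) ed_commute[of x y] by (auto simp: nbrs_def nbwalk_def)
    then show "finite (N ws)" "card (N ws) = deg (isl (hd bs) = even a) - 1"
      using card_nbrs[OF G hv] par by (auto simp: N_def)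
  qed
  have fX: "finite X" "card X = wprod (isl (hd bs)) a" using Suc by (auto simp: X_def)
  have "inj_on (\<lambda>(ws, y). y # ws) (Sigma X N)" by (auto simp: inj_on_def)
  then have "card ?L = card (Sigma X N)" unfolding eq by (rule card_image)
  also have "\<dots> = (\<Sum>ws\<in>X. card (N ws))" using fX cN by simp
  also have "\<dots> = wprod (isl (hd bs)) (Suc a)" using fX cN by (simp add: wprod_Suc del: wprod.simps)
  finally show ?case using eq fX cN by auto
qed

text \<open>Only the edge at \<open>c\<close> has the full degree to choose from; all other steps
  exclude the way back.\<close>

lemma card_nbwalks_to:
  assumes G: "G \<in> \<G>" and c: "c \<in> verts n m"
  shows "finite {ws. nbwalk G ws \<and> length ws = Suc (Suc L) \<and> last ws = c} \<and>
    card {ws. nbwalk G ws \<and> length ws = Suc (Suc L) \<and> last ws = c} = deg (isl c) * wprod (\<not> isl c) L"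
proof -
  define X where "X = (\<lambda>bs. {ws. nbwalk G ws \<and> length ws = L + length bs \<and> drop L ws = bs})"
  define B where "B = (\<lambda>y. [y, c]) ` nbrs G c"
  have eq: "{ws. nbwalk G ws \<and> length ws = Suc (Suc L) \<and> last ws = c} = (\<Union>bs\<in>B. X bs)" (is "?L = _")
  proof (intro equalityI subsetI)
    fix ws assume "ws \<in> ?L"
    then have ws: "nbwalk G ws" "length ws = Suc (Suc L)" "last ws = c" by auto
    have "length (drop L ws) = Suc (Suc 0)" using ws(2) by simp
    then obtain y z where d: "drop L ws = [y, z]" unfolding length_Suc_conv by auto
    have "last (drop L ws) = last ws" using ws(2) by simp
    then have z: "z = c" using ws(3) d by simp
    have "nbwalk G (drop L ws)" by (rule nbwalk_appendD[of G "take L ws"]) (simp add: ws(1))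
    then have "nbwalk G [y, z]" using d by simp
    then have "[y, c] \<in> B" using z by (auto simp: B_def nbrs_def nbwalk_def)
    moreover have "ws \<in> X [y, c]" using ws d z by (auto simp: X_def)
    ultimately show "ws \<in> (\<Union>bs\<in>B. X bs)" by blast
  next
    fix ws assume "ws \<in> (\<Union>bs\<in>B. X bs)"
    then obtain y where "y \<in> nbrs G c" and ws: "nbwalk G ws" "length ws = L + 2" "drop L ws = [y, c]"
      by (auto simp: B_def X_def)
    have "last ws = last (drop L ws)" using ws(2) by simp
    then show "ws \<in> ?L" using ws by simp
  qed
  have Xc: "finite (X bs)" "card (X bs) = wprod (\<not> isl c) L" if bsB: "bs \<in> B" for bs
  proof -
    obtain y where bs: "bs = [y, c]" "y \<in> nbrs G c" using bsB by (auto simp: B_def)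
    then have "nbwalk G bs" by (auto simp: nbwalk_def nbrs_def)
    then show "finite (X bs)" "card (X bs) = wprod (\<not> isl c) L"
      using card_nbwalk_extensions[OF G, of bs L] bs by (auto simp: X_def nbrs_def)
  qed
  have B: "finite B" "card B = deg (isl c)"
    unfolding B_def using card_nbrs[OF G c] by (auto simp: card_image inj_on_def)
  have "card ?L = (\<Sum>bs\<in>B. card (X bs))"
    unfolding eq using B Xc by (intro card_UN_disjoint) (auto simp: X_def)
  then show ?thesis using B Xc eq by auto
qed

text \<open>Counts walks to \<open>c\<close> together with one more neighbour of their first vertex,
  as needed for edges with an end near a cycle. At most two choices have a full degree, the step at
  \<open>c\<close> and the additional neighbour; \<open>deg b \<le> 2 * (deg b - 1)\<close> for each
  gives the 4.\<close>

lemma sum_deg_nbwalks_to: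
  assumes G: "G \<in> \<G>" and c: "c \<in> verts n m"
  shows "finite {ws. nbwalk G ws \<and> length ws = Suc L \<and> last ws = c}"
    "(\<Sum>ws\<in>{ws. nbwalk G ws \<and> length ws = Suc L \<and> last ws = c}. card (nbrs G (hd ws))) \<le> 4 * DD ^ (L div 2 + 1)"
    "ws \<in> {ws. nbwalk G ws \<and> length ws = Suc L \<and> last ws = c} \<Longrightarrow> finite (nbrs G (hd ws))"
proof -
  define X where "X = {ws. nbwalk G ws \<and> length ws = Suc L \<and> last ws = c}"
  have X: "finite X \<and> card X \<le> 2 * wprod (isl c) L"
  proof (cases L)
    case 0
    have "X \<subseteq> {[c]}" using 0 by (auto simp: X_def length_Suc_conv)
    then show ?thesis using 0 finite_subset[of X "{[c]}"] card_mono[of "{[c]}" X] by auto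
  next
    case (Suc L')
    have "deg (isl c) * wprod (\<not> isl c) L' \<le> 2 * (deg (isl c) - 1) * wprod (\<not> isl c) L'"
      by (intro mult_right_mono deg_le) simp
    then show ?thesis using card_nbwalks_to[OF G c, of L'] Suc by (simp add: X_def)
  qed
  have N: "finite (nbrs G (hd ws))" "card (nbrs G (hd ws)) \<le> 2 * (deg (isl c = even L) - 1)" if "ws \<in> X" for ws
  proof -
    have ws: "nbwalk G ws" "length ws = Suc L" "last ws = c" using that by (auto simp: X_def)
    have ne: "ws \<noteq> []" using ws by auto
    have "hd ws \<in> verts n m"
    proof (cases "L = 0")
      case True
      then show ?thesis using ws c by (cases ws) auto
    next
      case False
      then show ?thesis using nbwalk_verts[OF G ws(1)] ws ne by auto
    qed
    moreover have "isl c = (isl (hd ws) = even L)"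
      using alt_nth[of ws L] ws ne by (auto simp: nbwalk_def last_conv_nth)
    then have "isl (hd ws) = (isl c = even L)" by auto
    ultimately show "finite (nbrs G (hd ws))" "card (nbrs G (hd ws)) \<le> 2 * (deg (isl c = even L) - 1)"
      using card_nbrs[OF G, of "hd ws"] deg_le[of "isl c = even L"] by auto
  qed
  show "finite {ws. nbwalk G ws \<and> length ws = Suc L \<and> last ws = c}" using X by (simp add: X_def)
  show "ws \<in> {ws. nbwalk G ws \<and> length ws = Suc L \<and> last ws = c} \<Longrightarrow> finite (nbrs G (hd ws))"
    using N by (simp add: X_def)
  have "(\<Sum>ws\<in>X. card (nbrs G (hd ws))) \<le> card X * (2 * (deg (isl c = even L) - 1))"
    using sum_bounded_above[of X "\<lambda>ws. card (nbrs G (hd ws))"] N by simp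
  also have "\<dots> \<le> (2 * wprod (isl c) L) * (2 * (deg (isl c = even L) - 1))"
    using X by (intro mult_right_mono) auto
  also have "\<dots> = 4 * wprod (isl c) (Suc L)" by (simp add: wprod_Suc del: wprod.simps)
  also have "\<dots> \<le> 4 * DD ^ (L div 2 + 1)" using wprod_le[of "isl c" "Suc L"] by (simp del: wprod.simps)
  finally show "(\<Sum>ws\<in>{ws. nbwalk G ws \<and> length ws = Suc L \<and> last ws = c}. card (nbrs G (hd ws))) \<le> 4 * DD ^ (L div 2 + 1)"
    by (simp add: X_def)
qed

end

section \<open>Expected numbers of obstructions to switching\<close>

text \<open>A union bound over start \<open>p\<close>, end \<open>q\<close> and number
  \<open>s\<close> of inner vertices of an ear. Only \<open>q\<close> is charged in full, as the
  range of \<open>s\<close> depends on \<open>p\<close>. \<open>c\<close> carries the factor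
  \<open>n * d1\<close> of the cycle case.\<close>

lemma sum_card_UN3_le:
  fixes X :: "'g \<Rightarrow> 'a set" and B :: "nat \<Rightarrow> nat \<Rightarrow> nat \<Rightarrow> 'g \<Rightarrow> 'b set"
  assumes "finite A"
    and X: "\<And>G. G \<in> A \<Longrightarrow> X G \<subseteq> (\<Union>p<P. \<Union>q<Q. \<Union>s<S p. f ` B p q s G)"
    and fin: "\<And>G p q s. G \<in> A \<Longrightarrow> p < P \<Longrightarrow> q < Q \<Longrightarrow> s < S p \<Longrightarrow> finite (B p q s G)"
    and B: "\<And>p q s. p < P \<Longrightarrow> q < Q \<Longrightarrow> s < S p \<Longrightarrow> (\<Sum>G\<in>A. card (B p q s G)) * c \<le> K * g s"
  shows "(\<Sum>G\<in>A. card (X G)) * c \<le> K * Q * (\<Sum>p<P. \<Sum>s<S p. g s)"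
proof -
  have "card (X G) \<le> (\<Sum>p<P. \<Sum>q<Q. \<Sum>s<S p. card (B p q s G))" if G: "G \<in> A" for G
  proof -
    have "card (X G) \<le> card (\<Union>p<P. \<Union>q<Q. \<Union>s<S p. f ` B p q s G)"
      using fin[OF G] by (intro card_mono X G) auto
    also have "\<dots> \<le> (\<Sum>p<P. card (\<Union>q<Q. \<Union>s<S p. f ` B p q s G))" by (rule card_UN_le) simp
    also have "\<dots> \<le> (\<Sum>p<P. \<Sum>q<Q. card (\<Union>s<S p. f ` B p q s G))"
      by (intro sum_mono card_UN_le) simp
    also have "\<dots> \<le> (\<Sum>p<P. \<Sum>q<Q. \<Sum>s<S p. card (f ` B p q s G))"
      by (intro sum_mono card_UN_le) simp
    also have "\<dots> \<le> (\<Sum>p<P. \<Sum>q<Q. \<Sum>s<S p. card (B p q s G))"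
      using fin[OF G] by (intro sum_mono card_image_le) auto
    finally show ?thesis .
  qed
  then have "(\<Sum>G\<in>A. card (X G)) \<le> (\<Sum>G\<in>A. \<Sum>p<P. \<Sum>q<Q. \<Sum>s<S p. card (B p q s G))"
    by (intro sum_mono) auto
  also have "\<dots> = (\<Sum>p<P. \<Sum>G\<in>A. \<Sum>q<Q. \<Sum>s<S p. card (B p q s G))" by (rule sum.swap)
  also have "\<dots> = (\<Sum>p<P. \<Sum>q<Q. \<Sum>G\<in>A. \<Sum>s<S p. card (B p q s G))"
    by (intro sum.cong refl) (rule sum.swap)
  also have "\<dots> = (\<Sum>p<P. \<Sum>q<Q. \<Sum>s<S p. \<Sum>G\<in>A. card (B p q s G))"
    by (intro sum.cong refl) (rule sum.swap)
  finally have "(\<Sum>G\<in>A. card (X G)) * c \<le> (\<Sum>p<P. \<Sum>q<Q. \<Sum>s<S p. \<Sum>G\<in>A. card (B p q s G)) * c"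
    by (rule mult_right_mono) simp
  also have "\<dots> = (\<Sum>p<P. \<Sum>q<Q. \<Sum>s<S p. (\<Sum>G\<in>A. card (B p q s G)) * c)"
    by (simp add: sum_distrib_right)
  also have "\<dots> \<le> (\<Sum>p<P. \<Sum>q<Q. \<Sum>s<S p. K * g s)"
    by (intro sum_mono B) auto
  also have "\<dots> = K * Q * (\<Sum>p<P. \<Sum>s<S p. g s)"
    by (simp add: sum_distrib_left mult_ac)
  finally show ?thesis .
qed

text \<open>Take the longest suffix \<open>cs\<close> without repetition; the vertex before it must
  lie on it. From there on the walk is a path with one additional edge.\<close>

lemma not_distinct_suffix:
  "\<not> distinct ws \<Longrightarrow> \<exists>as y cs. ws = as @ y # cs \<and> distinct cs \<and> y \<in> set cs"
proof (induction ws)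
  case (Cons w ws)
  show ?case
  proof (cases "distinct ws")
    case True
    then show ?thesis using Cons by (intro exI[of _ "[]"] exI[of _ w] exI[of _ ws]) auto
  next
    case False
    then obtain as y cs where "ws = as @ y # cs \<and> distinct cs \<and> y \<in> set cs" using Cons by blast
    then show ?thesis by (intro exI[of _ "w # as"] exI[of _ y] exI[of _ cs]) auto
  qed
qed simp

context biregular_setting
begin

lemma DD_pow_combine: "DD ^ (k + 1) * DD ^ (k - 1) = DD ^ (2 * k)"
  unfolding power_add[symmetric] using k by (intro arg_cong[of _ _ "(^) DD"]) simp

lemma k_le_DD_pow: "k \<le> DD ^ (k - 1)"
proof -
  have "k - 1 < 2 ^ (k - 1)" by (rule less_exp)
  also have "(2 :: nat) ^ (k - 1) \<le> DD ^ (k - 1)" using DD2 by (rule power_mono) simp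
  finally show ?thesis using k by linarith
qed

text \<open>A second short path that first follows the given one for \<open>p\<close> steps has only \<open>2 * k - p\<close> steps left
  for the excursion. This makes the sums over \<open>p\<close> geometric and avoids a factor \<open>k\<close>.\<close>

definition short_cycle_excursion :: "graph \<Rightarrow> walk \<Rightarrow> bool" where
  "short_cycle_excursion G xs \<longleftrightarrow> (\<exists>p q ys. excursion G xs p q ys \<and>
     ed (last xs) (hd xs) \<notin> pe (xs ! p # ys @ [xs ! q]) \<and> length ys + 2 + p \<le> 2 * k)"

text \<open>The competing path has at most \<open>2 * k\<close> vertices and starts at index
  \<open>a\<close> of \<open>ws\<close>, where \<open>a\<close> is 0 or 1, so
  \<open>length ys + 2 + (p - a) \<le> 2 * k\<close> with \<open>a \<le> p\<close>. The two
  inequalities follow from this for either \<open>a\<close>.\<close>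

definition short_path_excursion :: "graph \<Rightarrow> walk \<Rightarrow> bool" where
  "short_path_excursion G ws \<longleftrightarrow> (\<exists>p q ys. excursion G ws p q ys \<and>
     length ys + 1 + p \<le> 2 * k \<and> length ys + 2 \<le> 2 * k)"

lemma expected_short_cycle_excursion:
  "(\<Sum>G\<in>\<G>. card {xs \<in> cycle_lists k G. short_cycle_excursion G xs}) * (n * d1) \<le> 64 * k * card \<G> * DD ^ (2 * k)"
proof -
  have "(\<Sum>G\<in>\<G>. card {xs \<in> cycle_lists k G. short_cycle_excursion G xs}) * (n * d1)
     \<le> (2 * card \<G> * DD ^ (k + 1)) * (2 * k) * (\<Sum>p<2 * k. \<Sum>s<2 * k - 1 - p. DD ^ ((s + 1) div 2))"
  proof (rule sum_card_UN3_le[where B = cycle_excursions and f = "take (2 * k)"])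
    fix G assume "G \<in> \<G>"
    show "{xs \<in> cycle_lists k G. short_cycle_excursion G xs}
       \<subseteq> (\<Union>p<2 * k. \<Union>q<2 * k. \<Union>s<2 * k - 1 - p. take (2 * k) ` cycle_excursions p q s G)" (is "_ \<subseteq> ?U")
    proof
      fix xs assume "xs \<in> {xs \<in> cycle_lists k G. short_cycle_excursion G xs}"
      then obtain p q ys where xs: "xs \<in> cycle_lists k G" and e: "excursion G xs p q ys"
        "ed (last xs) (hd xs) \<notin> pe (xs ! p # ys @ [xs ! q])" "length ys + 2 + p \<le> 2 * k"
        by (auto simp: short_cycle_excursion_def)
      have len: "length xs = 2 * k" using xs by (simp add: cycle_lists_def cycle_list_def)
      have tk: "take (2 * k) (xs @ ys) = xs" "drop (2 * k) (xs @ ys) = ys" using len by auto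
      have "xs @ ys \<in> cycle_excursions p q (length ys) G"
        unfolding cycle_excursions_def mem_Collect_eq tk using xs e len by simp
      moreover have "xs = take (2 * k) (xs @ ys)" using len by simp
      ultimately have "xs \<in> take (2 * k) ` cycle_excursions p q (length ys) G" by (rule rev_image_eqI)
      moreover have "p < 2 * k" "q < 2 * k" using e(1) len by (auto simp: excursion_def)
      moreover have "length ys < 2 * k - 1 - p" using e(3) by linarith
      ultimately show "xs \<in> ?U" by blast
    qed
  next
    fix G p q s assume "G \<in> \<G>" "p < 2 * k" "q < 2 * k" "s < 2 * k - 1 - p"
    then show "finite (cycle_excursions p q s G)" by (intro expected_cycle_excursions(2)) auto
  next
    fix p q s assume "p < 2 * k" "q < 2 * k" "s < 2 * k - 1 - p"
    then have "2 * k + s + 1 \<le> 4 * k" by linarith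
    from expected_cycle_excursions(1)[OF this, of p q]
    show "total (cycle_excursions p q s) * (n * d1) \<le> 2 * card \<G> * DD ^ (k + 1) * DD ^ ((s + 1) div 2)"
      by (simp add: power_add mult_ac)
  qed simp
  also have "\<dots> \<le> (2 * card \<G> * DD ^ (k + 1)) * (2 * k) * (16 * DD ^ (k - 1))"
    using sum_pow_half_triangle[OF DD2, of k] k by (intro mult_left_mono) auto
  \<comment> \<open>64 = 2 * 2 * 16: the containment bound, the \<open>2 * k\<close> positions
    \<open>q\<close>, and the double sum.\<close>
  also have "\<dots> = 64 * k * card \<G> * (DD ^ (k + 1) * DD ^ (k - 1))" by simp
  finally show ?thesis unfolding DD_pow_combine .
qed

lemma expected_short_path_excursion:
  "(\<Sum>G\<in>\<G>. card {ws. is_path G ws \<and> length ws = 2 * k + 2 \<and> isl (hd ws) = b \<and> short_path_excursion G ws})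
     \<le> 192 * k * card \<G> * DD ^ (2 * k)"
proof -
  define L where "L = 2 * k + 2"
  \<comment> \<open>The subtraction \<open>p - 1\<close> is truncated, so \<open>p = 0\<close> and
    \<open>p = 1\<close> allow the same \<open>s\<close> and the longest row of the triangular sum
    occurs twice. This turns 16 into 32 below.\<close>
  define S where "S = (\<lambda>p. 2 * k - 1 - (p - 1))"
  have "(\<Sum>G\<in>\<G>. card {ws. is_path G ws \<and> length ws = L \<and> isl (hd ws) = b \<and> short_path_excursion G ws}) * 1
     \<le> (2 * card \<G> * DD ^ (k + 1)) * L * (\<Sum>p<2 * k. \<Sum>s<S p. DD ^ ((s + 1) div 2))"
  proof (rule sum_card_UN3_le[where B = "path_excursions b L" and f = "take L"])
    fix G assume "G \<in> \<G>"
    show "{ws. is_path G ws \<and> length ws = L \<and> isl (hd ws) = b \<and> short_path_excursion G ws}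
       \<subseteq> (\<Union>p<2 * k. \<Union>q<L. \<Union>s<S p. take L ` path_excursions b L p q s G)" (is "_ \<subseteq> ?U")
    proof
      fix ws assume "ws \<in> {ws. is_path G ws \<and> length ws = L \<and> isl (hd ws) = b \<and> short_path_excursion G ws}"
      then obtain p q ys where ws: "is_path G ws" "length ws = L" "isl (hd ws) = b" and e: "excursion G ws p q ys"
        "length ys + 1 + p \<le> 2 * k" "length ys + 2 \<le> 2 * k"
        by (auto simp: short_path_excursion_def)
      have "ws \<noteq> []" using ws by (auto simp: L_def)
      then have "ws @ ys \<in> path_excursions b L p q (length ys) G"
        using ws e by (simp add: path_excursions_def)
      moreover have "ws = take L (ws @ ys)" using ws by simp
      ultimately have "ws \<in> take L ` path_excursions b L p q (length ys) G" by (rule rev_image_eqI)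
      moreover have "q < L" using e(1) ws by (auto simp: excursion_def)
      moreover have "p < 2 * k" "length ys < S p" using e(2,3) by (auto simp: S_def)
      ultimately show "ws \<in> ?U" by blast
    qed
  next
    fix G p q s assume "G \<in> \<G>" "p < 2 * k" "q < L" "s < S p"
    then show "finite (path_excursions b L p q s G)"
      by (intro expected_path_excursions(2)) (auto simp: L_def S_def)
  next
    fix p q s assume "p < 2 * k" "q < L" "s < S p"
    then have s: "L + s \<le> 4 * k" "L \<ge> 2" by (auto simp: L_def S_def)
    have "(L + 1) div 2 = k + 1" by (simp add: L_def)
    with expected_path_excursions(1)[OF s(2,1), of b p q]
    show "total (path_excursions b L p q s) * 1 \<le> 2 * card \<G> * DD ^ (k + 1) * DD ^ ((s + 1) div 2)"
      by (simp add: power_add mult_ac)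
  qed simp
  also have "(\<Sum>p<2 * k. \<Sum>s<S p. DD ^ ((s + 1) div 2)) \<le> 32 * DD ^ (k - 1)"
  proof -
    define g where "g = (\<lambda>N. \<Sum>s<N. DD ^ ((s + 1) div 2))"
    have tri: "(\<Sum>p<2 * k. g (2 * k - 1 - p)) \<le> 16 * DD ^ (k - 1)"
      using sum_pow_half_triangle[OF DD2, of k] k by (simp add: g_def)
    have "{..<2 * k} = insert 0 (Suc ` {..<2 * k - 1})"
      using k by (auto simp: image_iff) (metis Suc_less_eq Suc_pred gr0I lessThan_iff not_less0 nat_0_less_mult_iff pos2)
    then have "(\<Sum>p<2 * k. g (S p)) = g (2 * k - 1) + (\<Sum>p<2 * k - 1. g (2 * k - 1 - p))"
      by (simp add: sum.reindex S_def)
    also have "\<dots> \<le> (\<Sum>p<2 * k. g (2 * k - 1 - p)) + (\<Sum>p<2 * k. g (2 * k - 1 - p))"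
    proof (rule add_mono)
      show "g (2 * k - 1) \<le> (\<Sum>p<2 * k. g (2 * k - 1 - p))"
        using member_le_sum[of 0 "{..<2 * k}" "\<lambda>p. g (2 * k - 1 - p)"] k by simp
      show "(\<Sum>p<2 * k - 1. g (2 * k - 1 - p)) \<le> (\<Sum>p<2 * k. g (2 * k - 1 - p))"
        by (rule sum_mono2) auto
    qed
    finally show ?thesis using tri by (simp add: g_def)
  qed
  finally have "(\<Sum>G\<in>\<G>. card {ws. is_path G ws \<and> length ws = L \<and> isl (hd ws) = b \<and> short_path_excursion G ws})
     \<le> (2 * card \<G> * DD ^ (k + 1)) * L * (32 * DD ^ (k - 1))" by simp
  also have "\<dots> = 64 * L * card \<G> * (DD ^ (k + 1) * DD ^ (k - 1))" by simp
  also have "\<dots> \<le> 64 * (3 * k) * card \<G> * (DD ^ (k + 1) * DD ^ (k - 1))"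
    using k by (intro mult_right_mono mult_left_mono) (auto simp: L_def)
  finally show ?thesis unfolding DD_pow_combine L_def by simp
qed

text \<open>The longest repetition-free suffix together with the edge entering it has as many edges
  as vertices, so its expected number is known; the steps before it are counted in each graph
  separately. The exponents add up to \<open>k + 1\<close> wherever the walk is cut.\<close>

lemma expected_nonsimple_walks:
  "(\<Sum>G\<in>\<G>. card {ws. nbwalk G ws \<and> length ws = 2 * k + 2 \<and> isl (last ws) \<and> \<not> distinct ws})
     \<le> 10 * k * card \<G> * DD ^ (2 * k)"
proof -
  define X where "X = (\<lambda>G. {ws. nbwalk G ws \<and> length ws = 2 * k + 2 \<and> isl (last ws) \<and> \<not> distinct ws})"
  \<comment> \<open>The additional edge is a chord from the first vertex of \<open>cs\<close> to
    \<open>cs ! i\<close>, an ear without inner vertices. \<open>odd j\<close> is the side of the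
    first vertex, because the walk ends on the left.\<close>
  define B where "B = (\<lambda>j i G. path_excursions (odd j) j 0 i 0 G)"
  define Y where "Y = (\<lambda>G j i cs. {ws. nbwalk G ws \<and> length ws = (2 * k + 1 - j) + length (cs ! i # cs) \<and>
     drop (2 * k + 1 - j) ws = cs ! i # cs})"
  have sub: "X G \<subseteq> (\<Union>j\<in>{2..2 * k + 1}. \<Union>i<2 * k + 1. \<Union>cs\<in>{cs \<in> B j i G. nbwalk G (cs ! i # cs)}. Y G j i cs)" (is "_ \<subseteq> ?U") for G
  proof
    fix ws assume "ws \<in> X G"
    then have ws: "nbwalk G ws" "length ws = 2 * k + 2" "isl (last ws)" "\<not> distinct ws" by (auto simp: X_def)
    obtain as y cs where s: "ws = as @ y # cs" "distinct cs" "y \<in> set cs"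
      using not_distinct_suffix[OF ws(4)] by blast
    have nbw: "nbwalk G (y # cs)" using nbwalk_appendD ws(1) s(1) by blast
    obtain i where i: "i < length cs" "y = cs ! i" using s(3) by (auto simp: in_set_conv_nth)
    have ne: "cs \<noteq> []" using s by auto
    have alty: "isl y \<noteq> isl (hd cs)" "alt cs" "ed y (hd cs) \<in> G" "pe cs \<subseteq> G"
      using nbw ne by (auto simp: nbwalk_def alt_Cons pe_Cons)
    have i0: "i \<noteq> 0" using alty(1) i ne by (metis hd_conv_nth)
    then have l2: "length cs \<ge> 2" using i by linarith
    \<comment> \<open>Nonbacktracking enters here: for \<open>i = 1\<close> the chord would be the
      first edge of \<open>cs\<close>.\<close>
    have i1: "i \<noteq> 1" using nbw l2 i by (auto simp: nbwalk_def nb_Cons)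
    have h0: "cs ! 0 = hd cs" using ne by (simp add: hd_conv_nth)
    have "ed (hd cs) y \<notin> pe cs"
    proof
      assume "ed (hd cs) y \<in> pe cs"
      then have "y = cs ! 1"
        using pe_neighbour[OF s(2) alty(2), of 0 y] alty(1) ne h0 by auto
      then show False using i i1 l2 s(2) by (simp add: nth_eq_iff_index_eq)
    qed
    then have "excursion G cs 0 i []"
      using i i0 ne h0 alty ed_commute[OF alty(1)] by (auto simp: excursion_def)
    moreover have "is_path G cs" using s alty by (simp add: is_path_def)
    moreover have "isl (hd cs) = odd (length cs)"
      using alt_nth[OF alty(2), of "length cs - 1"] ws(3) s(1) ne by (auto simp: last_conv_nth)
    ultimately have "cs \<in> B (length cs) i G" by (simp add: B_def path_excursions_def)
    then have "cs \<in> {cs \<in> B (length cs) i G. nbwalk G (cs ! i # cs)}" using nbw i by simp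
    moreover have la: "length as = 2 * k + 1 - length cs" "length cs \<le> 2 * k + 1" using ws(2) s(1) by auto
    then have "ws \<in> Y G (length cs) i cs" using ws s i by (auto simp: Y_def)
    moreover have "length cs \<in> {2..2 * k + 1}" "i < 2 * k + 1" using l2 la i by auto
    ultimately show "ws \<in> ?U" by blast
  qed
  have fB: "finite (B j i G)" if "G \<in> \<G>" "j \<in> {2..2 * k + 1}" for G i j
    unfolding B_def using that k by (intro expected_path_excursions(2)) auto
  have Y: "finite (Y G j i cs)" "card (Y G j i cs) \<le> DD ^ ((2 * k + 2 - j) div 2)"
    if "G \<in> \<G>" "j \<in> {2..2 * k + 1}" "cs \<in> B j i G" "nbwalk G (cs ! i # cs)" for G i j cs
  proof -
    have "length cs = j" using that(3) by (simp add: B_def path_excursions_def)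
    then have "length (cs ! i # cs) \<ge> 2" using that(2) by auto
    note ne = card_nbwalk_extensions[OF that(1,4) this, of "2 * k + 1 - j"]
    show "finite (Y G j i cs)" using ne by (simp add: Y_def)
    have "card (Y G j i cs) = wprod (isl (cs ! i)) (2 * k + 1 - j)" using ne by (simp add: Y_def)
    also have "\<dots> \<le> DD ^ ((2 * k + 1 - j + 1) div 2)" by (rule wprod_le)
    also have "2 * k + 1 - j + 1 = 2 * k + 2 - j" using that(2) by auto
    finally show "card (Y G j i cs) \<le> DD ^ ((2 * k + 2 - j) div 2)" .
  qed
  have cX: "card (X G) \<le> (\<Sum>j\<in>{2..2 * k + 1}. \<Sum>i<2 * k + 1. card (B j i G) * DD ^ ((2 * k + 2 - j) div 2))"
    if G: "G \<in> \<G>" for G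
  proof -
    let ?C = "\<lambda>j i. {cs \<in> B j i G. nbwalk G (cs ! i # cs)}"
    have "card (X G) \<le> card (\<Union>j\<in>{2..2 * k + 1}. \<Union>i<2 * k + 1. \<Union>cs\<in>?C j i. Y G j i cs)"
      using fB[OF G] Y[OF G] by (intro card_mono sub) auto
    also have "\<dots> \<le> (\<Sum>j\<in>{2..2 * k + 1}. card (\<Union>i<2 * k + 1. \<Union>cs\<in>?C j i. Y G j i cs))"
      by (rule card_UN_le) simp
    also have "\<dots> \<le> (\<Sum>j\<in>{2..2 * k + 1}. \<Sum>i<2 * k + 1. card (\<Union>cs\<in>?C j i. Y G j i cs))"
      by (intro sum_mono card_UN_le) simp
    also have "\<dots> \<le> (\<Sum>j\<in>{2..2 * k + 1}. \<Sum>i<2 * k + 1. card (B j i G) * DD ^ ((2 * k + 2 - j) div 2))"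
    proof (intro sum_mono)
      fix j i assume j: "j \<in> {2..2 * k + 1}"
      have "card (\<Union>cs\<in>?C j i. Y G j i cs) \<le> (\<Sum>cs\<in>?C j i. card (Y G j i cs))"
        using fB[OF G j] by (intro card_UN_le) simp
      also have "\<dots> \<le> (\<Sum>cs\<in>?C j i. DD ^ ((2 * k + 2 - j) div 2))"
        using Y[OF G j] by (intro sum_mono) auto
      also have "\<dots> \<le> (\<Sum>cs\<in>B j i G. DD ^ ((2 * k + 2 - j) div 2))"
        using fB[OF G j] by (intro sum_mono2) auto
      finally show "card (\<Union>cs\<in>?C j i. Y G j i cs) \<le> card (B j i G) * DD ^ ((2 * k + 2 - j) div 2)" by simp
    qed
    finally show ?thesis .
  qed
  have "total X \<le> (\<Sum>G\<in>\<G>. \<Sum>j\<in>{2..2 * k + 1}. \<Sum>i<2 * k + 1. card (B j i G) * DD ^ ((2 * k + 2 - j) div 2))"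
    by (intro sum_mono cX)
  also have "\<dots> = (\<Sum>j\<in>{2..2 * k + 1}. \<Sum>G\<in>\<G>. \<Sum>i<2 * k + 1. card (B j i G) * DD ^ ((2 * k + 2 - j) div 2))"
    by (rule sum.swap)
  also have "\<dots> = (\<Sum>j\<in>{2..2 * k + 1}. \<Sum>i<2 * k + 1. \<Sum>G\<in>\<G>. card (B j i G) * DD ^ ((2 * k + 2 - j) div 2))"
    by (intro sum.cong refl) (rule sum.swap)
  also have "\<dots> \<le> (\<Sum>j\<in>{2..2 * k + 1}. \<Sum>i<2 * k + 1. 2 * card \<G> * DD ^ (k + 1))"
  proof (intro sum_mono)
    fix j i assume j: "j \<in> {2..2 * k + 1}"
    have "(\<Sum>G\<in>\<G>. card (B j i G) * DD ^ ((2 * k + 2 - j) div 2)) = total (B j i) * DD ^ ((2 * k + 2 - j) div 2)"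
      by (simp add: sum_distrib_right)
    also have "\<dots> \<le> (2 * card \<G> * DD ^ ((j + 1) div 2 + (0 + 1) div 2)) * DD ^ ((2 * k + 2 - j) div 2)"
      unfolding B_def using j k by (intro mult_right_mono expected_path_excursions(1)) auto
    also have "\<dots> = 2 * card \<G> * DD ^ ((j + 1) div 2 + (2 * k + 2 - j) div 2)" by (simp add: power_add)
    also have "(j + 1) div 2 + (2 * k + 2 - j) div 2 = k + 1"
    proof (cases "even j")
      case True
      then obtain i where ji: "j = 2 * i" by blast
      then have "2 * k + 2 - j = 2 * (k + 1 - i)" "i \<le> k" using j by auto
      then show ?thesis using ji by simp
    next
      case False
      then obtain i where ji: "j = 2 * i + 1" by (blast elim: oddE)
      then have "2 * k + 2 - j = 2 * (k - i) + 1" "i \<le> k" using j by auto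
      then show ?thesis using ji by simp
    qed
    finally show "(\<Sum>G\<in>\<G>. card (B j i G) * DD ^ ((2 * k + 2 - j) div 2)) \<le> 2 * card \<G> * DD ^ (k + 1)" .
  qed
  also have "\<dots> = 2 * (2 * k * (2 * k + 1)) * card \<G> * DD ^ (k + 1)"
    by (simp add: algebra_simps)
  also have "\<dots> \<le> 2 * (5 * k * k) * card \<G> * DD ^ (k + 1)"
  proof -
    have "2 * k * (2 * k + 1) = 4 * (k * k) + 2 * k" by (simp add: algebra_simps)
    moreover have "2 * k \<le> k * k" using k by (intro mult_right_mono) auto
    ultimately have "2 * k * (2 * k + 1) \<le> 5 * k * k" by simp
    then show ?thesis by (intro mult_right_mono mult_left_mono) auto
  qed
  \<comment> \<open>The choices of \<open>j\<close> and \<open>i\<close> cost a factor of order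
    \<open>k * k\<close>; one \<open>k\<close> is absorbed by the spare power
    \<open>DD ^ (k - 1)\<close>.\<close>
  also have "\<dots> \<le> 2 * (5 * k * DD ^ (k - 1)) * card \<G> * DD ^ (k + 1)"
    using k_le_DD_pow by (intro mult_right_mono mult_left_mono) auto
  also have "\<dots> = 10 * k * card \<G> * (DD ^ (k + 1) * DD ^ (k - 1))" by simp
  finally show ?thesis unfolding DD_pow_combine X_def .
qed

end

section \<open>Switchings that change a single short cycle\<close>

lemma cycle_list_ends:
  assumes "cycle_list j Q" "j \<ge> 1"
  shows "Q \<noteq> []" "hd Q = Inl (projl (hd Q))" "last Q = Inr (projr (last Q))"
proof -
  show "Q \<noteq> []" using assms by (auto simp: cycle_list_def)
  have "isl (hd Q)" "\<not> isl (last Q)" using assms alt_even_ends[of Q j] by (auto simp: cycle_list_def)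
  then show "hd Q = Inl (projl (hd Q))" "last Q = Inr (projr (last Q))" by auto
qed

lemma cycles_iff:
  "j \<ge> 1 \<Longrightarrow> C \<in> cycles j E \<longleftrightarrow> (\<exists>ys. cycle_list j ys \<and> C = cyc ys) \<and> C \<subseteq> E"
  by (auto simp: cycles_conv_cyc cycle_lists_def)

lemma cycle_through_edge:
  assumes "C \<in> cycles j E" "(x, y) \<in> C" "j \<ge> 2"
  obtains Q where "cycle_list j Q" "cyc Q = C" "hd Q = Inl x" "last Q = Inr y"
    "(x, y) \<notin> pe Q" "is_path (C - {(x, y)}) Q" "C \<subseteq> E"
proof -
  obtain ys where ys: "cycle_list j ys" "C = cyc ys" "C \<subseteq> E" using assms cycles_iff[of j C E] by auto
  obtain Q where Q: "cycle_list j Q" "cyc Q = C" "ed (last Q) (hd Q) = (x, y)"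
    using cycle_list_relabel[OF ys(1) assms(3), of "(x, y)"] ys assms by auto
  have e: "hd Q = Inl x" "last Q = Inr y"
    using cycle_list_ends[OF Q(1)] Q(3) assms(3) by (metis ed_Inl(2) prod.inject One_nat_def Suc_1 Suc_leD)+
  have np: "(x, y) \<notin> pe Q" using closing_edge_notin_pe[OF Q(1) assms(3)] Q(3) by simp
  have "is_path (C - {(x, y)}) Q" using Q np by (auto simp: is_path_def cycle_list_def cyc_def)
  then show ?thesis using that Q e np ys by blast
qed

lemma card_cycle: "C \<in> cycles j E \<Longrightarrow> j \<ge> 2 \<Longrightarrow> card C = 2 * j"
  using cycles_iff[of j C E] card_cyc by auto

text \<open>\<open>alpha\<close> says that no other short cycle uses a deleted edge,
  \<open>beta\<close> that no short cycle uses a new one. The short cycles of the two graphs then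
  differ by \<open>C\<close> alone, which has \<open>2 * k\<close> edges and so is not among the
  shorter ones.\<close>

lemma cycle_count_swap:
  assumes k: "k \<ge> 2" and fin: "finite G" and C: "C \<in> cycles k G" "(a, b) \<in> C"
    and G: "(a, b) \<in> G" "(c, d) \<in> G" "(a, d) \<notin> G" "(c, b) \<notin> G"
    and alpha: "\<And>j C'. j \<in> {2..k} \<Longrightarrow> C' \<in> cycles j G \<Longrightarrow> (a, b) \<in> C' \<or> (c, d) \<in> C' \<Longrightarrow> C' = C"
    and beta: "\<And>j C'. j \<in> {2..k} \<Longrightarrow> C' \<in> cycles j (swap G a b c d) \<Longrightarrow> (a, d) \<notin> C' \<and> (c, b) \<notin> C'"
  shows "j \<in> {2..<k} \<Longrightarrow> cycle_count j (swap G a b c d) = cycle_count j G"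
    and "cycle_count k G = Suc (cycle_count k (swap G a b c d))"
proof -
  define G' where "G' = swap G a b c d"
  have ab: "(a, b) \<notin> G'" "(c, d) \<notin> G'" using G by (auto simp: G'_def swap_def)
  have eq: "cycles j G' = cycles j G - {C}" if j: "j \<in> {2..k}" for j
  proof (intro equalityI subsetI)
    fix C' assume C': "C' \<in> cycles j G'"
    have sub: "C' \<subseteq> G'" using C' j cycles_iff[of j] by auto
    then have "C' \<subseteq> G" using beta[OF j, of C'] C' by (auto simp: G'_def swap_def)
    then have "C' \<in> cycles j G" using C' j cycles_iff[of j] by auto
    moreover have "C' \<noteq> C" using sub ab C by auto
    ultimately show "C' \<in> cycles j G - {C}" by simp
  next
    fix C' assume C': "C' \<in> cycles j G - {C}"
    then have "(a, b) \<notin> C'" "(c, d) \<notin> C'" using alpha[OF j, of C'] by auto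
    moreover have "C' \<subseteq> G" using C' j cycles_iff[of j] by auto
    ultimately have "C' \<subseteq> G'" by (auto simp: G'_def swap_def)
    then show "C' \<in> cycles j G'" using C' j cycles_iff[of j] by auto
  qed
  show "cycle_count j (swap G a b c d) = cycle_count j G" if j: "j \<in> {2..<k}"
  proof -
    have "C \<notin> cycles j G" using card_cycle[of C j G] card_cycle[OF C(1) k] j by auto
    then show ?thesis using eq[of j] j by (simp add: cycle_count_def G'_def)
  qed
  have "card (cycles k G) > 0" using C fin by (auto simp: card_gt_0_iff)
  then show "cycle_count k G = Suc (cycle_count k (swap G a b c d))"
    using eq[of k] k C fin by (simp add: cycle_count_def G'_def)
qed

text \<open>For short cycles through both new edges of a switching: cut at the second new edge; the
  part before it lies in the old graph and ends at a vertex of that edge.\<close>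

lemma path_split_at_edge:
  assumes Q: "is_path E Q" and e: "(c, d) \<in> pe Q"
  obtains Q1 where "Q1 \<noteq> []" "hd Q1 = hd Q" "length Q1 < length Q" "is_path (E - {(c, d)}) Q1"
    "last Q1 = Inl c \<or> last Q1 = Inr d"
proof -
  have "alt Q" using Q by (simp add: is_path_def)
  then obtain Q1 Q2 where s: "Q = Q1 @ Q2" "Q1 \<noteq> []" "Q2 \<noteq> []"
    and c2: "(last Q1 = Inl c \<and> hd Q2 = Inr d) \<or> (last Q1 = Inr d \<and> hd Q2 = Inl c)"
    using pe_split[of Q "Inl c" "Inr d"] e by auto
  have p1: "is_path E Q1" using Q s is_path_appendD by metis
  have "(c, d) \<notin> pe Q1"
  proof
    assume "(c, d) \<in> pe Q1"
    then have "Inl c \<in> set Q1" "Inr d \<in> set Q1"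
      using pe_vertices[of Q1 "Inl c" "Inr d"] p1 by (auto simp: is_path_def)
    moreover have "Inl c \<in> set Q2 \<or> Inr d \<in> set Q2" using c2 s(3) by (metis hd_in_set)
    ultimately show False using Q s by (auto simp: is_path_def)
  qed
  then have "is_path (E - {(c, d)}) Q1" using p1 by (auto simp: is_path_def)
  then show ?thesis using that[of Q1] s c2 by auto
qed

lemma prefix_last:
  assumes "prefix Q xs" "distinct xs" "Q \<noteq> []" "last Q = last xs"
  shows "Q = xs"
proof -
  obtain zs where zs: "xs = Q @ zs" using assms(1) by (auto simp: prefix_def)
  show ?thesis
  proof (cases "zs = []")
    case False
    then have "last xs \<in> set zs" "last Q \<in> set Q" using zs assms(3) by auto
    then show ?thesis using assms zs by (metis disjoint_iff distinct_append)
  qed (use zs in simp)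
qed

section \<open>Reducing the obstructions to excursions\<close>

context biregular_setting
begin

text \<open>\<open>a = 0\<close> if \<open>Q\<close> starts at an end of the path,
  \<open>a = 1\<close> if it starts one step inside, at an end of the former cycle. In the second
  case the first edge of \<open>ws\<close> has to be barred, or \<open>Q\<close> could escape along
  it without an excursion.\<close>

lemma short_path_excursionI:
  assumes "distinct ws" "alt ws" "length ws = 2 * k + 2" "is_path E Q" "E \<subseteq> G" "Q \<noteq> []" "a \<le> 1" "hd Q = ws ! a"
    "last Q \<in> set ws" "\<not> prefix Q (drop a ws)" "a = 0 \<or> ed (ws ! 0) (ws ! 1) \<notin> E" "length Q \<le> 2 * k"
  shows "short_path_excursion G ws"
proof -
  have pe: "pe Q \<subseteq> E" using assms(4) by (simp add: is_path_def)
  have "\<exists>p q ys. excursion (pe Q) ws p q ys \<and> a \<le> p \<and> length ys + 2 + (p - a) \<le> length Q"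
  proof (rule excursion_of_departing_path)
    show "a = 0 \<or> ed (ws ! (a - 1)) (ws ! a) \<notin> pe Q" using assms(7,11) pe by (cases a) auto
  qed (use assms in auto)
  then obtain p q ys where e: "excursion (pe Q) ws p q ys" "a \<le> p" "length ys + 2 + (p - a) \<le> length Q" by blast
  have "excursion G ws p q ys" using e(1) pe assms(5) by (blast intro: excursion_mono)
  then show ?thesis unfolding short_path_excursion_def using e assms(7,12)
    by (intro exI[of _ p] exI[of _ q] exI[of _ ys]) auto
qed

lemma short_cycle_excursionI:
  assumes xs: "cycle_list k xs" and Q: "is_path E Q" "E \<subseteq> G" "Q \<noteq> []" "hd Q = hd xs" "last Q = last xs" "Q \<noteq> xs"
    "ed (last xs) (hd xs) \<notin> E" "length Q \<le> 2 * k"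
  shows "short_cycle_excursion G xs"
proof -
  have x: "distinct xs" "alt xs" "xs \<noteq> []" "length xs = 2 * k" using xs k by (auto simp: cycle_list_def)
  have pe: "pe Q \<subseteq> E" using Q by (simp add: is_path_def)
  have "\<not> prefix Q xs" using prefix_last[of Q xs] x Q by auto
  then have "\<exists>p q ys. excursion (pe Q) xs p q ys \<and> 0 \<le> p \<and> length ys + 2 + (p - 0) \<le> length Q"
    using x Q k by (intro excursion_of_departing_path[OF x(1,2) Q(1)]) (auto simp: hd_conv_nth)
  then obtain p q ys where e: "excursion (pe Q) xs p q ys" "length ys + 2 + p \<le> length Q" by auto
  have "excursion G xs p q ys" using e(1) pe Q by (blast intro: excursion_mono)
  moreover have "ed (last xs) (hd xs) \<notin> pe (xs ! p # ys @ [xs ! q])" using e(1) pe Q by (auto simp: excursion_def)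
  ultimately show ?thesis unfolding short_cycle_excursion_def using e Q
    by (intro exI[of _ p] exI[of _ q] exI[of _ ys]) auto
qed

definition near :: "graph \<Rightarrow> walk \<Rightarrow> nat \<Rightarrow> nat \<Rightarrow> bool" where
  "near G xs c d \<longleftrightarrow> (\<exists>Q. is_path G Q \<and> Q \<noteq> [] \<and> length Q \<le> 2 * k \<and> last Q \<in> set xs \<and>
     (hd Q = Inl c \<or> hd Q = Inr d))"

definition on_disjoint_cycle :: "graph \<Rightarrow> walk \<Rightarrow> nat \<Rightarrow> nat \<Rightarrow> bool" where
  "on_disjoint_cycle G xs c d \<longleftrightarrow> (\<exists>j\<in>{2..k}. \<exists>Q\<in>cycle_lists j G. set Q \<inter> set xs = {} \<and>
     hd Q = Inl c \<and> last Q = Inr d)"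

text \<open>A second short cycle through \<open>(a, b)\<close> yields an excursion; one through
  \<open>(c, d)\<close> either meets \<open>xs\<close>, so that the edge is near, or is disjoint
  from it. A short cycle created by the switching contains a path of the old graph that joins
  \<open>c\<close> or \<open>d\<close> to \<open>a\<close> or \<open>b\<close>, so the edge is near,
  or one from \<open>a\<close> to \<open>b\<close> other than \<open>xs\<close>, again an
  excursion.\<close>

lemma forward_good:
  assumes xs: "xs \<in> cycle_lists k G" and ends: "hd xs = Inl a" "last xs = Inr b"
    and cd: "(c, d) \<in> G"
    and good: "\<not> short_cycle_excursion G xs" "\<not> near G xs c d" "\<not> on_disjoint_cycle G xs c d"
  shows "distinct (Inr d # xs @ [Inl c])" "(a, d) \<notin> G" "(c, b) \<notin> G"
    "\<And>j C'. j \<in> {2..k} \<Longrightarrow> C' \<in> cycles j G \<Longrightarrow> (a, b) \<in> C' \<or> (c, d) \<in> C' \<Longrightarrow> C' = cyc xs"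
    "\<And>j C'. j \<in> {2..k} \<Longrightarrow> C' \<in> cycles j (swap G a b c d) \<Longrightarrow> (a, d) \<notin> C' \<and> (c, b) \<notin> C'"
proof -
  have x: "cycle_list k xs" "cyc xs \<subseteq> G" "distinct xs" "alt xs" "length xs = 2 * k" "xs \<noteq> []"
    using xs k by (auto simp: cycle_lists_def cycle_list_def)
  have inx: "Inl a \<in> set xs" "Inr b \<in> set xs" using ends x(6) hd_in_set[of xs] last_in_set[of xs] by auto
  have k2: "2 * k \<ge> 4" using k by simp
  have nearI: "False" if "is_path G Q" "Q \<noteq> []" "length Q \<le> 2 * k" "last Q \<in> set xs" "hd Q = Inl c \<or> hd Q = Inr d" for Q
    using good(2) that unfolding near_def by blast
  have c: "Inl c \<notin> set xs" using nearI[of "[Inl c]"] k2 by (auto simp: is_path_def)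
  have d: "Inr d \<notin> set xs" using nearI[of "[Inr d]"] k2 by (auto simp: is_path_def)
  show dist: "distinct (Inr d # xs @ [Inl c])" using c d x by auto
  show ad: "(a, d) \<notin> G" using nearI[of "[Inr d, Inl a]"] inx k2 by (auto simp: is_path_def)
  show cb: "(c, b) \<notin> G" using nearI[of "[Inl c, Inr b]"] inx k2 by (auto simp: is_path_def)
  have ab: "ed (last xs) (hd xs) = (a, b)" using ends by simp
  have abG: "(a, b) \<in> G" using x(2) ab by (auto simp: cyc_def)
  show "C' = cyc xs" if j: "j \<in> {2..k}" and C': "C' \<in> cycles j G" and e: "(a, b) \<in> C' \<or> (c, d) \<in> C'" for j C'
  proof (rule ccontr)
    assume ne: "C' \<noteq> cyc xs"
    from e show False
    proof
      assume "(a, b) \<in> C'"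
      then obtain Q where Q: "cycle_list j Q" "cyc Q = C'" "hd Q = Inl a" "last Q = Inr b"
         "is_path (C' - {(a, b)}) Q" "C' \<subseteq> G"
        using cycle_through_edge[OF C'] j by (metis atLeastAtMost_iff)
      have "short_cycle_excursion G xs"
        using Q ends ne j ab by (intro short_cycle_excursionI[OF x(1) Q(5)]) (auto simp: cycle_list_def)
      then show False using good by blast
    next
      assume "(c, d) \<in> C'"
      then obtain Q where Q: "cycle_list j Q" "cyc Q = C'" "hd Q = Inl c" "last Q = Inr d"
         "is_path (C' - {(c, d)}) Q" "C' \<subseteq> G"
        using cycle_through_edge[OF C'] j by (metis atLeastAtMost_iff)
      have "set Q \<inter> set xs \<noteq> {}"
      proof
        assume "set Q \<inter> set xs = {}"
        then have "on_disjoint_cycle G xs c d"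
          unfolding on_disjoint_cycle_def using j Q by (intro bexI[of _ j] bexI[of _ Q]) (auto simp: cycle_lists_def)
        then show False using good by blast
      qed
      then obtain z where z: "z \<in> set Q" "z \<in> set xs" by auto
      then obtain Q1 Q2 where s: "Q = Q1 @ z # Q2" by (meson split_list)
      have "is_path G Q" using Q by (auto simp: is_path_def)
      then have "is_path G (Q1 @ [z])" using is_path_appendD(1)[of G "Q1 @ [z]" Q2] s by simp
      moreover have "hd (Q1 @ [z]) = Inl c" using Q(3) s by (cases Q1) auto
      moreover have "length (Q1 @ [z]) \<le> 2 * k" using Q(1) s j by (auto simp: cycle_list_def)
      ultimately show False using nearI[of "Q1 @ [z]"] z by auto
    qed
  qed
  define G0 where "G0 = G - {(a, b), (c, d)}"
  have sw: "swap G a b c d = G0 \<union> {(a, d), (c, b)}" by (simp add: swap_def G0_def)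
  have G0: "G0 \<subseteq> G" "(a, b) \<notin> G0" by (auto simp: G0_def)
  show "(a, d) \<notin> C' \<and> (c, b) \<notin> C'" if j: "j \<in> {2..k}" and C': "C' \<in> cycles j (swap G a b c d)" for j C'
  proof (rule ccontr)
    assume "\<not> ((a, d) \<notin> C' \<and> (c, b) \<notin> C')"
    then consider "(a, d) \<in> C'" | "(a, d) \<notin> C'" "(c, b) \<in> C'" by blast
    then show False
    proof cases
      case 1
      then obtain Q where Q: "cycle_list j Q" "cyc Q = C'" "hd Q = Inl a" "last Q = Inr d"
         "is_path (C' - {(a, d)}) Q" "C' \<subseteq> swap G a b c d"
        using cycle_through_edge[OF C'] j by (metis atLeastAtMost_iff)
      have lQ: "length Q \<le> 2 * k" "Q \<noteq> []" "alt Q" using Q j by (auto simp: cycle_list_def)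
      have sub: "C' - {(a, d)} \<subseteq> insert (c, b) G0" using Q(6) sw by auto
      show False
      proof (cases "(c, b) \<in> pe Q")
        case False
        then have "is_path G (rev Q)" using Q(5) sub G0 unfolding is_path_rev by (auto simp: is_path_def)
        then show False using nearI[of "rev Q"] Q lQ inx by (auto simp: hd_rev last_rev)
      next
        \<comment> \<open>\<open>Q\<close> also uses the other new edge \<open>(c, b)\<close>. Its
          part before that edge lies in the old graph and leads from \<open>a\<close> to
          \<open>c\<close> or to \<open>b\<close>.\<close>
        case True
        then obtain Q1 where s: "Q1 \<noteq> []" "hd Q1 = hd Q" "length Q1 < length Q"
          "is_path (C' - {(a, d)} - {(c, b)}) Q1" and c2: "last Q1 = Inl c \<or> last Q1 = Inr b"
          using path_split_at_edge[OF Q(5)] by metis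
        have hQ1: "hd Q1 = Inl a" using Q(3) s by simp
        have p0: "is_path G0 Q1" using s(4) sub by (auto simp: is_path_def)
        from c2 show False
        proof
          assume "last Q1 = Inl c"
          moreover have "is_path G (rev Q1)" using p0 G0 unfolding is_path_rev by (auto simp: is_path_def)
          ultimately show False using nearI[of "rev Q1"] s lQ hQ1 inx by (auto simp: hd_rev last_rev)
        next
          assume l: "last Q1 = Inr b"
          have "length Q1 < 2 * k" using lQ s by simp
          then have "short_cycle_excursion G xs"
            using l hQ1 ends s x ab G0 by (intro short_cycle_excursionI[OF x(1) p0]) auto
          then show False using good by blast
        qed
      qed
    next
      case 2
      then obtain Q where Q: "cycle_list j Q" "cyc Q = C'" "hd Q = Inl c" "last Q = Inr b"
         "is_path (C' - {(c, b)}) Q" "C' \<subseteq> swap G a b c d"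
        using cycle_through_edge[OF C'] j by (metis atLeastAtMost_iff)
      have "C' - {(c, b)} \<subseteq> G" using Q(6) sw 2 G0 by auto
      then have "is_path G Q" using Q(5) by (auto simp: is_path_def)
      moreover have "Q \<noteq> []" "length Q \<le> 2 * k" using Q(1) j by (auto simp: cycle_list_def)
      ultimately show False using nearI[of Q] Q(3,4) inx by auto
    qed
  qed
qed

text \<open>Every failure is a short path that departs from the former cycle prolonged at both ends.
  All but one kind are read from the end \<open>Inr d\<close>; a short cycle through
  \<open>(c, b)\<close> departs next to the other end and is treated by reversing the path.\<close>

lemma backward_good:
  assumes ws: "is_path G (Inr d # xs @ [Inl c])" "length xs = 2 * k" and ends: "hd xs = Inl a" "last xs = Inr b"
    and good: "\<not> short_path_excursion G (Inr d # xs @ [Inl c])"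
      "\<not> short_path_excursion G (rev (Inr d # xs @ [Inl c]))"
  shows "(a, b) \<notin> G" "(c, d) \<notin> G" "cycle_list k xs" "cyc xs \<subseteq> swap G a d c b"
    "\<And>j C'. j \<in> {2..k} \<Longrightarrow> C' \<in> cycles j (swap G a d c b) \<Longrightarrow> (a, b) \<in> C' \<or> (c, d) \<in> C' \<Longrightarrow> C' = cyc xs"
    "\<And>j C'. j \<in> {2..k} \<Longrightarrow> C' \<in> cycles j G \<Longrightarrow> (a, d) \<notin> C' \<and> (c, b) \<notin> C'"
proof -
  define W where "W = Inr d # xs @ [Inl c]"
  have xne: "xs \<noteq> []" using ws k by auto
  have W: "distinct W" "alt W" "pe W \<subseteq> G" "length W = 2 * k + 2" using ws by (auto simp: W_def is_path_def)
  have Wr: "distinct (rev W)" "alt (rev W)" "length (rev W) = 2 * k + 2" using W by (auto simp: alt_rev)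
  have axs: "alt xs" "distinct xs" using W xne by (auto simp: W_def alt_Cons alt_append)
  have W0: "W ! 0 = Inr d" "W ! 1 = Inl a" "W ! (2 * k) = Inr b" "W ! (2 * k + 1) = Inl c"
    using ends xne ws(2) by (auto simp: W_def nth_append hd_conv_nth last_conv_nth nth_Cons split: nat.splits)
  have lastW: "last W = Inl c" by (simp add: W_def)
  have setW: "Inr d \<in> set W" "Inl a \<in> set W" "Inr b \<in> set W" "Inl c \<in> set W"
    using ends xne hd_in_set[of xs] last_in_set[of xs] by (auto simp: W_def)
  have rW: "rev W ! 0 = Inl c" "rev W ! 1 = Inr b" using W0 W(4) by (auto simp: rev_nth)
  have noW: "\<not> short_path_excursion G W" "\<not> short_path_excursion G (rev W)" using good by (auto simp: W_def)
  show cl: "cycle_list k xs" using axs ws(2) ends by (simp add: cycle_list_def)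
  have peW: "pe W = insert (a, d) (insert (c, b) (pe xs))"
    using xne ends by (auto simp: W_def pe_Cons pe_append)
  have fin_idx: "i = i'" if "W ! i = W ! i'" "i < 2 * k + 2" "i' < 2 * k + 2" for i i'
    using that W by (simp add: nth_eq_iff_index_eq)
  show ab: "(a, b) \<notin> G"
  proof
    assume "(a, b) \<in> G"
    have "short_path_excursion G W"
    proof (rule short_path_excursionI[where Q="[Inl a, Inr b]" and E="{(a, b)}" and a=1])
      have "a \<noteq> a \<or> d \<noteq> b" using fin_idx[of 0 "2 * k"] W0 k by auto
      then show "1 = 0 \<or> ed (W ! 0) (W ! 1) \<notin> {(a, b)}" using W0 by simp
      have "W ! 2 \<noteq> Inr b" using fin_idx[of 2 "2 * k"] W0 k by auto
      moreover have "drop 1 W = W ! 1 # W ! 2 # drop 3 W"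
        using W(4) k by (simp add: Cons_nth_drop_Suc numeral_2_eq_2 numeral_3_eq_3)
      ultimately show "\<not> prefix [Inl a, Inr b] (drop 1 W)" by auto
    qed (use W W0 setW \<open>(a, b) \<in> G\<close> k in \<open>auto simp: is_path_def\<close>)
    then show False using noW by simp
  qed
  show cd: "(c, d) \<notin> G"
  proof
    assume "(c, d) \<in> G"
    have "short_path_excursion G W"
    proof (rule short_path_excursionI[where Q="[Inr d, Inl c]" and E="{(c, d)}" and a=0])
      have "W ! 1 \<noteq> Inl c" using fin_idx[of 1 "2 * k + 1"] W0 k by auto
      then show "\<not> prefix [Inr d, Inl c] (drop 0 W)" by (auto simp: prefix_def)
    qed (use W W0 setW \<open>(c, d) \<in> G\<close> k in \<open>auto simp: is_path_def\<close>)
    then show False using noW by simp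
  qed
  define G0 where "G0 = G - {(a, d), (c, b)}"
  have sw: "swap G a d c b = G0 \<union> {(a, b), (c, d)}" by (simp add: swap_def G0_def)
  have G0: "G0 \<subseteq> G" "(a, d) \<notin> G0" "(c, b) \<notin> G0" by (auto simp: G0_def)
  have ndx: "Inr d \<notin> set xs" "Inl c \<notin> set xs" using W(1) by (auto simp: W_def)
  have "(a, d) \<notin> pe xs" "(c, b) \<notin> pe xs"
    using pe_vertices[OF axs(1), of "Inl a" "Inr d"] pe_vertices[OF axs(1), of "Inl c" "Inr b"] ndx by auto
  then have "pe xs \<subseteq> G0" using peW W(3) by (auto simp: G0_def)
  then show "cyc xs \<subseteq> swap G a d c b" using ends by (auto simp: cyc_def sw)
  have f0: "ed (W ! 0) (W ! 1) = (a, d)" "ed (rev W ! 0) (rev W ! 1) = (c, b)" using W0 rW by auto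
  show "(a, d) \<notin> C' \<and> (c, b) \<notin> C'" if j: "j \<in> {2..k}" and C': "C' \<in> cycles j G" for j C'
  proof (intro conjI notI)
    assume "(a, d) \<in> C'"
    then obtain Q where Q: "cycle_list j Q" "hd Q = Inl a" "last Q = Inr d"
       "is_path (C' - {(a, d)}) Q" "C' \<subseteq> G"
      using cycle_through_edge[OF C'] j by (metis atLeastAtMost_iff)
    have Qne: "Q \<noteq> []" using Q j by (auto simp: cycle_list_def)
    have "short_path_excursion G W"
    proof (rule short_path_excursionI[OF W(1,2,4) Q(4), where a=1])
      show "\<not> prefix Q (drop 1 W)"
      proof
        assume "prefix Q (drop 1 W)"
        then have "set Q \<subseteq> set (drop 1 W)" by (rule set_mono_prefix)
        then have "Inr d \<in> set (drop 1 W)" using Q(3) Qne last_in_set[of Q] by auto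
        then show False using ndx by (auto simp: W_def)
      qed
    qed (use Q Qne W0 f0 setW j in \<open>auto simp: cycle_list_def\<close>)
    then show False using noW by simp
  next
    assume "(c, b) \<in> C'"
    then obtain Q where Q: "cycle_list j Q" "hd Q = Inl c" "last Q = Inr b"
       "is_path (C' - {(c, b)}) Q" "C' \<subseteq> G"
      using cycle_through_edge[OF C'] j by (metis atLeastAtMost_iff)
    have Qne: "Q \<noteq> []" using Q j by (auto simp: cycle_list_def)
    have "is_path (C' - {(c, b)}) (rev Q)" using Q(4) by (simp add: is_path_rev)
    then have "short_path_excursion G (rev W)"
    proof (rule short_path_excursionI[OF Wr, where a=1])
      show "\<not> prefix (rev Q) (drop 1 (rev W))"
      proof
        assume "prefix (rev Q) (drop 1 (rev W))"
        then have "set (rev Q) \<subseteq> set (drop 1 (rev W))" by (rule set_mono_prefix)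
        then have "Inl c \<in> set (drop 1 (rev W))" using Q(2) Qne hd_in_set[of Q] by auto
        then show False using ndx by (auto simp: W_def)
      qed
    qed (use Q Qne rW f0 setW j in \<open>auto simp: cycle_list_def hd_rev last_rev\<close>)
    then show False using noW by simp
  qed
  show "C' = cyc xs" if j: "j \<in> {2..k}" and C': "C' \<in> cycles j (swap G a d c b)"
    and e: "(a, b) \<in> C' \<or> (c, d) \<in> C'" for j C'
  proof (rule ccontr)
    assume ne: "C' \<noteq> cyc xs"
    consider "(a, b) \<in> C'" | "(a, b) \<notin> C'" "(c, d) \<in> C'" using e by blast
    then show False
    proof cases
      case 1
      then obtain Q where Q: "cycle_list j Q" "cyc Q = C'" "hd Q = Inl a" "last Q = Inr b"
         "is_path (C' - {(a, b)}) Q" "C' \<subseteq> swap G a d c b"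
        using cycle_through_edge[OF C'] j by (metis atLeastAtMost_iff)
      have lQ: "length Q \<le> 2 * k" "Q \<noteq> []" "alt Q" using Q j by (auto simp: cycle_list_def)
      have sub: "C' - {(a, b)} \<subseteq> insert (c, d) G0" using Q(6) sw by auto
      have dW: "drop 1 W = xs @ [Inl c]" by (simp add: W_def)
      show False
      proof (cases "(c, d) \<in> pe Q")
        case False
        then have p0: "is_path G0 Q" using Q(5) sub by (auto simp: is_path_def)
        have "short_path_excursion G W"
        proof (rule short_path_excursionI[OF W(1,2,4) p0 G0(1), where a=1])
          show "\<not> prefix Q (drop 1 W)"
          proof
            assume pr: "prefix Q (drop 1 W)"
            have "Q \<noteq> xs @ [Inl c]" using Q(4) by auto
            then have "prefix Q xs" using pr unfolding dW prefix_snoc by simp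
            then have "Q = xs" using prefix_last[of Q xs] axs lQ Q(4) ends by simp
            then show False using ne Q(2) by simp
          qed
        qed (use Q lQ W0 f0 setW G0 in auto)
        then show False using noW by simp
      next
        case True
        then obtain Q1 where s: "Q1 \<noteq> []" "hd Q1 = hd Q" "length Q1 < length Q"
          "is_path (C' - {(a, b)} - {(c, d)}) Q1" and c2: "last Q1 = Inl c \<or> last Q1 = Inr d"
          using path_split_at_edge[OF Q(5)] by metis
        have hQ1: "hd Q1 = Inl a" using Q(3) s by simp
        have p0: "is_path G0 Q1" using s(4) sub by (auto simp: is_path_def)
        have l1: "length Q1 < 2 * k" using lQ s by simp
        have "short_path_excursion G W"
        proof (rule short_path_excursionI[OF W(1,2,4) p0 G0(1), where a=1])
          show "\<not> prefix Q1 (drop 1 W)"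
          proof
            assume pr: "prefix Q1 (drop 1 W)"
            have "Q1 \<noteq> xs @ [Inl c]" using l1 ws(2) by auto
            then have "prefix Q1 xs" using pr unfolding dW prefix_snoc by simp
            then have "set Q1 \<subseteq> set xs" by (rule set_mono_prefix)
            then have "last Q1 \<in> set xs" using s by auto
            then show False using ndx c2 by auto
          qed
          show "last Q1 \<in> set W" using c2 setW by auto
        qed (use hQ1 s l1 W0 f0 G0 in auto)
        then show False using noW by simp
      qed
    next
      case 2
      then obtain Q where Q: "cycle_list j Q" "cyc Q = C'" "hd Q = Inl c" "last Q = Inr d"
         "is_path (C' - {(c, d)}) Q" "C' \<subseteq> swap G a d c b"
        using cycle_through_edge[OF C'] j by (metis atLeastAtMost_iff)
      have Qne: "Q \<noteq> []" using Q j by (auto simp: cycle_list_def)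
      have "C' - {(c, d)} \<subseteq> G0" using Q(6) sw 2 by auto
      then have p0: "is_path G0 (rev Q)" using Q(5) unfolding is_path_rev by (auto simp: is_path_def)
      have lQ: "length Q \<le> 2 * k" using Q j by (auto simp: cycle_list_def)
      have "short_path_excursion G W"
      proof (rule short_path_excursionI[OF W(1,2,4) p0 G0(1), where a=0])
        show "\<not> prefix (rev Q) (drop 0 W)"
        proof
          assume "prefix (rev Q) (drop 0 W)"
          then have "rev Q = W" using prefix_last[of "rev Q" W] W Q Qne lastW by (simp add: last_rev)
          then have "length Q = 2 * k + 2" using W(4) by (metis length_rev)
          then show False using lQ by simp
        qed
      qed (use Q Qne lQ W0 f0 setW in \<open>auto simp: hd_rev last_rev\<close>)
      then show False using noW by simp
    qed
  qed
qed

end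

section \<open>Counting the failed switchings\<close>

context biregular_setting
begin

text \<open>Sum over the cycle vertex \<open>z\<close> that is reached and the length
  \<open>L\<close> of the walk to it. The lengths contribute geometrically, so the factor is 2 * 4 *
  4 and only the choice of \<open>z\<close> costs \<open>k\<close>.\<close>

lemma card_near_le:
  assumes G: "G \<in> \<G>" and xs: "xs \<in> cycle_lists k G"
  shows "card {(c, d) \<in> G. near G xs c d} \<le> 32 * k * DD ^ k"
proof -
  have x: "cycle_list k xs" "cyc xs \<subseteq> G" using xs by (auto simp: cycle_lists_def)
  have len: "card (set xs) \<le> 2 * k" using card_length[of xs] x by (simp add: cycle_list_def)
  have sv: "set xs \<subseteq> verts n m" using vs_G[OF G x(2)] vs_cyc[OF x(1)] k by auto
  define B where "B = (\<lambda>z L. Sigma {ws. nbwalk G ws \<and> length ws = Suc L \<and> last ws = z} (\<lambda>ws. nbrs G (hd ws)))"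
  have B: "finite (B z L)" "card (B z L) \<le> 4 * DD ^ (L div 2 + 1)" if "z \<in> set xs" for z L
  proof -
    have z: "z \<in> verts n m" using that sv by auto
    note s = sum_deg_nbwalks_to[OF G z, where L=L]
    show "finite (B z L)" unfolding B_def using s(1,3) by (intro finite_SigmaI) auto
    have "card (B z L) = (\<Sum>ws\<in>{ws. nbwalk G ws \<and> length ws = Suc L \<and> last ws = z}. card (nbrs G (hd ws)))"
      unfolding B_def using s(1,3) by (intro card_SigmaI) auto
    then show "card (B z L) \<le> 4 * DD ^ (L div 2 + 1)" using s(2) by simp
  qed
  have "{(c, d) \<in> G. near G xs c d} \<subseteq> (\<Union>z\<in>set xs. \<Union>L<2 * k. (\<lambda>(ws, y). ed y (hd ws)) ` B z L)"
  proof clarify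
    fix c d assume cd: "(c, d) \<in> G" "near G xs c d"
    then obtain Q where Q: "is_path G Q" "Q \<noteq> []" "length Q \<le> 2 * k" "last Q \<in> set xs"
      "hd Q = Inl c \<or> hd Q = Inr d" by (auto simp: near_def)
    define y :: "nat + nat" where "y = (if hd Q = Inl c then Inr d else Inl c)"
    have y: "y \<in> nbrs G (hd Q)" "ed y (hd Q) = (c, d)"
      using Q(5) cd by (auto simp: y_def nbrs_def)
    define L where "L = length Q - 1"
    have L: "length Q = Suc L" "L < 2 * k" using Q(2,3) k by (cases Q; auto simp: L_def)+
    have "(Q, y) \<in> B (last Q) L" using y L is_path_nbwalk[OF Q(1)] by (auto simp: B_def)
    then have "(c, d) \<in> (\<lambda>(ws, y). ed y (hd ws)) ` B (last Q) L"
      using y by (intro image_eqI[of _ _ "(Q, y)"]) auto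
    then show "(c, d) \<in> (\<Union>z\<in>set xs. \<Union>L<2 * k. (\<lambda>(ws, y). ed y (hd ws)) ` B z L)"
      using Q(4) L(2) by blast
  qed
  then have "card {(c, d) \<in> G. near G xs c d} \<le> card (\<Union>z\<in>set xs. \<Union>L<2 * k. (\<lambda>(ws, y). ed y (hd ws)) ` B z L)"
    using B by (intro card_mono) auto
  also have "\<dots> \<le> (\<Sum>z\<in>set xs. card (\<Union>L<2 * k. (\<lambda>(ws, y). ed y (hd ws)) ` B z L))"
    by (rule card_UN_le) simp
  also have "\<dots> \<le> (\<Sum>z\<in>set xs. \<Sum>L<2 * k. card ((\<lambda>(ws, y). ed y (hd ws)) ` B z L))"
    by (intro sum_mono card_UN_le) simp
  also have "\<dots> \<le> (\<Sum>z\<in>set xs. \<Sum>L<2 * k. 4 * DD ^ (L div 2 + 1))"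
    using B by (intro sum_mono) (meson card_image_le order_trans)
  also have "\<dots> = card (set xs) * (4 * DD * (\<Sum>L<2 * k. DD ^ (L div 2)))"
    by (simp add: sum_distrib_left mult_ac)
  also have "\<dots> \<le> (2 * k) * (4 * DD * (4 * DD ^ ((2 * k - 1) div 2)))"
    by (intro mult_mono len sum_pow_half DD2) auto
  also have "(2 * k - 1) div 2 = k - 1" using k by linarith
  also have "(2 * k) * (4 * DD * (4 * DD ^ (k - 1))) = 32 * k * (DD ^ Suc (k - 1))" by simp
  also have "Suc (k - 1) = k" using k by simp
  finally show ?thesis .
qed

abbreviation la :: "walk \<Rightarrow> nat" where "la xs \<equiv> projl (hd xs)"
abbreviation lb :: "walk \<Rightarrow> nat" where "lb xs \<equiv> projr (last xs)"

text \<open>The closing edge \<open>(la xs, lb xs)\<close> of the cycle \<open>xs\<close> is switched with \<open>(c, d)\<close>, which turns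
  \<open>Inr d # xs @ [Inl c]\<close> into a path.\<close>

definition forward :: "graph \<Rightarrow> (walk \<times> nat \<times> nat) set" where
  "forward G = {(xs, c, d). xs \<in> cycle_lists k G \<and> (c, d) \<in> G \<and> distinct (Inr d # xs @ [Inl c]) \<and>
     (la xs, d) \<notin> G \<and> (c, lb xs) \<notin> G \<and>
     (\<forall>j\<in>{2..<k}. cycle_count j (swap G (la xs) (lb xs) c d) = cycle_count j G) \<and>
     cycle_count k G = Suc (cycle_count k (swap G (la xs) (lb xs) c d))}"

text \<open>The same triples as in \<open>forward\<close>, seen in the switched graph:
  \<open>xs\<close> is now the inner part of a path, and the reverse switching closes it to a
  cycle.\<close>

definition backward :: "graph \<Rightarrow> (walk \<times> nat \<times> nat) set" where
  "backward G = {(xs, c, d). cycle_list k xs \<and> is_path G (Inr d # xs @ [Inl c]) \<and>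
     (la xs, lb xs) \<notin> G \<and> (c, d) \<notin> G \<and>
     (\<forall>j\<in>{2..<k}. cycle_count j (swap G (la xs) d c (lb xs)) = cycle_count j G) \<and>
     cycle_count k (swap G (la xs) d c (lb xs)) = Suc (cycle_count k G)}"

lemma cycle_list_k_ends:
  "cycle_list k xs \<Longrightarrow> xs \<noteq> [] \<and> hd xs = Inl (la xs) \<and> last xs = Inr (lb xs)"
  using cycle_list_ends[of k xs] k by auto

lemma pe_extended:
  assumes "cycle_list k xs"
  shows "pe (Inr d # xs @ [Inl c]) = insert (la xs, d) (insert (c, lb xs) (pe xs))"
    "alt (Inr d # xs @ [Inl c])"
proof -
  have e: "xs \<noteq> []" "hd xs = Inl (la xs)" "last xs = Inr (lb xs)" using cycle_list_k_ends[OF assms] by auto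
  have "ed (Inr d) (hd xs) = (la xs, d)" "ed (last xs) (Inl c) = (c, lb xs)"
    by (subst e; simp)+
  then show "pe (Inr d # xs @ [Inl c]) = insert (la xs, d) (insert (c, lb xs) (pe xs))"
    using e(1) by (auto simp: pe_Cons pe_append)
  have "isl (hd xs)" "\<not> isl (last xs)" by (subst e, simp)+
  then show "alt (Inr d # xs @ [Inl c])"
    using e(1) assms by (auto simp: alt_Cons alt_append cycle_list_def)
qed

lemma cyc_conv_ends:
  assumes "cycle_list k xs"
  shows "cyc xs = insert (la xs, lb xs) (pe xs)" "(la xs, lb xs) \<notin> pe xs"
proof -
  have "ed (last xs) (hd xs) = (la xs, lb xs)"
    using cycle_list_k_ends[OF assms] by (metis ed_Inl(2))
  then show "cyc xs = insert (la xs, lb xs) (pe xs)" "(la xs, lb xs) \<notin> pe xs"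
    using closing_edge_notin_pe[OF assms k] by (auto simp: cyc_def)
qed

lemma notin_pe:
  assumes "cycle_list k xs" "distinct (Inr d # xs @ [Inl c])"
  shows "(c, y) \<notin> pe xs" "(x, d) \<notin> pe xs"
  using pe_vertices[of xs "Inl c" "Inr y"] pe_vertices[of xs "Inl x" "Inr d"] assms
  by (auto simp: cycle_list_def)

lemma swap_graph:
  assumes "G \<in> \<G>" "(a, b) \<in> G" "(c, d) \<in> G" "(a, d) \<notin> G" "(c, b) \<notin> G"
  shows "swap G a b c d \<in> \<G>"
  using biregular_swap[OF G_biregular[OF assms(1)]] assms(2-) by (simp add: biregular_graphs_def)

text \<open>Both sides demand the right effect on the cycle counts, so undoing the switching is an
  exact bijection. All failures are left to the cardinality bounds.\<close>

lemma forward_backward_bij: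
  "bij_betw (\<lambda>(G, xs, c, d). (swap G (la xs) (lb xs) c d, xs, c, d)) (Sigma \<G> forward) (Sigma \<G> backward)"
proof (rule bij_betw_byWitness[where f' = "\<lambda>(G, xs, c, d). (swap G (la xs) d c (lb xs), xs, c, d)"])
  have fw: "(la xs, lb xs) \<in> G \<and> (c, d) \<in> G \<and> (la xs, d) \<notin> G \<and> (c, lb xs) \<notin> G \<and> cycle_list k xs"
    if "(xs, c, d) \<in> forward G" for G xs c d
    using that cyc_conv_ends[of xs] by (auto simp: forward_def cycle_lists_def)
  have bw: "(la xs, d) \<in> G \<and> (c, lb xs) \<in> G \<and> (la xs, lb xs) \<notin> G \<and> (c, d) \<notin> G \<and> cycle_list k xs"
    if "(xs, c, d) \<in> backward G" for G xs c d
    using that pe_extended[of xs d c] by (auto simp: backward_def is_path_def)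
  have sw1: "swap (swap G (la xs) (lb xs) c d) (la xs) d c (lb xs) = G" if "(xs, c, d) \<in> forward G" for G xs c d
    using fw[OF that] by (intro swap_swap) auto
  have sw2: "swap (swap G (la xs) d c (lb xs)) (la xs) (lb xs) c d = G" if "(xs, c, d) \<in> backward G" for G xs c d
    using bw[OF that] by (intro swap_swap) auto
  show "\<forall>x\<in>Sigma \<G> forward. (\<lambda>(G, xs, c, d). (swap G (la xs) d c (lb xs), xs, c, d))
      ((\<lambda>(G, xs, c, d). (swap G (la xs) (lb xs) c d, xs, c, d)) x) = x"
    using sw1 by auto
  show "\<forall>x\<in>Sigma \<G> backward. (\<lambda>(G, xs, c, d). (swap G (la xs) (lb xs) c d, xs, c, d))
      ((\<lambda>(G, xs, c, d). (swap G (la xs) d c (lb xs), xs, c, d)) x) = x"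
    using sw2 by auto
  show "(\<lambda>(G, xs, c, d). (swap G (la xs) (lb xs) c d, xs, c, d)) ` Sigma \<G> forward \<subseteq> Sigma \<G> backward"
  proof clarify
    fix G xs c d assume G: "G \<in> \<G>" and f: "(xs, c, d) \<in> forward G"
    define G' where "G' = swap G (la xs) (lb xs) c d"
    note F = fw[OF f]
    have cl: "cycle_list k xs" using F by simp
    have dist: "distinct (Inr d # xs @ [Inl c])" using f by (auto simp: forward_def)
    have "pe xs \<subseteq> G" using f cyc_conv_ends[OF cl] by (auto simp: forward_def cycle_lists_def)
    then have "pe xs \<subseteq> G'"
      using cyc_conv_ends[OF cl] notin_pe[OF cl dist] by (auto simp: G'_def swap_def)
    then have "is_path G' (Inr d # xs @ [Inl c])"
      unfolding is_path_def pe_extended(1)[OF cl] using dist pe_extended(2)[OF cl]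
      by (auto simp: G'_def swap_def)
    moreover have "(la xs, lb xs) \<notin> G'" "(c, d) \<notin> G'" using F by (auto simp: G'_def swap_def)
    ultimately have "(xs, c, d) \<in> backward G'"
      using f sw1[OF f] cl by (auto simp: backward_def forward_def G'_def)
    moreover have "G' \<in> \<G>" unfolding G'_def using swap_graph[OF G] F by blast
    ultimately show "swap G (la xs) (lb xs) c d \<in> \<G> \<and> (xs, c, d) \<in> backward (swap G (la xs) (lb xs) c d)"
      by (simp add: G'_def)
  qed
  show "(\<lambda>(G, xs, c, d). (swap G (la xs) d c (lb xs), xs, c, d)) ` Sigma \<G> backward \<subseteq> Sigma \<G> forward"
  proof clarify
    fix G xs c d assume G: "G \<in> \<G>" and f: "(xs, c, d) \<in> backward G"
    define G' where "G' = swap G (la xs) d c (lb xs)"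
    note F = bw[OF f]
    have cl: "cycle_list k xs" using F by simp
    have dist: "distinct (Inr d # xs @ [Inl c])" using f by (auto simp: backward_def is_path_def)
    have "pe xs \<subseteq> G" using f pe_extended(1)[OF cl, of d c] by (auto simp: backward_def is_path_def)
    then have "pe xs \<subseteq> G'" using notin_pe[OF cl dist] by (auto simp: G'_def swap_def)
    then have "cyc xs \<subseteq> G'" unfolding cyc_conv_ends(1)[OF cl] by (auto simp: G'_def swap_def)
    moreover have "(c, d) \<in> G'" "(la xs, d) \<notin> G'" "(c, lb xs) \<notin> G'" using F by (auto simp: G'_def swap_def)
    ultimately have "(xs, c, d) \<in> forward G'"
      using f sw2[OF f] cl dist by (auto simp: backward_def forward_def G'_def cycle_lists_def)
    moreover have "G' \<in> \<G>" unfolding G'_def using swap_graph[OF G] F by blast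
    ultimately show "swap G (la xs) d c (lb xs) \<in> \<G> \<and> (xs, c, d) \<in> forward (swap G (la xs) d c (lb xs))"
      by (simp add: G'_def)
  qed
qed

text \<open>Three kinds of failure make up the 132: a short excursion from the cycle (64), a second
  edge close to the cycle (64), and a second edge on a disjoint short cycle (4).\<close>

lemma forward_bounds:
  shows "G \<in> \<G> \<Longrightarrow> finite (forward G)"
    and "G \<in> \<G> \<Longrightarrow> card (forward G) \<le> 2 * k * cycle_count k G * (n * d1)"
    and "(\<Sum>G\<in>\<G>. 2 * k * cycle_count k G * (n * d1)) \<le> total forward + 132 * k * card \<G> * DD ^ (2 * k)"
proof -
  define T where "T = (\<lambda>G. cycle_lists k G \<times> G)"
  define A where "A = (\<lambda>G. {xs \<in> cycle_lists k G. short_cycle_excursion G xs} \<times> G)"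
  define B where "B = (\<lambda>G. SIGMA xs:cycle_lists k G. {(c, d) \<in> G. near G xs c d})"
  \<comment> \<open>The second cycle is remembered only through its closing edge, which is the edge
    \<open>(c, d)\<close>.\<close>
  define g where "g = (\<lambda>zs :: walk. (take (2 * k) zs, la (drop (2 * k) zs), lb (drop (2 * k) zs)))"
  define C where "C = (\<lambda>G. \<Union>j\<in>{2..k}. g ` cycle_pairs j G)"
  have fc: "finite (cycle_lists k G)" if "G \<in> \<G>" for G
    using card_cycle_lists(1)[OF finite_graph[OF that] k] .
  have fT: "finite (T G)" if "G \<in> \<G>" for G using fc[OF that] finite_graph[OF that] by (simp add: T_def)
  have cT: "card (T G) = 2 * k * cycle_count k G * (n * d1)" if "G \<in> \<G>" for G
    using card_cycle_lists(2)[OF finite_graph[OF that] k] biregular_card[OF G_biregular[OF that]]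
    by (simp add: T_def card_cartesian_product)
  have sub: "forward G \<subseteq> T G" for G by (auto simp: forward_def T_def)
  show "finite (forward G)" if "G \<in> \<G>" using finite_subset[OF sub fT[OF that]] .
  show "card (forward G) \<le> 2 * k * cycle_count k G * (n * d1)" if "G \<in> \<G>"
    using card_mono[OF fT[OF that] sub] cT[OF that] by simp
  have cover: "T G \<subseteq> forward G \<union> (A G \<union> B G \<union> C G)" if G: "G \<in> \<G>" for G
  proof
    fix t assume "t \<in> T G"
    then obtain xs c d where t: "t = (xs, c, d)" "xs \<in> cycle_lists k G" "(c, d) \<in> G" by (auto simp: T_def)
    have cl: "cycle_list k xs" using t by (simp add: cycle_lists_def)
    note ce = cycle_list_k_ends[OF cl]
    consider "short_cycle_excursion G xs" | "near G xs c d" | "on_disjoint_cycle G xs c d"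
      | "\<not> short_cycle_excursion G xs" "\<not> near G xs c d" "\<not> on_disjoint_cycle G xs c d" by blast
    then show "t \<in> forward G \<union> (A G \<union> B G \<union> C G)"
    proof cases
      case 1 then show ?thesis using t by (auto simp: A_def)
    next
      case 2 then show ?thesis using t by (auto simp: B_def)
    next
      case 3
      then obtain j Q where Q: "j \<in> {2..k}" "Q \<in> cycle_lists j G" "set Q \<inter> set xs = {}" "hd Q = Inl c" "last Q = Inr d"
        by (auto simp: on_disjoint_cycle_def)
      have "length xs = 2 * k" using cl by (simp add: cycle_list_def)
      then have tk: "take (2 * k) (xs @ Q) = xs" "drop (2 * k) (xs @ Q) = Q" by auto
      have "xs @ Q \<in> cycle_pairs j G" "g (xs @ Q) = t"
        unfolding cycle_pairs_def g_def mem_Collect_eq tk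
        using Q t cl by (auto simp: cycle_lists_def cycle_list_def)
      then have "t \<in> C G" unfolding C_def using Q(1) by blast
      then show ?thesis by simp
    next
      case 4
      note fg = forward_good[OF t(2) _ _ t(3) 4, of "la xs" "lb xs"]
      have fg': "distinct (Inr d # xs @ [Inl c])" "(la xs, d) \<notin> G" "(c, lb xs) \<notin> G"
        using fg(1-3) ce by blast+
      have abC: "(la xs, lb xs) \<in> cyc xs" using cyc_conv_ends[OF cl] by simp
      have cxG: "cyc xs \<subseteq> G" using t by (simp add: cycle_lists_def)
      have "cyc xs \<in> cycles k G" using cycles_iff[of k] k cl cxG by auto
      note cc = cycle_count_swap[OF k finite_graph[OF G] this abC _ t(3) fg'(2,3)]
      have "\<forall>j\<in>{2..<k}. cycle_count j (swap G (la xs) (lb xs) c d) = cycle_count j G"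
        using cc(1) fg(4,5) ce cxG abC by blast
      moreover have "cycle_count k G = Suc (cycle_count k (swap G (la xs) (lb xs) c d))"
        using cc(2) fg(4,5) ce cxG abC by blast
      ultimately have "t \<in> forward G" using t fg' by (auto simp: forward_def)
      then show ?thesis by simp
    qed
  qed
  have fA: "finite (A G)" if "G \<in> \<G>" for G using fc[OF that] finite_graph[OF that] by (simp add: A_def)
  have fB: "finite (B G)" if "G \<in> \<G>" for G
    unfolding B_def using fc[OF that] finite_graph[OF that]
    by (intro finite_SigmaI) (auto intro: finite_subset[of _ G])
  have fZ: "finite (cycle_pairs j G)" if "G \<in> \<G>" "j \<in> {2..k}" for G j
    using expected_cycle_pairs(2)[of j G] that by auto
  have fC: "finite (C G)" if "G \<in> \<G>" for G unfolding C_def using fZ[OF that] by auto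
  have sA: "total A \<le> 64 * k * card \<G> * DD ^ (2 * k)"
  proof -
    have "total A = (\<Sum>G\<in>\<G>. card {xs \<in> cycle_lists k G. short_cycle_excursion G xs}) * (n * d1)"
      unfolding sum_distrib_right
      by (intro sum.cong refl) (simp add: A_def card_cartesian_product biregular_card[OF G_biregular])
    then show ?thesis using expected_short_cycle_excursion by simp
  qed
  have DD2k: "DD ^ k * DD ^ k = DD ^ (2 * k)" by (simp add: power_add[symmetric] mult_2)
  have sB: "total B \<le> 64 * k * card \<G> * DD ^ (2 * k)"
  proof -
    have "card (B G) \<le> card (cycle_lists k G) * (32 * k * DD ^ k)" if G: "G \<in> \<G>" for G
    proof -
      have "card (B G) = (\<Sum>xs\<in>cycle_lists k G. card {(c, d) \<in> G. near G xs c d})"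
        unfolding B_def using fc[OF G] finite_graph[OF G]
        by (intro card_SigmaI) (auto intro: finite_subset[of _ G])
      also have "\<dots> \<le> card (cycle_lists k G) * (32 * k * DD ^ k)"
        using sum_bounded_above[of "cycle_lists k G" "\<lambda>xs. card {(c, d) \<in> G. near G xs c d}"] card_near_le[OF G] by simp
      finally show ?thesis .
    qed
    then have "total B \<le> (\<Sum>G\<in>\<G>. card (cycle_lists k G) * (32 * k * DD ^ k))"
      by (rule sum_mono)
    also have "\<dots> = total (cycle_lists k) * (32 * k * DD ^ k)" by (simp add: sum_distrib_right)
    also have "\<dots> \<le> (2 * card \<G> * DD ^ k) * (32 * k * DD ^ k)"
      by (intro mult_right_mono expected_cycle_lists) simp
    also have "\<dots> = 64 * k * card \<G> * (DD ^ k * DD ^ k)" by simp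
    finally show ?thesis unfolding DD2k .
  qed
  have sC: "total C \<le> 4 * k * card \<G> * DD ^ (2 * k)"
  proof -
    have "card (C G) \<le> (\<Sum>j\<in>{2..k}. card (cycle_pairs j G))" if G: "G \<in> \<G>" for G
    proof -
      have "card (C G) \<le> (\<Sum>j\<in>{2..k}. card (g ` cycle_pairs j G))" unfolding C_def by (rule card_UN_le) simp
      also have "\<dots> \<le> (\<Sum>j\<in>{2..k}. card (cycle_pairs j G))" using fZ[OF G] by (intro sum_mono card_image_le) auto
      finally show ?thesis .
    qed
    then have "total C \<le> (\<Sum>G\<in>\<G>. \<Sum>j\<in>{2..k}. card (cycle_pairs j G))" by (rule sum_mono)
    also have "\<dots> = (\<Sum>j\<in>{2..k}. \<Sum>G\<in>\<G>. card (cycle_pairs j G))" by (rule sum.swap)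
    also have "\<dots> \<le> (\<Sum>j\<in>{2..k}. 2 * card \<G> * DD ^ (2 * k))"
    proof (rule sum_mono)
      fix j assume j: "j \<in> {2..k}"
      have "(\<Sum>G\<in>\<G>. card (cycle_pairs j G)) \<le> 2 * card \<G> * DD ^ (k + j)"
        using expected_cycle_pairs(1)[of j] j by auto
      also have "\<dots> \<le> 2 * card \<G> * DD ^ (2 * k)"
        using j DD2 by (intro mult_left_mono power_increasing) auto
      finally show "(\<Sum>G\<in>\<G>. card (cycle_pairs j G)) \<le> 2 * card \<G> * DD ^ (2 * k)" .
    qed
    also have "\<dots> = (k - 1) * (2 * card \<G> * DD ^ (2 * k))" by simp
    also have "\<dots> \<le> (2 * k) * (2 * card \<G> * DD ^ (2 * k))" by (rule mult_right_mono) auto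
    finally show ?thesis by (simp add: mult_ac)
  qed
  have "(\<Sum>G\<in>\<G>. 2 * k * cycle_count k G * (n * d1)) = total T" using cT by simp
  also have "\<dots> \<le> (\<Sum>G\<in>\<G>. card (forward G) + (card (A G) + card (B G) + card (C G)))"
  proof (rule sum_mono)
    fix G assume G: "G \<in> \<G>"
    have "card (T G) \<le> card (forward G \<union> (A G \<union> B G \<union> C G))"
      using finite_subset[OF sub fT[OF G]] fA[OF G] fB[OF G] fC[OF G] by (intro card_mono cover G) auto
    also have "\<dots> \<le> card (forward G) + (card (A G) + card (B G) + card (C G))"
      by (meson add_le_mono card_Un_le le_refl order_trans)
    finally show "card (T G) \<le> card (forward G) + (card (A G) + card (B G) + card (C G))" .
  qed
  also have "\<dots> = total forward + (total A + total B + total C)"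
    by (simp only: sum.distrib)
  also have "\<dots> \<le> total forward + (64 * k * card \<G> * DD ^ (2 * k) + 64 * k * card \<G> * DD ^ (2 * k) + 4 * k * card \<G> * DD ^ (2 * k))"
    by (intro add_mono sA sB sC order_refl)
  finally show "(\<Sum>G\<in>\<G>. 2 * k * cycle_count k G * (n * d1)) \<le> total forward + 132 * k * card \<G> * DD ^ (2 * k)"
    by simp
qed

text \<open>The count is the same in every graph. Its ratio to the \<open>2 * k * (n * d1)\<close>
  switchings per cycle is \<open>DD ^ k / (2 * k)\<close>, the Poisson mean. Fixing the side of the
  last vertex counts each walk in one direction only.\<close>

lemma card_nbwalks_total:
  assumes G: "G \<in> \<G>"
  shows "finite {ws. nbwalk G ws \<and> length ws = 2 * k + 2 \<and> isl (last ws)}"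
    "card {ws. nbwalk G ws \<and> length ws = 2 * k + 2 \<and> isl (last ws)} = n * d1 * DD ^ k"
proof -
  define X where "X = (\<lambda>u. {ws. nbwalk G ws \<and> length ws = Suc (Suc (2 * k)) \<and> last ws = Inl u})"
  have eq: "{ws. nbwalk G ws \<and> length ws = 2 * k + 2 \<and> isl (last ws)} = (\<Union>u\<in>{0..<n}. X u)"
  proof (intro equalityI subsetI)
    fix ws assume "ws \<in> {ws. nbwalk G ws \<and> length ws = 2 * k + 2 \<and> isl (last ws)}"
    then have ws: "nbwalk G ws" "length ws = 2 * k + 2" "isl (last ws)" by auto
    have "ws \<noteq> []" using ws by auto
    then have "last ws \<in> verts n m" using nbwalk_verts[OF G ws(1)] ws(2) by auto
    then obtain u where "u < n" "last ws = Inl u" using ws(3) by (auto simp: verts_def)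
    then show "ws \<in> (\<Union>u\<in>{0..<n}. X u)" using ws by (auto simp: X_def)
  qed (auto simp: X_def)
  have X: "finite (X u)" "card (X u) = d1 * DD ^ k" if "u \<in> {0..<n}" for u
    using card_nbwalks_to[OF G, of "Inl u" "2 * k"] that wprod_even[of False k]
    by (auto simp: X_def verts_def deg_def)
  show "finite {ws. nbwalk G ws \<and> length ws = 2 * k + 2 \<and> isl (last ws)}" unfolding eq using X by auto
  have "card (\<Union>u\<in>{0..<n}. X u) = (\<Sum>u\<in>{0..<n}. card (X u))"
    using X by (intro card_UN_disjoint) (auto simp: X_def)
  then show "card {ws. nbwalk G ws \<and> length ws = 2 * k + 2 \<and> isl (last ws)} = n * d1 * DD ^ k"
    unfolding eq using X by simp
qed

text \<open>A triple is read as the walk \<open>Inr d # xs @ [Inl c]\<close>. Walks fail if they are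
  not simple (10) or have a short excursion seen from the first or from the last vertex (192
  each).\<close>

lemma backward_bounds:
  shows "G \<in> \<G> \<Longrightarrow> finite (backward G)"
    and "G \<in> \<G> \<Longrightarrow> card (backward G) \<le> n * d1 * DD ^ k"
    and "card \<G> * (n * d1 * DD ^ k) \<le> total backward + 394 * k * card \<G> * DD ^ (2 * k)"
proof -
  define T where "T = (\<lambda>G. {ws. nbwalk G ws \<and> length ws = 2 * k + 2 \<and> isl (last ws)})"
  define g where "g = (\<lambda>(xs, c, d). Inr d # xs @ [Inl c] :: walk)"
  define A where "A = (\<lambda>G. {ws. nbwalk G ws \<and> length ws = 2 * k + 2 \<and> isl (last ws) \<and> \<not> distinct ws})"
  \<comment> \<open>\<open>b = False\<close> is for the walks themselves, which start on the right;
    \<open>b = True\<close> is for their reversals.\<close>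
  define B where "B = (\<lambda>b G. {ws. is_path G ws \<and> length ws = 2 * k + 2 \<and> isl (hd ws) = b \<and> short_path_excursion G ws})"
  have inj: "inj_on g S" for S by (auto simp: inj_on_def g_def)
  have sub: "g ` backward G \<subseteq> T G" for G
    by (auto simp: backward_def T_def g_def is_path_nbwalk cycle_list_def)
  have fT: "finite (T G)" "card (T G) = n * d1 * DD ^ k" if "G \<in> \<G>" for G
    using card_nbwalks_total[OF that] by (auto simp: T_def)
  show fb: "finite (backward G)" if "G \<in> \<G>" for G
    using finite_subset[OF sub fT(1)[OF that]] finite_imageD[OF _ inj] by blast
  have cg: "card (g ` backward G) = card (backward G)" for G by (rule card_image[OF inj])
  show "card (backward G) \<le> n * d1 * DD ^ k" if "G \<in> \<G>"
    using card_mono[OF fT(1)[OF that] sub] fT(2)[OF that] cg by simp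
  have altends: "isl (hd ws) \<longleftrightarrow> \<not> isl (last ws)" if "alt ws" "length ws = 2 * k + 2" for ws
    using alt_even_ends[of ws "k + 1"] that by auto
  have fB: "finite (B b G)" if G: "G \<in> \<G>" for b G
  proof (cases b)
    case False
    have "B b G \<subseteq> T G" using False altends by (auto simp: B_def T_def is_path_nbwalk is_path_def)
    then show ?thesis using fT(1)[OF G] finite_subset by blast
  next
    case True
    have "rev ` B b G \<subseteq> T G"
    proof clarify
      fix ws assume ws: "ws \<in> B b G"
      then have "is_path G (rev ws)" "ws \<noteq> []" by (auto simp: B_def is_path_rev)
      then show "rev ws \<in> T G" using ws True by (auto simp: B_def T_def is_path_nbwalk last_rev)
    qed
    then have "finite (rev ` B b G)" using fT(1)[OF G] finite_subset by blast
    then show ?thesis by (rule finite_imageD) (simp add: inj_on_def)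
  qed
  have fA: "finite (A G)" if "G \<in> \<G>" for G
    using fT(1)[OF that] by (rule rev_finite_subset) (auto simp: A_def T_def)
  have cover: "T G \<subseteq> g ` backward G \<union> (A G \<union> B False G \<union> rev ` B True G)" if G: "G \<in> \<G>" for G
  proof
    fix ws assume "ws \<in> T G"
    then have ws: "nbwalk G ws" "length ws = 2 * k + 2" "isl (last ws)" by (auto simp: T_def)
    have aw: "alt ws" "pe ws \<subseteq> G" using ws(1) by (auto simp: nbwalk_def)
    have hw: "\<not> isl (hd ws)" using altends[OF aw(1) ws(2)] ws(3) by simp
    have ne: "ws \<noteq> []" using ws by auto
    show "ws \<in> g ` backward G \<union> (A G \<union> B False G \<union> rev ` B True G)"
    proof (cases "distinct ws")
      case False
      then show ?thesis using ws by (auto simp: A_def)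
    next
      case True
      then have path: "is_path G ws" using aw by (simp add: is_path_def)
      consider "short_path_excursion G ws" | "short_path_excursion G (rev ws)"
        | "\<not> short_path_excursion G ws" "\<not> short_path_excursion G (rev ws)" by blast
      then show ?thesis
      proof cases
        case 1
        then show ?thesis using path ws hw by (auto simp: B_def)
      next
        case 2
        then have "rev ws \<in> B True G" using path ws ne by (auto simp: B_def is_path_rev hd_rev)
        then have "ws \<in> rev ` B True G" by (rule rev_image_eqI) simp
        then show ?thesis by simp
      next
        case 3
        define xs where "xs = butlast (tl ws)"
        define d where "d = projr (hd ws)"
        define c where "c = projl (last ws)"
        have tln: "tl ws \<noteq> []" using ws(2) by (cases ws) auto
        have "ws = hd ws # butlast (tl ws) @ [last (tl ws)]" using ne tln by simp
        moreover have "last (tl ws) = last ws" using ne tln by (simp add: last_tl)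
        ultimately have w: "ws = Inr d # xs @ [Inl c]" using hw ws(3) by (simp add: xs_def c_def d_def)
        have lx: "length xs = 2 * k" "xs \<noteq> []" using ws(2) w k by auto
        have ax: "alt xs" "isl (hd xs)" "\<not> isl (last xs)"
          using aw(1) lx unfolding w by (auto simp: alt_Cons alt_append)
        then have e: "hd xs = Inl (la xs)" "last xs = Inr (lb xs)" by auto
        note bg = backward_good[OF path[unfolded w] lx(1) e 3(1)[unfolded w] 3(2)[unfolded w]]
        have peG: "(la xs, d) \<in> G" "(c, lb xs) \<in> G"
          using aw(2) unfolding w pe_extended(1)[OF bg(3)] by auto
        define G' where "G' = swap G (la xs) d c (lb xs)"
        have G': "(la xs, lb xs) \<in> G'" "(c, d) \<in> G'" "(la xs, d) \<notin> G'" "(c, lb xs) \<notin> G'"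
          using peG bg(1,2) by (auto simp: G'_def swap_def)
        have restore: "swap G' (la xs) (lb xs) c d = G" unfolding G'_def using swap_swap peG bg(1,2) by blast
        have abC: "(la xs, lb xs) \<in> cyc xs" using cyc_conv_ends[OF bg(3)] by simp
        have CG: "cyc xs \<in> cycles k G'" using cycles_iff[of k] k bg(3,4) by (auto simp: G'_def)
        have fG': "finite G'" using finite_graph[OF G] by (simp add: G'_def swap_def)
        note cc = cycle_count_swap[OF k fG' CG abC G', unfolded restore]
        have "\<forall>j\<in>{2..<k}. cycle_count j G' = cycle_count j G"
          using cc(1) bg(5,6) unfolding G'_def by metis
        moreover have "cycle_count k G' = Suc (cycle_count k G)"
          using cc(2) bg(5,6) unfolding G'_def by metis
        ultimately have "(xs, c, d) \<in> backward G"
          using bg(1-3) path w by (auto simp: backward_def G'_def)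
        then have "ws \<in> g ` backward G" by (rule rev_image_eqI) (simp add: g_def w)
        then show ?thesis by simp
      qed
    qed
  qed
  have "card \<G> * (n * d1 * DD ^ k) = total T" using fT by simp
  also have "\<dots> \<le> (\<Sum>G\<in>\<G>. card (backward G) + (card (A G) + card (B False G) + card (B True G)))"
  proof (rule sum_mono)
    fix G assume G: "G \<in> \<G>"
    have "card (T G) \<le> card (g ` backward G \<union> (A G \<union> B False G \<union> rev ` B True G))"
      using fb[OF G] fA[OF G] fB[OF G] by (intro card_mono cover G) auto
    also have "\<dots> \<le> card (g ` backward G) + (card (A G) + card (B False G) + card (rev ` B True G))"
      by (meson add_le_mono card_Un_le le_refl order_trans)
    also have "\<dots> \<le> card (backward G) + (card (A G) + card (B False G) + card (B True G))"
      using cg card_image_le[OF fB[OF G], of rev True] by simp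
    finally show "card (T G) \<le> card (backward G) + (card (A G) + card (B False G) + card (B True G))" .
  qed
  also have "\<dots> = total backward + (total A + total (B False) + total (B True))"
    by (simp only: sum.distrib)
  also have "\<dots> \<le> total backward + (10 * k * card \<G> * DD ^ (2 * k) + 192 * k * card \<G> * DD ^ (2 * k) + 192 * k * card \<G> * DD ^ (2 * k))"
    unfolding A_def B_def
    by (intro add_mono expected_nonsimple_walks expected_short_path_excursion order_refl)
  finally show "card \<G> * (n * d1 * DD ^ k) \<le> total backward + 394 * k * card \<G> * DD ^ (2 * k)"
    by simp
qed

end

section \<open>The Stein equation with error terms\<close>

context biregular_setting
begin

text \<open>The bijection keeps the shorter counts, hence \<open>f\<close>, and changes the count
  for \<open>k\<close> by one. This is the Stein identity with the exact numbers of switchings in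
  place of their main terms.\<close>

lemma switching_identity:
  fixes f :: "(nat \<Rightarrow> nat) \<Rightarrow> nat \<Rightarrow> real"
  assumes W: "\<And>G i. i \<in> {2..k} \<Longrightarrow> W G i = cycle_count i G"
    and f: "\<And>w w'. (\<And>i. i \<in> {2..<k} \<Longrightarrow> w i = w' i) \<Longrightarrow> f w = f w'"
  shows "(\<Sum>G\<in>\<G>. real (card (backward G)) * f (W G) (Suc (W G k)))
       = (\<Sum>G\<in>\<G>. real (card (forward G)) * f (W G) (W G k))"
proof -
  have "(\<Sum>G\<in>\<G>. real (card (backward G)) * f (W G) (Suc (W G k)))
     = (\<Sum>G\<in>\<G>. \<Sum>t\<in>backward G. f (W G) (Suc (W G k)))" by simp
  also have "\<dots> = (\<Sum>(G, t)\<in>Sigma \<G> backward. f (W G) (Suc (W G k)))"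
    using backward_bounds(1) by (intro sum.Sigma) auto
  also have "\<dots> = (\<Sum>x\<in>Sigma \<G> forward. (\<lambda>(G, t). f (W G) (Suc (W G k)))
      ((\<lambda>(G, xs, c, d). (swap G (la xs) (lb xs) c d, xs, c, d)) x))"
    by (rule sum.reindex_bij_betw[OF forward_backward_bij, symmetric])
  also have "\<dots> = (\<Sum>(G, t)\<in>Sigma \<G> forward. f (W G) (W G k))"
  proof (rule sum.cong[OF refl], clarify)
    fix G xs c d assume t: "G \<in> \<G>" "(xs, c, d) \<in> forward G"
    let ?G = "swap G (la xs) (lb xs) c d"
    have "f (W ?G) = f (W G)" using t(2) W by (intro f) (auto simp: forward_def)
    moreover have "W G k = Suc (W ?G k)" using t(2) W k by (auto simp: forward_def)
    ultimately show "f (W ?G) (Suc (W ?G k)) = f (W G) (W G k)" by simp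
  qed
  also have "\<dots> = (\<Sum>G\<in>\<G>. \<Sum>t\<in>forward G. f (W G) (W G k))"
    using forward_bounds(1) by (intro sum.Sigma[symmetric]) auto
  finally show ?thesis by simp
qed

lemma stein_step:
  fixes f :: "(nat \<Rightarrow> nat) \<Rightarrow> nat \<Rightarrow> real"
  assumes W: "\<And>G i. i \<in> {2..k} \<Longrightarrow> W G i = cycle_count i G"
    and b: "\<And>w j. \<bar>f w j\<bar> \<le> b"
    and f: "\<And>w w'. (\<And>i. i \<in> {2..<k} \<Longrightarrow> w i = w' i) \<Longrightarrow> f w = f w'"
  shows "\<bar>\<Sum>G\<in>\<G>. real (DD ^ k) / (2 * real k) * f (W G) (Suc (W G k)) - real (W G k) * f (W G) (W G k)\<bar>
         \<le> real (card \<G>) * (b * (263 * real (DD ^ (2 * k)) / real (n * d1)))"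
proof -
  define N where "N = real (n * d1)"
  define c where "c = 2 * real k * N"
  define l where "l = real (DD ^ k) / (2 * real k)"
  \<comment> \<open>\<open>p\<close> and \<open>q\<close> are the shortfalls of the two numbers of
    switchings against their main terms. They are nonnegative in every graph, so bounds on their
    sums suffice even when they are weighted by \<open>f\<close>.\<close>
  define p where "p = (\<lambda>G. l - real (card (backward G)) / c)"
  define q where "q = (\<lambda>G. real (W G k) - real (card (forward G)) / c)"
  have N: "N > 0" using nd1_pos by (simp add: N_def)
  have c: "c > 0" using N k by (simp add: c_def)
  have lc: "l * c = N * real (DD ^ k)" using k by (simp add: l_def c_def)
  have Wk: "W G k = cycle_count k G" for G using W[of k] k by auto
  have p0: "p G \<ge> 0" if "G \<in> \<G>" for G
  proof -
    have "real (card (backward G)) \<le> real (n * d1 * DD ^ k)" using backward_bounds(2)[OF that] by (rule of_nat_mono)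
    then have "real (card (backward G)) \<le> l * c" unfolding lc N_def by simp
    then show ?thesis using c by (simp add: p_def field_simps)
  qed
  have q0: "q G \<ge> 0" if "G \<in> \<G>" for G
  proof -
    have "real (card (forward G)) \<le> real (2 * k * cycle_count k G * (n * d1))"
      using forward_bounds(2)[OF that] by (rule of_nat_mono)
    also have "\<dots> = real (W G k) * c" by (simp add: Wk c_def N_def)
    finally show ?thesis using c by (simp add: q_def field_simps)
  qed
  have sp: "(\<Sum>G\<in>\<G>. p G) \<le> 197 * real (card \<G>) * real (DD ^ (2 * k)) / N"
  proof -
    have "(\<Sum>G\<in>\<G>. p G) = (real (card \<G>) * (l * c) - (\<Sum>G\<in>\<G>. real (card (backward G)))) / c"
      using c by (simp add: p_def sum_subtractf sum_divide_distrib[symmetric] diff_divide_distrib)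
    also have "\<dots> \<le> (394 * real k * real (card \<G>) * real (DD ^ (2 * k))) / c"
    proof (rule divide_right_mono)
      have "real (card \<G> * (n * d1 * DD ^ k)) \<le> real (total backward + 394 * k * card \<G> * DD ^ (2 * k))"
        using backward_bounds(3) by (rule of_nat_mono)
      then show "real (card \<G>) * (l * c) - (\<Sum>G\<in>\<G>. real (card (backward G))) \<le> 394 * real k * real (card \<G>) * real (DD ^ (2 * k))"
        unfolding lc N_def by simp
    qed (use c in simp)
    also have "\<dots> = 197 * real (card \<G>) * real (DD ^ (2 * k)) / N" using k N by (simp add: c_def field_simps)
    finally show ?thesis .
  qed
  have sq: "(\<Sum>G\<in>\<G>. q G) \<le> 66 * real (card \<G>) * real (DD ^ (2 * k)) / N"
  proof -
    have "(\<Sum>G\<in>\<G>. q G) = ((\<Sum>G\<in>\<G>. real (W G k) * c) - (\<Sum>G\<in>\<G>. real (card (forward G)))) / c"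
      using c by (simp add: q_def sum_subtractf sum_divide_distrib[symmetric] sum_distrib_right[symmetric] diff_divide_distrib)
    also have "\<dots> \<le> (132 * real k * real (card \<G>) * real (DD ^ (2 * k))) / c"
    proof (rule divide_right_mono)
      have "real (\<Sum>G\<in>\<G>. 2 * k * cycle_count k G * (n * d1)) \<le> real (total forward + 132 * k * card \<G> * DD ^ (2 * k))"
        using forward_bounds(3) by (rule of_nat_mono)
      moreover have "(\<Sum>G\<in>\<G>. real (W G k) * c) = real (\<Sum>G\<in>\<G>. 2 * k * cycle_count k G * (n * d1))"
        unfolding of_nat_sum by (rule sum.cong) (auto simp: Wk c_def N_def)
      ultimately show "(\<Sum>G\<in>\<G>. real (W G k) * c) - (\<Sum>G\<in>\<G>. real (card (forward G))) \<le> 132 * real k * real (card \<G>) * real (DD ^ (2 * k))"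
        by simp
    qed (use c in simp)
    also have "\<dots> = 66 * real (card \<G>) * real (DD ^ (2 * k)) / N" using k N by (simp add: c_def field_simps)
    finally show ?thesis .
  qed
  have b0: "b \<ge> 0" using b[of "\<lambda>_. 0" 0] by linarith
  have id: "(\<Sum>G\<in>\<G>. real (card (backward G)) / c * f (W G) (Suc (W G k)))
       = (\<Sum>G\<in>\<G>. real (card (forward G)) / c * f (W G) (W G k))"
    using switching_identity[of W f, OF W f] by (simp add: sum_divide_distrib[symmetric])
  have "(\<Sum>G\<in>\<G>. l * f (W G) (Suc (W G k)) - real (W G k) * f (W G) (W G k))
     = (\<Sum>G\<in>\<G>. p G * f (W G) (Suc (W G k))) - (\<Sum>G\<in>\<G>. q G * f (W G) (W G k))"
    using id by (simp add: p_def q_def left_diff_distrib sum_subtractf)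
  also have "\<bar>\<dots>\<bar> \<le> \<bar>\<Sum>G\<in>\<G>. p G * f (W G) (Suc (W G k))\<bar> + \<bar>\<Sum>G\<in>\<G>. q G * f (W G) (W G k)\<bar>"
    by (rule abs_triangle_ineq4)
  also have "\<dots> \<le> (\<Sum>G\<in>\<G>. p G * b) + (\<Sum>G\<in>\<G>. q G * b)"
  proof (rule add_mono)
    show "\<bar>\<Sum>G\<in>\<G>. p G * f (W G) (Suc (W G k))\<bar> \<le> (\<Sum>G\<in>\<G>. p G * b)"
      by (rule order_trans[OF sum_abs], rule sum_mono) (auto simp: abs_mult p0 intro!: mult_left_mono b)
    show "\<bar>\<Sum>G\<in>\<G>. q G * f (W G) (W G k)\<bar> \<le> (\<Sum>G\<in>\<G>. q G * b)"
      by (rule order_trans[OF sum_abs], rule sum_mono) (auto simp: abs_mult q0 intro!: mult_left_mono b)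
  qed
  also have "\<dots> = ((\<Sum>G\<in>\<G>. p G) + (\<Sum>G\<in>\<G>. q G)) * b" by (simp add: sum_distrib_right distrib_right)
  \<comment> \<open>263 = (394 + 132) / 2; the factor \<open>k\<close> of the failure counts has
    cancelled against \<open>c = 2 * k * N\<close>.\<close>
  also have "\<dots> \<le> (197 * real (card \<G>) * real (DD ^ (2 * k)) / N + 66 * real (card \<G>) * real (DD ^ (2 * k)) / N) * b"
    by (intro mult_right_mono add_mono sp sq b0)
  also have "\<dots> = real (card \<G>) * (b * (263 * real (DD ^ (2 * k)) / N))"
    using N by (simp add: field_simps)
  finally show ?thesis by (simp only: l_def N_def)
qed

lemma poisson_mean_ge_1: "real (DD ^ k) / (2 * real k) \<ge> 1"
proof -
  have "2 * k \<le> DD * DD ^ (k - 1)" using DD2 k_le_DD_pow by (rule mult_mono) auto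
  also have "\<dots> = DD ^ k" using k by (simp flip: power_Suc)
  finally have "real (2 * k) \<le> real (DD ^ k)" by (rule of_nat_mono)
  then show ?thesis using k by (simp add: field_simps)
qed

end

section \<open>The main theorem\<close>

lemma d_TV_le_1: "d_TV p q \<le> 1"
proof -
  have "\<bar>measure_pmf.prob p A - measure_pmf.prob q A\<bar> \<le> 1" for A
    using measure_pmf.prob_le_1[of p A] measure_pmf.prob_le_1[of q A]
      measure_nonneg[of "measure_pmf p" A] measure_nonneg[of "measure_pmf q" A] by linarith
  then show ?thesis unfolding d_TV_def by (intro cSUP_least) auto
qed

lemma d_TV_self: "d_TV p p = 0"
  by (simp add: d_TV_def)

lemma no_cycles_degree_one:
  assumes "biregular n m d1 1 E" "j \<ge> 2"
  shows "cycle_count j E = 0"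
proof -
  have "cycles j E = {}"
  proof (rule ccontr)
    assume "cycles j E \<noteq> {}"
    then obtain u v where uv: "inj_on u {0..<j}" "cycle_edges j u v \<subseteq> E" by (auto simp: cycles_def)
    have "(u 0, v 0) \<in> cycle_edges j u v" using assms(2) by (auto simp: cycle_edges_def)
    moreover have "(u ((0 + 1) mod j), v 0) \<in> cycle_edges j u v"
      unfolding cycle_edges_def using assms(2) by (intro UnI2 image_eqI[of _ _ 0]) auto
    moreover have "(0 + 1) mod j = 1" using assms(2) by simp
    ultimately have sub: "{u 0, u 1} \<subseteq> {x. (x, v 0) \<in> E}" using uv(2) by auto
    have "u 0 \<noteq> u 1" using inj_onD[OF uv(1), of 0 1] assms(2) by auto
    then have "card {u 0, u 1} = 2" by simp
    moreover have "card {u 0, u 1} \<le> card {x. (x, v 0) \<in> E}"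
      using biregular_finite_nbrs(2)[OF assms(1)] sub by (intro card_mono) auto
    ultimately show False using biregular_card_nbrs_le(2)[OF assms(1), of "v 0"] by simp
  qed
  then show ?thesis by (simp add: cycle_count_def)
qed

text \<open>For \<open>d2 = 1\<close> the graph is a union of stars and has no cycles; every mean is
  0, and \<open>poisson 0\<close> is the point mass at 0. The switching argument needs
  \<open>DD \<ge> 2\<close>, so this case is separate.\<close>

lemma degree_one_laws_agree:
  assumes "biregular_graphs n m d1 1 \<noteq> {}"
  shows "cycle_law n m d1 1 r = poisson_law d1 1 r"
proof -
  have "cycle_law n m d1 1 r = map_pmf (\<lambda>_. \<lambda>_. 0) (pmf_of_set (biregular_graphs n m d1 1))"
    unfolding cycle_law_def using assms finite_biregular_graphs no_cycles_degree_one
    by (intro map_pmf_cong) (auto simp: biregular_graphs_def fun_eq_iff)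
  moreover have "poisson_law d1 1 r = Pi_pmf {2..r} 0 (\<lambda>_. return_pmf 0)"
    unfolding poisson_law_def by (intro Pi_pmf_cong) (auto simp: poisson_def mu_def power_0_left)
  ultimately show ?thesis by (simp add: map_pmf_const)
qed

lemma square_le_two_power: "r * r \<le> 2 * 2 ^ (r :: nat)"
proof (cases "r \<ge> 3")
  case True
  then show ?thesis
  proof (induction r rule: nat_induct_at_least)
    case (Suc r)
    have "3 * r \<le> r * r" using Suc by (intro mult_right_mono) auto
    moreover have "Suc r * Suc r = r * r + 2 * r + 1" by simp
    ultimately have "Suc r * Suc r \<le> 2 * (r * r)" using Suc by linarith
    then show ?case using Suc by simp
  qed simp
next
  case False
  then have "r = 0 \<or> r = 1 \<or> r = 2" by auto
  then show ?thesis by auto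
qed

lemma sum_powers_le:
  fixes x :: real assumes "x \<ge> 2"
  shows "(\<Sum>k=2..r. x ^ k) \<le> 2 * x ^ r"
proof (induction r)
  case (Suc r)
  have "(\<Sum>k=2..Suc r. x ^ k) \<le> 2 * x ^ r + x ^ Suc r"
    using Suc assms by (cases "2 \<le> Suc r") (auto simp: sum.cl_ivl_Suc)
  also have "2 * x ^ r \<le> x ^ Suc r" using assms by (simp add: mult_right_mono)
  finally show ?case by simp
qed simp

lemma powr_three_halves:
  fixes D :: real assumes "D > 0" shows "D powr (3 * real r / 2) = (sqrt D ^ 3) ^ r"
proof -
  have "sqrt D ^ (3 * r) = (D powr (1 / 2)) powr (real (3 * r))"
    using assms powr_realpow[of "sqrt D" "3 * r"] by (simp add: powr_half_sqrt)
  then show ?thesis using assms by (simp add: powr_powr power_mult)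
qed

theorem theorem2p10:
  shows "\<exists>c6 > 0. \<forall>n m d1 d2 r :: nat.
     n \<ge> 1 \<longrightarrow> m \<ge> 1 \<longrightarrow> r \<ge> 2 \<longrightarrow> d1 \<ge> 3 \<longrightarrow> n * d1 = m * d2 \<longrightarrow>
     biregular_graphs n m d1 d2 \<noteq> {} \<longrightarrow>
     d_TV (cycle_law n m d1 d2 r) (poisson_law d1 d2 r)
       \<le> c6 * sqrt (real r) * (real d1 - 1) powr (3 * real r / 2) * (real d2 - 1) powr (3 * real r / 2)
          / (real n * real d1)"
proof (intro exI[of _ "1600 :: real"] conjI allI impI)
  fix n m d1 d2 r :: nat
  assume n: "n \<ge> 1" and m: "m \<ge> 1" and r: "r \<ge> 2" and d1: "d1 \<ge> 3" and eq: "n * d1 = m * d2"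
    and ne: "biregular_graphs n m d1 d2 \<noteq> {}"
  define R where "R = 1600 * sqrt (real r) * (real d1 - 1) powr (3 * real r / 2) * (real d2 - 1) powr (3 * real r / 2)
          / (real n * real d1)"
  have d2: "d2 \<ge> 1" using eq n d1 by (cases d2) auto
  show "d_TV (cycle_law n m d1 d2 r) (poisson_law d1 d2 r) \<le> R"
  proof (cases "d2 = 1")
    case True
    then show ?thesis using degree_one_laws_agree[of n m d1 r] ne by (simp add: d_TV_self R_def)
  next
    case False
    then have d2: "d2 \<ge> 2" using d2 by simp
    define D where "D = (d1 - 1) * (d2 - 1)"
    define N where "N = real (n * d1)"
    define x where "x = sqrt (real D) ^ 3"
    have Dr: "real D = (real d1 - 1) * (real d2 - 1)" using d1 d2 by (simp add: D_def of_nat_diff)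
    have "2 * 1 \<le> D" unfolding D_def using d1 d2 by (intro mult_mono) auto
    then have D2: "D \<ge> 2" "real D \<ge> 2" by simp_all
    have N: "N > 0" using n d1 by (simp add: N_def)
    have "1 \<le> sqrt (real D)" using D2 by simp
    then have "1 * 2 \<le> sqrt (real D) * real D" using D2 by (intro mult_mono) auto
    then have x2: "x \<ge> 2" using D2 by (simp add: x_def power3_eq_cube mult.commute)
    have "(real d1 - 1) powr (3 * real r / 2) * (real d2 - 1) powr (3 * real r / 2) = real D powr (3 * real r / 2)"
      unfolding Dr using d1 d2 by (simp add: powr_mult)
    also have "\<dots> = x ^ r" unfolding x_def using D2 by (intro powr_three_halves) simp
    finally have R: "R = 1600 * sqrt (real r) * x ^ r / N" by (simp add: R_def N_def mult.assoc)
    have sr: "sqrt (real r) \<ge> 1" using r by simp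
    show ?thesis
    proof (cases "8 * r * (4 * r + 2 * d1 * d2) \<le> n * d1")
      \<comment> \<open>Here \<open>n * d1\<close> is below \<open>80 * D ^ (r + 1)\<close>, and
        \<open>r + 1 \<le> 3 * r / 2\<close> because \<open>r \<ge> 2\<close>. Hence
        \<open>R\<close> is at least 1 and the trivial bound on \<open>d_TV\<close>
        suffices.\<close>
      case False
      have "d1 * d2 \<le> 3 * D"
      proof -
        have "(2 * d1) * d2 \<le> (3 * (d1 - 1)) * (2 * (d2 - 1))" 
          by (rule mult_mono) (use d1 d2 in auto)
        then show ?thesis by (simp add: D_def)
      qed
      then have "4 * r + 2 * d1 * d2 \<le> 4 * r + 6 * D" by simp
      also have "\<dots> \<le> 5 * (r * D)"
      proof -
        have "r * 2 \<le> r * D" using D2 by (intro mult_left_mono) auto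
        moreover have "2 * D \<le> r * D" using r by (intro mult_right_mono) auto
        ultimately show ?thesis by linarith
      qed
      finally have "8 * r * (4 * r + 2 * d1 * d2) \<le> 8 * r * (5 * (r * D))" by (rule mult_left_mono) simp
      also have "\<dots> = 40 * (r * r) * D" by simp
      also have "\<dots> \<le> 40 * (2 * 2 ^ r) * D" by (intro mult_right_mono mult_left_mono square_le_two_power) auto
      also have "\<dots> \<le> 40 * (2 * D ^ r) * D" using D2 by (intro mult_right_mono mult_left_mono power_mono) auto
      finally have "8 * r * (4 * r + 2 * d1 * d2) \<le> 80 * D ^ Suc r" by simp
      then have "n * d1 \<le> 80 * D ^ Suc r" using False by linarith
      then have "N \<le> real (80 * D ^ Suc r)" unfolding N_def by (rule of_nat_mono)
      also have "\<dots> = 80 * sqrt (real D) ^ (2 * Suc r)"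
        unfolding power_mult by simp
      also have "\<dots> \<le> 80 * sqrt (real D) ^ (3 * r)"
        using \<open>1 \<le> sqrt (real D)\<close> r by (intro mult_left_mono power_increasing) auto
      also have "\<dots> = 80 * 1 * x ^ r" by (simp add: x_def power_mult)
      also have "\<dots> \<le> 1600 * sqrt (real r) * x ^ r"
        using sr x2 by (intro mult_right_mono mult_mono) auto
      finally have "1 \<le> R" unfolding R using N by (simp add: field_simps)
      then show ?thesis using d_TV_le_1 order_trans by blast
    next
      case True
      define W where "W = (\<lambda>E k. if k \<in> {2..r} then cycle_count k E else 0)"
      define S where "S = biregular_graphs n m d1 d2"
      define l where "l = (\<lambda>k. real (D ^ k) / (2 * real k))"
      define B where "B = (\<lambda>k. 263 * real (D ^ (2 * k)) / N)"
      have loc: "biregular_setting n m d1 d2 k" if "k \<in> {2..r}" for k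
      proof
        have "8 * k * (4 * k + 2 * d1 * d2) \<le> 8 * r * (4 * r + 2 * d1 * d2)"
          using that by (intro mult_mono) auto
        then show "8 * k * (4 * k + 2 * d1 * d2) \<le> n * d1" using True by linarith
      qed (use eq d1 d2 that in auto)
      have DD: "biregular_setting.DD d1 d2 = D" if "k \<in> {2..r}" for k
        using biregular_setting.DD_def[OF loc[OF that]] by (simp add: D_def)
      have "d_TV (map_pmf W (pmf_of_set S)) (Pi_pmf {2..r} 0 (\<lambda>k. poisson_pmf (l k)))
           \<le> (\<Sum>k=2..r. 2 / sqrt (l k) * B k)"
      proof (rule d_TV_poisson_product)
        show "finite S" by (simp add: S_def finite_biregular_graphs)
        show "S \<noteq> {}" using ne by (simp add: S_def)
        show "W G i = 0" if "i \<notin> {2..r}" for G i using that by (auto simp: W_def)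
        show "l k \<ge> 1" if k: "k \<in> {2..r}" for k
          using biregular_setting.poisson_mean_ge_1[OF loc[OF k]] by (simp add: l_def DD[OF k])
        show "\<bar>\<Sum>G\<in>S. l k * f (W G) (Suc (W G k)) - real (W G k) * f (W G) (W G k)\<bar>
         \<le> real (card S) * (b * B k)"
          if k: "k \<in> {2..r}" and b: "\<And>w j. \<bar>f w j\<bar> \<le> b"
           and f: "\<And>w w'. (\<And>i. i \<in> {2..<k} \<Longrightarrow> w i = w' i) \<Longrightarrow> f w = f w'"
          for k and f :: "(nat \<Rightarrow> nat) \<Rightarrow> nat \<Rightarrow> real" and b
        proof -
          have W: "W G i = cycle_count i G" if "i \<in> {2..k}" for G i using that k by (auto simp: W_def)
          show ?thesis
            using biregular_setting.stein_step[OF loc[OF k], of W f b, OF W b f]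
            unfolding DD[OF k] l_def B_def S_def N_def by simp
        qed
      qed
      also have "map_pmf W (pmf_of_set S) = cycle_law n m d1 d2 r"
        unfolding cycle_law_def W_def S_def ..
      also have "Pi_pmf {2..r} 0 (\<lambda>k. poisson_pmf (l k)) = poisson_law d1 d2 r"
        unfolding poisson_law_def
      proof (intro Pi_pmf_cong refl)
        fix k assume "k \<in> {2..r}"
        then have "l k > 0" using D2 by (simp add: l_def)
        moreover have "mu d1 d2 k = l k" by (simp add: mu_def l_def Dr power_mult_distrib)
        ultimately show "poisson_pmf (l k) = poisson (mu d1 d2 k)" by (simp add: poisson_def)
      qed
      also have "(\<Sum>k=2..r. 2 / sqrt (l k) * B k) \<le> (\<Sum>k=2..r. 800 * sqrt (real r) / N * x ^ k)"
      proof (rule sum_mono)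
        fix k assume k: "k \<in> {2..r}"
        define y where "y = sqrt (real D)"
        have y: "y > 0" using D2 by (simp add: y_def)
        have y2: "real D = y ^ 2" using D2 by (simp add: y_def)
        have "real (D ^ k) = (y ^ k) ^ 2" by (simp add: y2 power_mult[symmetric] mult.commute)
        then have "sqrt (l k) = y ^ k / sqrt (2 * real k)"
          using y by (simp add: l_def real_sqrt_divide)
        moreover have "x = y ^ 3" by (simp add: x_def y_def)
        then have "real (D ^ (2 * k)) = y ^ k * x ^ k"
          using y2 by (simp flip: power_mult power_add)
        \<comment> \<open>\<open>1 / sqrt (l k)\<close> cancels a factor \<open>D ^ (k / 2)\<close>
          of \<open>D ^ (2 * k)\<close> and leaves \<open>x ^ k\<close>; 526 = 2 * 263.\<close>
        ultimately have "2 / sqrt (l k) * B k = 526 * sqrt (2 * real k) / N * x ^ k"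
          using y N by (simp add: B_def field_simps)
        also have "\<dots> \<le> 800 * sqrt (real r) / N * x ^ k"
        proof (intro mult_right_mono divide_right_mono)
          \<comment> \<open>\<open>sqrt 2 \<le> 3 / 2\<close>, and 526 * 3 / 2 = 789 is rounded up
            to 800.\<close>
          have "sqrt (2 * real k) \<le> sqrt ((3 / 2)\<^sup>2 * real r)" using k by (simp add: power2_eq_square)
          also have "\<dots> = 3 / 2 * sqrt (real r)" by (simp add: real_sqrt_mult real_sqrt_divide)
          finally have "526 * sqrt (2 * real k) \<le> 526 * (3 / 2 * sqrt (real r))" by simp
          also have "\<dots> \<le> 800 * sqrt (real r)" by simp
          finally show "526 * sqrt (2 * real k) \<le> 800 * sqrt (real r)" .
        qed (use N x2 in auto)
        finally show "2 / sqrt (l k) * B k \<le> 800 * sqrt (real r) / N * x ^ k" .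
      qed
      also have "\<dots> = 800 * sqrt (real r) / N * (\<Sum>k=2..r. x ^ k)" by (simp add: sum_distrib_left)
      \<comment> \<open>As \<open>x \<ge> 2\<close>, the longest cycles dominate the sum up to a
        factor 2, whence 1600.\<close>
      also have "\<dots> \<le> 800 * sqrt (real r) / N * (2 * x ^ r)"
        using N by (intro mult_left_mono sum_powers_le x2) auto
      also have "\<dots> = R" by (simp add: R)
      finally show ?thesis .
    qed
  qed
qed simp

end
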